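(* Let $G$ be a finite simple connected graph with edge set $E(G)=\{e_1,\dots,e_m\}$, let $I_G\subseteq \mathbb{K}[e_1,\dots,e_m]$ be its toric ideal, and let $w$ be an even closed primitive walk of $G$. Then $B_w$ belongs to the universal Gr\"obner basis of $I_G$ if and only if $w$ is mixed, i.e. no cyclic block of the graph $\mathbf{w}$ is pure.
   Context: $\mathbb{K}$ is a field. To each edge $e=\{v_i,v_j\}$ of $G$ associate the vector $a_e=v_i+v_j$ in the free abelian group on the vertices of $G$; the toric ideal $I_G$ is the ideal generated by all binomials $\mathbf{e}^{u}-\mathbf{e}^{v}$ with $\sum u_k a_{e_k}=\sum v_k a_{e_k}$. A walk is a sequence of edges $(e_{i_1},\dots,e_{i_q})$ with $e_{i_j}=\{v_{i_j},v_{i_{j+1}}\}$; it is closed if $v_{i_{q+1}}=v_{i_1}$ and even if $q$ is even (edges may repeat). For an even closed walk $w=(e_{i_1},\dots,e_{i_{2q}})$ put $E^+(w)=\prod_{k=1}^q e_{i_{2k-1}}$, $E^-(w)=\prod_{k=1}^q e_{i_{2k}}$ and $B_w=E^+(w)-E^-(w)\in I_G$. The walk $w$ (and $B_w$) is primitive if there is no binomial $\mathbf{e}^u-\mathbf{e}^v\in I_G$ other than $B_w$ with $\mathbf{e}^u\mid E^+(w)$ and $\mathbf{e}^v\mid E^-(w)$. For a primitive walk, the sets $\mathbf{w}^+=\{e_{i_j}: j \text{ odd}\}$ and $\mathbf{w}^-=\{e_{i_j}: j\text{ even}\}$ are disjoint. $\mathbf{w}$ denotes the subgraph of $G$ whose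 vertices and edges are those of $w$. A block of a graph is a maximal connected subgraph without a cut vertex; a cyclic block is a block that is a cycle. A cyclic block $B$ of $\mathbf{w}$ is pure if all its edges lie in $\mathbf{w}^+$ or all lie in $\mathbf{w}^-$. The universal Gr\"obner basis of an ideal is the union of all its reduced Gr\"obner bases over all term orders. *)

theory Defs
  imports Main "HOL-Library.Poly_Mapping"
begin

(* ===== Graphs: vertices of type 'v, edges are 2-element vertex sets ===== *)

definition simple_graph :: "'v set \<Rightarrow> 'v set set \<Rightarrow> bool" where
  "simple_graph V E \<longleftrightarrow> finite V \<and> (\<forall>e\<in>E. card e = 2 \<and> e \<subseteq> V)"

definition adj_rel :: "'v set set \<Rightarrow> ('v \<times> 'v) set" where
  "adj_rel E = {(a, b). {a, b} \<in> E}"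

(* connected (the empty graph counts as connected) *)
definition connected_graph :: "'v set \<Rightarrow> 'v set set \<Rightarrow> bool" where
  "connected_graph V E \<longleftrightarrow> (\<forall>x\<in>V. \<forall>y\<in>V. (x, y) \<in> (adj_rel E)\<^sup>*)"

(* H = (VH, EH) is a subgraph of (V, E) *)
definition subgraph :: "'v set \<Rightarrow> 'v set set \<Rightarrow> 'v set \<Rightarrow> 'v set set \<Rightarrow> bool" where
  "subgraph VH EH V E \<longleftrightarrow> VH \<subseteq> V \<and> EH \<subseteq> E \<and> (\<forall>e\<in>EH. e \<subseteq> VH)"

(* connected and without a cut vertex: deleting any vertex leaves it connected *)
definition no_cut_vertex :: "'v set \<Rightarrow> 'v set set \<Rightarrow> bool" where
  "no_cut_vertex VH EH \<longleftrightarrow> connected_graph VH EH \<and>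
     (\<forall>x\<in>VH. connected_graph (VH - {x}) {e\<in>EH. x \<notin> e})"

(* block: maximal connected subgraph without a cut vertex *)
definition is_block :: "'v set \<Rightarrow> 'v set set \<Rightarrow> 'v set \<Rightarrow> 'v set set \<Rightarrow> bool" where
  "is_block V E VH EH \<longleftrightarrow> subgraph VH EH V E \<and> VH \<noteq> {} \<and> no_cut_vertex VH EH \<and>
     (\<forall>VH' EH'. subgraph VH' EH' V E \<and> no_cut_vertex VH' EH' \<and> VH \<subseteq> VH' \<and> EH \<subseteq> EH'
        \<longrightarrow> VH' = VH \<and> EH' = EH)"

(* a (simple) graph that is a cycle *)
definition is_cycle :: "'v set \<Rightarrow> 'v set set \<Rightarrow> bool" where
  "is_cycle VH EH \<longleftrightarrow> finite VH \<and> card VH \<ge> 3 \<and> connected_graph VH EH \<and>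
     (\<forall>x\<in>VH. card {e\<in>EH. x \<in> e} = 2)"

definition cyclic_block :: "'v set \<Rightarrow> 'v set set \<Rightarrow> 'v set \<Rightarrow> 'v set set \<Rightarrow> bool" where
  "cyclic_block V E VH EH \<longleftrightarrow> is_block V E VH EH \<and> is_cycle VH EH"

(* ===== Walks: a walk is given by its vertex sequence v_1, ..., v_{q+1};
   its j-th edge (0-indexed) is {ws!j, ws!(j+1)} ===== *)

definition walk_edge :: "'v list \<Rightarrow> nat \<Rightarrow> 'v set" where
  "walk_edge ws j = {ws ! j, ws ! Suc j}"

definition walk_len :: "'v list \<Rightarrow> nat" where
  "walk_len ws = length ws - 1"

definition even_closed_walk :: "'v set set \<Rightarrow> 'v list \<Rightarrow> bool" where
  "even_closed_walk E ws \<longleftrightarrow> length ws \<ge> 2 \<and> (\<forall>j < walk_len ws. walk_edge ws j \<in> E) \<and>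
     last ws = hd ws \<and> even (walk_len ws)"

(* edges in odd positions (1-indexed) / even positions (1-indexed) *)
definition walk_plus_edges :: "'v list \<Rightarrow> 'v set set" where
  "walk_plus_edges ws = {walk_edge ws j | j. j < walk_len ws \<and> even j}"

definition walk_minus_edges :: "'v list \<Rightarrow> 'v set set" where
  "walk_minus_edges ws = {walk_edge ws j | j. j < walk_len ws \<and> odd j}"

(* exponent vectors of E^+(w) and E^-(w) *)
definition Eplus :: "'v list \<Rightarrow> ('v set \<Rightarrow>\<^sub>0 nat)" where
  "Eplus ws = (\<Sum>j \<in> {j. j < walk_len ws \<and> even j}. Poly_Mapping.single (walk_edge ws j) 1)"

definition Eminus :: "'v list \<Rightarrow> ('v set \<Rightarrow>\<^sub>0 nat)" where
  "Eminus ws = (\<Sum>j \<in> {j. j < walk_len ws \<and> odd j}. Poly_Mapping.single (walk_edge ws j) 1)"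

(* the graph \<^bold>w *)
definition walk_vertices :: "'v list \<Rightarrow> 'v set" where
  "walk_vertices ws = set ws"

definition walk_edges :: "'v list \<Rightarrow> 'v set set" where
  "walk_edges ws = {walk_edge ws j | j. j < walk_len ws}"

definition pure_block :: "'v list \<Rightarrow> 'v set set \<Rightarrow> bool" where
  "pure_block ws EH \<longleftrightarrow> EH \<subseteq> walk_plus_edges ws \<or> EH \<subseteq> walk_minus_edges ws"

definition mixed_walk :: "'v list \<Rightarrow> bool" where
  "mixed_walk ws \<longleftrightarrow> (\<forall>VH EH. cyclic_block (walk_vertices ws) (walk_edges ws) VH EH
                           \<longrightarrow> \<not> pure_block ws EH)"

(* ===== Monomials and polynomials in the variables E ===== *)

definition mons :: "'x set \<Rightarrow> ('x \<Rightarrow>\<^sub>0 nat) set" where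
  "mons X = {m. Poly_Mapping.keys m \<subseteq> X}"

definition polys :: "'x set \<Rightarrow> (('x \<Rightarrow>\<^sub>0 nat) \<Rightarrow>\<^sub>0 'k::zero) set" where
  "polys X = {p. Poly_Mapping.keys p \<subseteq> mons X}"

(* the monomial e^u as a polynomial *)
definition monom :: "('x \<Rightarrow>\<^sub>0 nat) \<Rightarrow> (('x \<Rightarrow>\<^sub>0 nat) \<Rightarrow>\<^sub>0 'k::{zero,one})" where
  "monom u = Poly_Mapping.single u 1"

definition binom :: "('x \<Rightarrow>\<^sub>0 nat) \<Rightarrow> ('x \<Rightarrow>\<^sub>0 nat) \<Rightarrow> (('x \<Rightarrow>\<^sub>0 nat) \<Rightarrow>\<^sub>0 'k::ring_1)" where
  "binom u v = monom u - monom v"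

(* monomial divisibility *)
definition mdvd :: "('x \<Rightarrow>\<^sub>0 nat) \<Rightarrow> ('x \<Rightarrow>\<^sub>0 nat) \<Rightarrow> bool" where
  "mdvd m n \<longleftrightarrow> (\<forall>x. Poly_Mapping.lookup m x \<le> Poly_Mapping.lookup n x)"

(* ideal of K[X] generated by S \<subseteq> K[X] *)
definition ideal_gen :: "'x set \<Rightarrow> (('x \<Rightarrow>\<^sub>0 nat) \<Rightarrow>\<^sub>0 'k::comm_ring_1) set
                           \<Rightarrow> (('x \<Rightarrow>\<^sub>0 nat) \<Rightarrow>\<^sub>0 'k) set" where
  "ideal_gen X S = {p. \<exists>F c. finite F \<and> F \<subseteq> S \<and> (\<forall>s\<in>F. c s \<in> polys X) \<and> p = (\<Sum>s\<in>F. c s * s)}"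

(* ===== Toric ideal of a graph ===== *)

(* \<Sum> u_k a_{e_k} = \<Sum> v_k a_{e_k}: every vertex has the same weighted degree *)
definition balanced :: "'v set set \<Rightarrow> ('v set \<Rightarrow>\<^sub>0 nat) \<Rightarrow> ('v set \<Rightarrow>\<^sub>0 nat) \<Rightarrow> bool" where
  "balanced E u v \<longleftrightarrow> (\<forall>x. (\<Sum>e\<in>{e\<in>E. x \<in> e}. Poly_Mapping.lookup u e) = (\<Sum>e\<in>{e\<in>E. x \<in> e}. Poly_Mapping.lookup v e))"

definition toric_ideal :: "'v set set \<Rightarrow> (('v set \<Rightarrow>\<^sub>0 nat) \<Rightarrow>\<^sub>0 'k::comm_ring_1) set" where
  "toric_ideal E = ideal_gen E {binom u v | u v. u \<in> mons E \<and> v \<in> mons E \<and> balanced E u v}"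

(* primitive even closed walk: B_w is a (nonzero) binomial and no other binomial
   e^u - e^v of I_G has e^u | E^+(w), e^v | E^-(w) *)
definition primitive_walk :: "'v set set \<Rightarrow> 'v list \<Rightarrow> bool" where
  "primitive_walk E ws \<longleftrightarrow> Eplus ws \<noteq> Eminus ws \<and>
     (\<forall>u v. u \<in> mons E \<and> v \<in> mons E \<and> balanced E u v \<and> u \<noteq> v \<and>
            mdvd u (Eplus ws) \<and> mdvd v (Eminus ws) \<longrightarrow> u = Eplus ws \<and> v = Eminus ws)"

(* ===== Term orders, Groebner bases ===== *)

(* ord m n means m \<preceq> n; a term order on the monomials of K[X] *)
definition term_order :: "'x set \<Rightarrow> (('x \<Rightarrow>\<^sub>0 nat) \<Rightarrow> ('x \<Rightarrow>\<^sub>0 nat) \<Rightarrow> bool) \<Rightarrow> bool" where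
  "term_order X ord \<longleftrightarrow>
     (\<forall>m\<in>mons X. ord m m) \<and>
     (\<forall>m\<in>mons X. \<forall>n\<in>mons X. ord m n \<and> ord n m \<longrightarrow> m = n) \<and>
     (\<forall>m\<in>mons X. \<forall>n\<in>mons X. \<forall>l\<in>mons X. ord m n \<and> ord n l \<longrightarrow> ord m l) \<and>
     (\<forall>m\<in>mons X. \<forall>n\<in>mons X. ord m n \<or> ord n m) \<and>
     (\<forall>m\<in>mons X. ord 0 m) \<and>
     (\<forall>m\<in>mons X. \<forall>n\<in>mons X. \<forall>l\<in>mons X. ord m n \<longrightarrow> ord (m + l) (n + l)) \<and>
     wf {(m, n). m \<in> mons X \<and> n \<in> mons X \<and> ord m n \<and> m \<noteq> n}"

(* leading monomial and leading coefficient *)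
definition lm :: "(('x \<Rightarrow>\<^sub>0 nat) \<Rightarrow> ('x \<Rightarrow>\<^sub>0 nat) \<Rightarrow> bool) \<Rightarrow> (('x \<Rightarrow>\<^sub>0 nat) \<Rightarrow>\<^sub>0 'k::zero)
                   \<Rightarrow> ('x \<Rightarrow>\<^sub>0 nat)" where
  "lm ord p = (THE m. m \<in> Poly_Mapping.keys p \<and> (\<forall>n\<in>Poly_Mapping.keys p. ord n m))"

definition lc :: "(('x \<Rightarrow>\<^sub>0 nat) \<Rightarrow> ('x \<Rightarrow>\<^sub>0 nat) \<Rightarrow> bool) \<Rightarrow> (('x \<Rightarrow>\<^sub>0 nat) \<Rightarrow>\<^sub>0 'k::zero) \<Rightarrow> 'k" where
  "lc ord p = Poly_Mapping.lookup p (lm ord p)"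

definition is_groebner_basis :: "(('x \<Rightarrow>\<^sub>0 nat) \<Rightarrow> ('x \<Rightarrow>\<^sub>0 nat) \<Rightarrow> bool)
     \<Rightarrow> (('x \<Rightarrow>\<^sub>0 nat) \<Rightarrow>\<^sub>0 'k::comm_ring_1) set \<Rightarrow> (('x \<Rightarrow>\<^sub>0 nat) \<Rightarrow>\<^sub>0 'k) set \<Rightarrow> bool" where
  "is_groebner_basis ord I G \<longleftrightarrow> finite G \<and> G \<subseteq> I \<and> 0 \<notin> G \<and>
     (\<forall>f\<in>I. f \<noteq> 0 \<longrightarrow> (\<exists>g\<in>G. mdvd (lm ord g) (lm ord f)))"

(* reduced: monic, and no monomial of g' is divisible by lm g for g \<noteq> g' *)
definition is_reduced_groebner_basis :: "(('x \<Rightarrow>\<^sub>0 nat) \<Rightarrow> ('x \<Rightarrow>\<^sub>0 nat) \<Rightarrow> bool)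
     \<Rightarrow> (('x \<Rightarrow>\<^sub>0 nat) \<Rightarrow>\<^sub>0 'k::comm_ring_1) set \<Rightarrow> (('x \<Rightarrow>\<^sub>0 nat) \<Rightarrow>\<^sub>0 'k) set \<Rightarrow> bool" where
  "is_reduced_groebner_basis ord I G \<longleftrightarrow> is_groebner_basis ord I G \<and>
     (\<forall>g\<in>G. lc ord g = 1) \<and>
     (\<forall>g\<in>G. \<forall>g'\<in>G. g \<noteq> g' \<longrightarrow> (\<forall>m\<in>Poly_Mapping.keys g'. \<not> mdvd (lm ord g) m))"

(* universal Groebner basis of an ideal I of K[X] *)
definition universal_groebner_basis :: "'x set \<Rightarrow> (('x \<Rightarrow>\<^sub>0 nat) \<Rightarrow>\<^sub>0 'k::comm_ring_1) set
     \<Rightarrow> (('x \<Rightarrow>\<^sub>0 nat) \<Rightarrow>\<^sub>0 'k) set" where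
  "universal_groebner_basis X I =
     \<Union>{G. \<exists>ord. term_order X ord \<and> is_reduced_groebner_basis ord I G}"

end

theory Submission
  imports Defs Complex_Main
begin

text \<open>
Let \<open>b\<close> be the exponent vector of \<open>B_w\<close>. Two occurrences of a vertex at positions of equal parity, or two
pairs of occurrences that cross, would split off a smaller even closed walk, so by primitivity
the repeated vertices form a noncrossing system of chords of the walk. A chord cuts the graph
of the walk at its vertex into two sides, hence all blocks with at least three vertices are
cycles, and \<open>b\<close> takes the values \<open>1\<close> and \<open>-1\<close> on them.

If a cyclic block \<open>C\<close> is pure of sign \<open>s\<close>, a part of the walk hangs off every vertex of \<open>C\<close>, and
\<open>b\<close> is \<open>s\<close> times the indicator of \<open>C\<close> plus the restrictions \<open>d x\<close> of \<open>b\<close> to these parts. For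
an edge \<open>t = {x, y}\<close> of \<open>C\<close> the vector \<open>g t = 2 s t + d x + d y\<close> is balanced. The sum of all \<open>g t\<close>
is \<open>2 b\<close> and that of all \<open>b - g t\<close> is \<open>(card C - 2) b\<close>, while one monomial of each of the binomials of
these vectors properly divides, for \<open>s = 1\<close>, \<open>E^-\<close> respectively \<open>E^+\<close>. So neither term of \<open>B_w\<close> can be the
leading term of an element of a reduced Groebner basis.

If every cyclic block is mixed, each contains a vertex of degree 2, so a balanced vector \<open>h\<close> with
\<open>E^- + h \<ge> 0\<close> has \<open>t_C = h(p_C) \<in> {0, 1}\<close> at the positive edge \<open>p_C\<close> there. Parity gives \<open>h \<ge> t_C b\<close> on \<open>C\<close>.
The linear functional that sums \<open>h(e) - t_C b(e)\<close> over all \<open>C\<close> and all \<open>e \<in> C\<close> is therefore nonnegative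
on the fiber of \<open>E^-\<close>. Where it vanishes, \<open>h\<close> is proportional to \<open>b\<close>, which is seen by
following the walk. Thus the two terms of \<open>B_w\<close> span an edge of the convex hull of their fiber.
\<close>

section \<open>Ears and blocks\<close>

lemma adj_rtrancl_sym: "(x, y) \<in> (adj_rel E)\<^sup>* \<Longrightarrow> (y, x) \<in> (adj_rel E)\<^sup>*"
proof -
  have "sym (adj_rel E)" by (auto simp: sym_def adj_rel_def insert_commute)
  then show "(x, y) \<in> (adj_rel E)\<^sup>* \<Longrightarrow> (y, x) \<in> (adj_rel E)\<^sup>*"
    by (meson sym_rtrancl symD)
qed

lemma adj_rtrancl_mono: "(x, y) \<in> (adj_rel E)\<^sup>* \<Longrightarrow> E \<subseteq> F \<Longrightarrow> (x, y) \<in> (adj_rel F)\<^sup>*"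
  by (rule subsetD[OF rtrancl_mono]) (auto simp: adj_rel_def)

fun path_edges :: "'v list \<Rightarrow> 'v set set" where
  "path_edges (x # y # zs) = insert {x, y} (path_edges (y # zs))"
| "path_edges zs = {}"

lemma path_edges_subset: "e \<in> path_edges ps \<Longrightarrow> e \<subseteq> set ps"
  by (induction ps rule: path_edges.induct) auto

lemma path_edges_prefix: "path_edges (as @ [y]) \<subseteq> path_edges (as @ y # bs)"
  by (induction as rule: path_edges.induct) auto

lemma path_edges_suffix: "path_edges bs \<subseteq> path_edges (as @ bs)"
proof (induction as)
  case (Cons a as)
  have "path_edges (as @ bs) \<subseteq> path_edges (a # as @ bs)" by (cases "as @ bs") auto
  then show ?case using Cons by simp
qed simp

lemma path_edges_snoc: "ps \<noteq> [] \<Longrightarrow> path_edges (ps @ [y]) = insert {last ps, y} (path_edges ps)"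
  by (induction ps rule: path_edges.induct) auto

lemma path_edges_connect: "ps \<noteq> [] \<Longrightarrow> (hd ps, last ps) \<in> (adj_rel (path_edges ps))\<^sup>*"
proof (induction ps rule: path_edges.induct)
  case (1 x y zs)
  have "(y, last (y # zs)) \<in> (adj_rel (path_edges (x # y # zs)))\<^sup>*"
    using 1 adj_rtrancl_mono[of y "last (y # zs)" "path_edges (y # zs)" "path_edges (x # y # zs)"] by (simp add: subset_insertI)
  moreover have "(x, y) \<in> adj_rel (path_edges (x # y # zs))" by (simp add: adj_rel_def)
  ultimately show ?case by (simp add: converse_rtrancl_into_rtrancl)
qed auto

lemma distinct_path_exists:
  assumes "(x, y) \<in> (adj_rel E)\<^sup>*"
  obtains ps where "ps \<noteq> []" "hd ps = x" "last ps = y" "distinct ps" "path_edges ps \<subseteq> E"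
proof -
  have "\<exists>ps. ps \<noteq> [] \<and> hd ps = x \<and> last ps = y \<and> distinct ps \<and> path_edges ps \<subseteq> E"
    using assms
  proof (induction rule: converse_rtrancl_induct)
    case base
    show ?case by (rule exI[of _ "[y]"]) auto
  next
    case (step x z)
    then obtain ps where ps: "ps \<noteq> []" "hd ps = z" "last ps = y" "distinct ps" "path_edges ps \<subseteq> E"
      by blast
    show ?case
    proof (cases "x \<in> set ps")
      case True
      then obtain as bs where "ps = as @ x # bs" by (auto simp: in_set_conv_decomp)
      then show ?thesis using ps path_edges_suffix[of "x # bs" as] by (intro exI[of _ "x # bs"]) auto
    next
      case False
      obtain zs where zs: "ps = z # zs" using ps by (cases ps) auto
      show ?thesis using False ps step(1) zs by (intro exI[of _ "x # ps"]) (auto simp: adj_rel_def)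
    qed
  qed
  then show ?thesis using that by blast
qed

text \<open>The ear has distinct vertices, so the at most one deleted vertex meets at most one of
  the two stretches from an ear vertex to the ends of the ear; the other stretch still leads to the
  old graph. Allowing \<open>A\<close> to be empty covers plain connectedness by the same
  argument.\<close>

lemma connected_graph_ear:
  assumes con: "connected_graph (VH - A) {e\<in>EH. e \<inter> A = {}}" and A: "A \<subseteq> {x}"
    and ps: "distinct ps" "ps \<noteq> []" "hd ps \<in> VH" "last ps \<in> VH"
  shows "connected_graph ((VH \<union> set ps) - A) {e \<in> EH \<union> path_edges ps. e \<inter> A = {}}"
proof -
  let ?F = "{e \<in> EH \<union> path_edges ps. e \<inter> A = {}}"
  have reach: "\<exists>c\<in>VH - A. (y, c) \<in> (adj_rel ?F)\<^sup>*" if y: "y \<in> (VH \<union> set ps) - A" for y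
  proof (cases "y \<in> VH")
    case True
    then show ?thesis using y by blast
  next
    case False
    then obtain as bs where split: "ps = as @ y # bs" using y by (auto simp: in_set_conv_decomp)
    have "set (y # bs) \<inter> A = {} \<or> set (as @ [y]) \<inter> A = {}" using split ps(1) A y by auto
    then show ?thesis
    proof
      assume dis: "set (y # bs) \<inter> A = {}"
      have sub: "path_edges (y # bs) \<subseteq> ?F"
        using path_edges_subset[of _ "y # bs"] path_edges_suffix[of "y # bs" as] dis split by auto
      have "(hd (y # bs), last (y # bs)) \<in> (adj_rel ?F)\<^sup>*"
        by (rule adj_rtrancl_mono[OF path_edges_connect sub]) simp
      then have "(y, last (y # bs)) \<in> (adj_rel ?F)\<^sup>*" by simp
      moreover have "last (y # bs) \<in> VH - A" using split ps(4) dis last_in_set[of "y # bs"]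
        by (auto simp del: last.simps)
      ultimately show ?thesis by blast
    next
      assume dis: "set (as @ [y]) \<inter> A = {}"
      have sub: "path_edges (as @ [y]) \<subseteq> ?F"
        using path_edges_subset[of _ "as @ [y]"] path_edges_prefix[of as y bs] dis split by auto
      have "(hd (as @ [y]), last (as @ [y])) \<in> (adj_rel ?F)\<^sup>*"
        by (rule adj_rtrancl_mono[OF path_edges_connect sub]) simp
      then have "(y, hd (as @ [y])) \<in> (adj_rel ?F)\<^sup>*" using adj_rtrancl_sym by (simp del: hd_append)
      moreover have "hd (as @ [y]) = hd ps" using split by (cases as) auto
      moreover have "hd ps \<notin> A" using dis hd_in_set[of "as @ [y]"] calculation(2) by auto
      ultimately show ?thesis using ps(3) by auto
    qed
  qed
  have core: "(c, d) \<in> (adj_rel ?F)\<^sup>*" if "c \<in> VH - A" "d \<in> VH - A" for c d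
    using con that adj_rtrancl_mono[of c d "{e\<in>EH. e \<inter> A = {}}" ?F] unfolding connected_graph_def by blast
  show ?thesis
    unfolding connected_graph_def
  proof (intro ballI)
    fix y z assume y: "y \<in> VH \<union> set ps - A" and z: "z \<in> VH \<union> set ps - A"
    obtain c where c: "c \<in> VH - A" "(y, c) \<in> (adj_rel ?F)\<^sup>*" using reach[OF y] by blast
    obtain d where d: "d \<in> VH - A" "(z, d) \<in> (adj_rel ?F)\<^sup>*" using reach[OF z] by blast
    have "(c, z) \<in> (adj_rel ?F)\<^sup>*"
      using core[OF c(1) d(1)] adj_rtrancl_sym[OF d(2)] by (rule rtrancl_trans)
    with c(2) show "(y, z) \<in> (adj_rel ?F)\<^sup>*" by (rule rtrancl_trans)
  qed
qed

lemma no_cut_vertex_ear: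
  assumes ncv: "no_cut_vertex VH EH" and EH: "\<forall>e\<in>EH. e \<subseteq> VH"
    and ps: "distinct ps" "ps \<noteq> []" "hd ps \<in> VH" "last ps \<in> VH"
  shows "no_cut_vertex (VH \<union> set ps) (EH \<union> path_edges ps)"
proof -
  have con: "connected_graph VH EH" using ncv by (simp add: no_cut_vertex_def)
  have "connected_graph (VH \<union> set ps) (EH \<union> path_edges ps)"
    using connected_graph_ear[of VH "{}" EH, OF _ _ ps] con by (simp add: Un_def)
  moreover have "connected_graph ((VH \<union> set ps) - {x}) {e \<in> EH \<union> path_edges ps. x \<notin> e}" for x
  proof -
    have "connected_graph (VH - {x}) {e\<in>EH. x \<notin> e}"
    proof (cases "x \<in> VH")
      case True
      then show ?thesis using ncv by (simp add: no_cut_vertex_def)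
    next
      case False
      then have "VH - {x} = VH" "{e\<in>EH. x \<notin> e} = EH" using EH by auto
      then show ?thesis using con by simp
    qed
    then show ?thesis using connected_graph_ear[of VH "{x}" EH x, OF _ _ ps] by simp
  qed
  ultimately show ?thesis by (simp add: no_cut_vertex_def)
qed

lemma no_cut_vertex_edge: "no_cut_vertex {x, y} {{x, y}}"
proof -
  have "(x, y) \<in> adj_rel {{x, y}}" "(y, x) \<in> adj_rel {{x, y}}"
    by (auto simp: adj_rel_def insert_commute)
  then show ?thesis by (auto simp: no_cut_vertex_def connected_graph_def)
qed

text \<open>Among the finitely many candidates above the given subgraph, one with the largest total
  number of vertices and edges is maximal under inclusion.\<close>

lemma block_extends:
  assumes fin: "finite V" "finite E"
    and D: "subgraph VD ED V E" "no_cut_vertex VD ED" "VD \<noteq> {}"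
  obtains VB EB where "is_block V E VB EB" "VD \<subseteq> VB" "ED \<subseteq> EB"
proof -
  define S where "S = {(VH, EH). subgraph VH EH V E \<and> no_cut_vertex VH EH \<and> VD \<subseteq> VH \<and> ED \<subseteq> EH}"
  let ?m = "\<lambda>(VH, EH). card VH + card EH"
  have "S \<subseteq> Pow V \<times> Pow E" by (auto simp: S_def subgraph_def)
  then have finS: "finite S" using fin finite_subset by blast
  have "(VD, ED) \<in> S" using D by (auto simp: S_def)
  then have "Max (?m ` S) \<in> ?m ` S" using finS by (intro Max_in) auto
  then obtain B where B: "B \<in> S" "?m B = Max (?m ` S)" by (metis (no_types, lifting) imageE)
  obtain VB EB where VB: "B = (VB, EB)" by (cases B)
  then have VBS: "subgraph VB EB V E" "no_cut_vertex VB EB" "VD \<subseteq> VB" "ED \<subseteq> EB"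
    using B(1) by (auto simp: S_def)
  have max: "?m B' \<le> ?m B" if "B' \<in> S" for B' using that finS B(2) by simp
  have "is_block V E VB EB"
    unfolding is_block_def
  proof (intro conjI allI impI)
    show "subgraph VB EB V E" "no_cut_vertex VB EB" "VB \<noteq> {}" using VBS D by auto
    fix VH EH assume H: "subgraph VH EH V E \<and> no_cut_vertex VH EH \<and> VB \<subseteq> VH \<and> EB \<subseteq> EH"
    then have "(VH, EH) \<in> S" using VBS by (auto simp: S_def)
    then have le: "card VH + card EH \<le> card VB + card EB" using max[of "(VH, EH)"] VB by simp
    have finH: "finite VH" "finite EH" using H fin by (auto simp: subgraph_def intro: finite_subset)
    then have "card VB \<le> card VH" "card EB \<le> card EH" using H by (auto intro: card_mono)
    then have "card VB = card VH" "card EB = card EH" using le by auto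
    then show "VH = VB" "EH = EB" using H finH by (auto dest: card_subset_eq)
  qed
  then show ?thesis using that VBS by blast
qed

text \<open>Connectedness gives a first neighbour \<open>y\<close> of \<open>x\<close>. After
  deleting \<open>y\<close> a third vertex is still reachable from \<open>x\<close>, which forces a
  second edge.\<close>

lemma no_cut_vertex_degree:
  assumes ncv: "no_cut_vertex VB EB" and fin: "finite VB" and card: "card VB \<ge> 3" and x: "x \<in> VB"
    and EB: "\<forall>e\<in>EB. e \<subseteq> VB \<and> card e = 2"
  obtains e e' where "e \<in> EB" "e' \<in> EB" "e \<noteq> e'" "x \<in> e" "x \<in> e'"
proof -
  have first: "\<exists>y. {x, y} \<in> F" if "connected_graph U F" "x \<in> U" "z \<in> U" "z \<noteq> x" for U F z
  proof -
    have "(x, z) \<in> (adj_rel F)\<^sup>*" using that by (auto simp: connected_graph_def)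
    then show ?thesis using that(4) by (cases rule: converse_rtranclE) (auto simp: adj_rel_def)
  qed
  have big: "\<exists>z\<in>VB. z \<notin> S" if "finite S" "card S \<le> 2" for S
    using that card card_mono[of S VB] by fastforce
  obtain z where "z \<in> VB" "z \<noteq> x" using big[of "{x}"] by auto
  then obtain y where y: "{x, y} \<in> EB" using first ncv x unfolding no_cut_vertex_def by blast
  then have "y \<noteq> x" "y \<in> VB" using EB by auto
  obtain z' where z': "z' \<in> VB" "z' \<noteq> x" "z' \<noteq> y" using big[of "{x, y}"] card_insert_le_m1[of 2 "{y}" x] by auto
  have "connected_graph (VB - {y}) {e\<in>EB. y \<notin> e}" using ncv \<open>y \<in> VB\<close> by (simp add: no_cut_vertex_def)
  then obtain y' where "{x, y'} \<in> {e\<in>EB. y \<notin> e}" using first[of "VB - {y}"] z' x \<open>y \<noteq> x\<close> by blast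
  then show ?thesis using that[of "{x, y}" "{x, y'}"] y by auto
qed

text \<open>Double counting of incidences: every vertex lies on two edges and every edge has two
  vertices.\<close>

lemma cycle_card_edges:
  assumes cyc: "is_cycle VC EC" and EC: "\<forall>e\<in>EC. e \<subseteq> VC \<and> card e = 2"
  shows "finite EC" and "card EC = card VC"
proof -
  have fin: "finite VC" using cyc by (simp add: is_cycle_def)
  show finE: "finite EC" using EC fin by (auto intro: finite_subset[of EC "Pow VC"])
  have "(\<Sum>x\<in>VC. card {e\<in>EC. x \<in> e}) = (\<Sum>e\<in>EC. card {x\<in>VC. x \<in> e})"
    using sum.swap_restrict[OF fin finE, of "\<lambda>x e. 1::nat" "\<lambda>x e. x \<in> e"] by simp
  moreover have "card {x\<in>VC. x \<in> e} = 2" if "e \<in> EC" for e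
  proof -
    have "{x\<in>VC. x \<in> e} = e" using EC that by auto
    then show ?thesis using EC that by simp
  qed
  ultimately show "card EC = card VC" using cyc by (simp add: is_cycle_def)
qed

section \<open>Primitive closed walks\<close>

text \<open>A closed walk of length \<open>n\<close> is a periodic vertex sequence, so that it can be read from any
  starting position. The function \<open>bal h\<close> is the image of \<open>h\<close> under the incidence matrix.\<close>

locale closed_walk =
  fixes f :: "nat \<Rightarrow> 'v" and n :: nat
  assumes npos: "n > 0" and neven: "even n" and per: "f (k + n) = f k"
    and step: "f k \<noteq> f (Suc k)"
begin

definition Ed :: "nat \<Rightarrow> 'v set" where "Ed k = {f k, f (Suc k)}"
definition W :: "'v set set" where "W = Ed ` {..<n}"
text \<open>Exponent vector of the signed steps at the positions in \<open>T\<close>. The set is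
  arbitrary because the smaller walks split off later are unions of stretches.\<close>

definition vec :: "nat set \<Rightarrow> 'v set \<Rightarrow> int" where
  "vec T e = (\<Sum>k\<in>T. if Ed k = e then (-1) ^ k else 0)"
definition b :: "'v set \<Rightarrow> int" where "b = vec {..<n}"
definition bal :: "('v set \<Rightarrow> int) \<Rightarrow> 'v \<Rightarrow> int" where
  "bal h x = (\<Sum>e | e \<in> W \<and> x \<in> e. h e)"

lemma finite_W [simp]: "finite W" by (simp add: W_def)

lemma Ed_per [simp]: "Ed (k + n) = Ed k"
  using per[of "k"] per[of "Suc k"] by (simp add: Ed_def)

lemma per_mult: "f (k + m * n) = f k"
proof (induction m)
  case (Suc m)
  have "f (k + Suc m * n) = f ((k + m * n) + n)" by (simp add: algebra_simps)
  then show ?case using Suc per by simp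
qed simp

text \<open>Moving the window by one loses only its first position, whose translate by
  \<open>n\<close> enters at the other end.\<close>

lemma window: "\<exists>k\<in>{i..<i+n}. f k = f l \<and> f (Suc k) = f (Suc l)"
proof (induction i)
  case 0
  have "f (l mod n) = f l" using per_mult[of "l mod n" "l div n"] by simp
  moreover have "f (Suc (l mod n)) = f (Suc l)" using per_mult[of "Suc (l mod n)" "l div n"] by simp
  ultimately show ?case using npos by (intro bexI[of _ "l mod n"]) auto
next
  case (Suc i)
  then obtain k where k: "k \<in> {i..<i+n}" "f k = f l" "f (Suc k) = f (Suc l)" by blast
  show ?case
  proof (cases "k = i")
    case True
    then show ?thesis using k npos per[of i] per[of "Suc i"] by (intro bexI[of _ "i + n"]) auto
  next
    case False
    then show ?thesis using k by (intro bexI[of _ k]) auto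
  qed
qed

lemma Ed_in_W [simp]: "Ed k \<in> W"
proof -
  obtain l where "l \<in> {0..<0+n}" "f l = f k" "f (Suc l) = f (Suc k)" using window by blast
  then show ?thesis unfolding W_def Ed_def by (intro image_eqI[of _ _ l]) auto
qed

lemma W_window:
  assumes "e \<in> W" obtains k where "k \<in> {i..<i+n}" "e = Ed k"
proof -
  from assms obtain l where "e = Ed l" by (auto simp: W_def)
  then show ?thesis using window[of i l] that unfolding Ed_def by metis
qed

lemma card_W: "e \<in> W \<Longrightarrow> card e = 2"
  using step by (auto simp: W_def Ed_def)

text \<open>Positions \<open>i\<close> and \<open>i + n\<close> carry the same edge and,
  \<open>n\<close> being even, the same sign.\<close>

lemma vec_window: "vec {i..<i+n} = b"
proof (induction i)
  case 0
  show ?case by (simp add: b_def lessThan_atLeast0)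
next
  case (Suc i)
  have "vec {Suc i..<Suc i + n} e = vec {i..<i+n} e" for e
  proof -
    have "{i..<i+n} = insert i {Suc i..<i+n}" "{Suc i..<Suc i+n} = insert (i+n) {Suc i..<i+n}"
      using npos by auto
    then show ?thesis using neven by (simp add: vec_def power_add)
  qed
  then show ?case using Suc by auto
qed

text \<open>Each step contributes its sign once to each of its two endpoints, which are different by
  \<open>step\<close>.\<close>

lemma bal_vec:
  assumes "finite T"
  shows "bal (vec T) x = (\<Sum>k\<in>T. (-1) ^ k * (of_bool (f k = x) + of_bool (f (Suc k) = x)))"
proof -
  have "bal (vec T) x = (\<Sum>k\<in>T. \<Sum>e | e \<in> W \<and> x \<in> e. if Ed k = e then (-1) ^ k else 0)"
    unfolding bal_def vec_def by (rule sum.swap)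
  also have "\<dots> = (\<Sum>k\<in>T. (-1) ^ k * (of_bool (f k = x) + of_bool (f (Suc k) = x)))"
  proof (rule sum.cong)
    fix k
    have "(\<Sum>e | e \<in> W \<and> x \<in> e. if Ed k = e then (-1::int) ^ k else 0) = (if x \<in> Ed k then (-1) ^ k else 0)"
      by (simp add: sum.delta')
    then show "(\<Sum>e | e \<in> W \<and> x \<in> e. if Ed k = e then (-1::int) ^ k else 0) =
       (-1) ^ k * (of_bool (f k = x) + of_bool (f (Suc k) = x))"
      using step[of k] by (auto simp: Ed_def)
  qed simp
  finally show ?thesis .
qed

lemma telescope:
  fixes g :: "nat \<Rightarrow> int"
  assumes "i \<le> j"
  shows "(\<Sum>k\<in>{i..<j}. (-1) ^ k * (g k + g (Suc k))) = (-1) ^ i * g i - (-1) ^ j * g j"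
  using assms by (induction j rule: dec_induct) (auto simp: algebra_simps)

text \<open>Contributions at inner positions cancel in pairs. Hence a stretch returning to its
  starting vertex is balanced exactly when its length is even.\<close>

lemma bal_interval:
  assumes "i \<le> j"
  shows "bal (vec {i..<j}) x = (-1) ^ i * of_bool (f i = x) - (-1) ^ j * of_bool (f j = x)"
  using telescope[OF assms, of "\<lambda>k. of_bool (f k = x)"] by (simp add: bal_vec)

lemma bal_b: "bal b x = 0"
  using bal_interval[of 0 "0+n" x] vec_window[of 0] neven per[of 0] by simp

end

text \<open>\<open>sgn\<close> expresses that the sets of odd and even edges are disjoint.
  \<open>prim\<close> is primitivity for exponent vectors: the bounds on \<open>h\<close> say that
  the two terms of its binomial divide \<open>E^+\<close> and \<open>E^-\<close>.\<close>

locale prim_walk = closed_walk f n for f :: "nat \<Rightarrow> 'v" and n :: nat +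
  assumes sgn: "Ed k = Ed l \<Longrightarrow> even k = even l"
    and prim: "\<lbrakk>\<And>x. bal h x = 0; \<And>e. e \<in> W \<Longrightarrow> 0 \<le> h e \<and> h e \<le> b e \<or> b e \<le> h e \<and> h e \<le> 0\<rbrakk>
      \<Longrightarrow> (\<forall>e\<in>W. h e = 0) \<or> (\<forall>e\<in>W. h e = b e)"
begin

text \<open>By \<open>sgn\<close> all positions on one edge have the same sign, so nothing cancels
  and the coefficient only counts positions.\<close>

lemma vec_sign:
  assumes "finite T" shows "vec T (Ed l) = (-1) ^ l * int (card {k\<in>T. Ed k = Ed l})"
proof -
  have "vec T (Ed l) = (\<Sum>k\<in>T. if Ed k = Ed l then (-1) ^ l else 0)"
    unfolding vec_def
  proof (rule sum.cong)
    fix k show "(if Ed k = Ed l then (- 1) ^ k else 0) = (if Ed k = Ed l then (- 1::int) ^ l else 0)"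
      using sgn[of k l] by (cases "even k") auto
  qed simp
  also have "\<dots> = (\<Sum>k\<in>{k\<in>T. Ed k = Ed l}. (-1) ^ l)"
    using assms by (intro sum.mono_neutral_cong_right) auto
  finally show ?thesis by simp
qed

lemma b_sign: obtains c where "c > 0" "b (Ed l) = (-1) ^ l * int c"
proof -
  obtain k where "k \<in> {0..<0+n}" "Ed l = Ed k" using W_window[OF Ed_in_W] by blast
  then have "k \<in> {k\<in>{..<n}. Ed k = Ed l}" by auto
  then have "card {k\<in>{..<n}. Ed k = Ed l} \<noteq> 0" by (subst card_0_eq) auto
  then have "card {k\<in>{..<n}. Ed k = Ed l} > 0" by (rule neq0_conv[THEN iffD1])
  moreover have "b (Ed l) = (-1) ^ l * int (card {k\<in>{..<n}. Ed k = Ed l})"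
    unfolding b_def by (rule vec_sign) simp
  ultimately show ?thesis by (rule that)
qed

lemma b_pos_iff: "b (Ed l) > 0 \<longleftrightarrow> even l"
  by (rule b_sign[of l]; cases "even l"; simp)

lemma b_neg_iff: "b (Ed l) < 0 \<longleftrightarrow> odd l"
  by (rule b_sign[of l]; cases "even l"; simp)

lemma b_nonzero: "b (Ed l) \<noteq> 0"
  using b_pos_iff[of l] b_neg_iff[of l] by linarith

text \<open>Without cancellation \<open>vec T\<close> lies between \<open>0\<close> and
  \<open>b\<close>, so \<open>prim\<close> applies. Equality with \<open>0\<close> or
  \<open>b\<close> fixes the number of positions on each edge, hence \<open>T\<close>
  itself.\<close>

lemma prim_positions:
  assumes T: "T \<subseteq> {i..<i+n}" and bal: "\<And>x. bal (vec T) x = 0"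
  shows "T = {} \<or> T = {i..<i+n}"
proof -
  have fin: "finite T" using T finite_subset by blast
  let ?N = "\<lambda>T l. {k\<in>T. Ed k = Ed l}"
  have bl: "b (Ed l) = (-1) ^ l * int (card (?N {i..<i+n} l))" for l
    using vec_sign[of "{i..<i+n}" l] vec_window by simp
  have sub: "?N T l \<subseteq> ?N {i..<i+n} l" for l using T by auto
  have le: "card (?N T l) \<le> card (?N {i..<i+n} l)" for l
    using sub by (intro card_mono) auto
  have "(\<forall>e\<in>W. vec T e = 0) \<or> (\<forall>e\<in>W. vec T e = b e)"
  proof (rule prim[OF bal])
    fix e assume "e \<in> W"
    then obtain l where "e = Ed l" by (auto simp: W_def)
    then show "0 \<le> vec T e \<and> vec T e \<le> b e \<or> b e \<le> vec T e \<and> vec T e \<le> 0"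
      using bl[of l] le[of l] vec_sign[OF fin, of l] by (cases "even l") auto
  qed
  then show ?thesis
  proof
    assume *: "\<forall>e\<in>W. vec T e = 0"
    have "?N T l = {}" for l
      using *[rule_format, of "Ed l"] vec_sign[OF fin, of l] fin by auto
    then show ?thesis by blast
  next
    assume *: "\<forall>e\<in>W. vec T e = b e"
    have "?N T l = ?N {i..<i+n} l" for l
      using *[rule_format, of "Ed l"] vec_sign[OF fin, of l] bl[of l] sub[of l]
      by (intro card_subset_eq) auto
    then have "{i..<i+n} \<subseteq> T" by blast
    then show ?thesis using T by blast
  qed
qed

text \<open>A closed stretch of even length would be balanced although it is a nonempty proper part
  of the walk.\<close>

lemma odd_chord:
  assumes "i < j" "j < i + n" "f i = f j" shows "even i \<noteq> even j"
proof
  assume "even i = even j"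
  then have "(-1::int) ^ i = (-1) ^ j" by (cases "even i") auto
  then have "\<And>x. bal (vec {i..<j}) x = 0" using assms bal_interval[of i j] by simp
  then have "{i..<j} = {} \<or> {i..<j} = {i..<i+n}" using assms by (intro prim_positions) auto
  then show False using assms by (auto simp: atLeastLessThan_eq_iff)
qed

text \<open>The stretch from \<open>i\<close> to \<open>k\<close> followed by the reversed stretch from \<open>j\<close> to \<open>l\<close> is an even
  closed walk, and the odd distances make its signs alternate.\<close>

lemma noncrossing:
  assumes "i < k" "k < j" "j < l" "l < i + n" "f i = f j" "f k = f l" shows False
proof -
  have par: "even i \<noteq> even j" "even k \<noteq> even l"
    using assms odd_chord[of i j] odd_chord[of k l] by auto
  have fin: "finite {i..<k}" "finite {j..<l}" "{i..<k} \<inter> {j..<l} = {}" using assms by auto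
  have "bal (vec ({i..<k} \<union> {j..<l})) x = bal (vec {i..<k}) x + bal (vec {j..<l}) x" for x
    unfolding bal_vec[OF finite_UnI[OF fin(1,2)]] bal_vec[OF fin(1)] bal_vec[OF fin(2)]
    by (rule sum.union_disjoint[OF fin])
  then have "bal (vec ({i..<k} \<union> {j..<l})) x = 0" for x
    using assms par bal_interval[of i k x] bal_interval[of j l x]
    by (cases "even i"; cases "even k") auto
  then have *: "{i..<k} \<union> {j..<l} = {} \<or> {i..<k} \<union> {j..<l} = {i..<i+n}"
    using assms by (intro prim_positions) auto
  have "i \<in> {i..<k} \<union> {j..<l}" "k \<in> {i..<i+n}" "k \<notin> {i..<k} \<union> {j..<l}" using assms by auto
  with * show False by blast
qed

section \<open>Chords of the walk and the two sides they cut off\<close>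

definition chord :: "nat \<Rightarrow> nat \<Rightarrow> bool" where
  "chord i j \<longleftrightarrow> i < j \<and> j < i + n \<and> f i = f j"
definition side :: "nat \<Rightarrow> nat \<Rightarrow> 'v set" where "side i j = f ` {i<..<j}"
text \<open>The edges with which the stretch from \<open>i\<close> to \<open>j\<close> leaves its
  base vertex and returns to it; they may coincide.\<close>

definition ends :: "nat \<Rightarrow> nat \<Rightarrow> 'v set set" where "ends i j = {Ed i, Ed (j - 1)}"

lemma range_f: "range f = f ` {i..<i+n}"
proof -
  have "f l \<in> f ` {i..<i+n}" for l using window[of i l] by (metis image_eqI)
  then show ?thesis by blast
qed

lemma finite_range [simp]: "finite (range f)" using range_f[of 0] by simp

lemma W_range: "e \<in> W \<Longrightarrow> e \<subseteq> range f" by (auto simp: W_def Ed_def)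

text \<open>The complementary stretch is again a chord with the same base vertex, so each fact about
  one side transfers to the other.\<close>

lemma chord_shift: "chord i j \<Longrightarrow> chord j (i + n)"
  using per[of i] by (simp add: chord_def)

lemma chord_length: assumes "chord i j" shows "Suc i < j" "i < j - 1"
proof -
  have "j \<noteq> Suc i" using assms step[of i] by (auto simp: chord_def)
  then show "Suc i < j" "i < j - 1" using assms by (auto simp: chord_def)
qed

lemma sideI: "i < k \<Longrightarrow> k < j \<Longrightarrow> f k \<in> side i j"
  by (simp add: side_def)

text \<open>A third visit would give three positions of pairwise different parity. In particular a
  vertex is visited at most twice per period.\<close>

lemma apex_notin_side: assumes "chord i j" shows "f i \<notin> side i j"
proof
  assume "f i \<in> side i j"
  then obtain k where "i < k" "k < j" "f i = f k" by (auto simp: side_def)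
  then show False using assms odd_chord[of i k] odd_chord[of k j] odd_chord[of i j]
    by (auto simp: chord_def)
qed

lemma apex_notin_side': "chord i j \<Longrightarrow> f i \<notin> side j (i + n)"
  using apex_notin_side[OF chord_shift] by (auto simp: chord_def)

text \<open>A common vertex of the two sides would be the base of a chord crossing this one.\<close>

lemma sides_disjoint: assumes "chord i j" shows "side i j \<inter> side j (i + n) = {}"
  using assms noncrossing[of i _ j] by (fastforce simp: side_def chord_def)

lemma range_sides: assumes "chord i j" shows "range f = insert (f i) (side i j \<union> side j (i + n))"
proof -
  have "{i..<i+n} = insert i ({i<..<j} \<union> insert j {j<..<i+n})" using assms by (auto simp: chord_def)
  then show ?thesis using assms unfolding range_f[of i] side_def chord_def by auto
qed

lemma edge_in_side:
  assumes ch: "chord i j" and e: "e \<in> W" "f i \<notin> e"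
  shows "e \<subseteq> side i j \<or> e \<subseteq> side j (i + n)"
proof -
  obtain k where k: "k \<in> {i..<i+n}" "e = Ed k" using W_window e by blast
  have "k \<noteq> i" "k \<noteq> j" "Suc k \<noteq> j" "Suc k \<noteq> i + n"
    using e(2) ch k per[of i] by (auto simp: Ed_def chord_def)
  then have "i < k \<and> Suc k < j \<or> j < k \<and> Suc k < i + n" using k ch by (auto simp: chord_def)
  then show ?thesis using k by (auto simp: side_def Ed_def)
qed

text \<open>The base vertex is visited only at \<open>i\<close> and \<open>j\<close>, so its edges
  are exactly those used just before or just after these two visits.\<close>

lemma edge_at_apex:
  assumes ch: "chord i j" and e: "e \<in> W" "f i \<in> e"
  shows "e \<in> ends i j \<or> e \<in> ends j (i + n)"
proof -
  obtain k where k: "k \<in> {i..<i+n}" "e = Ed k" using W_window e by blast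
  have "\<not> (i < l \<and> l < j) \<and> \<not> (j < l \<and> l < i + n)" if "f l = f i" for l
    using that apex_notin_side[OF ch] apex_notin_side'[OF ch] sideI[of i l j] sideI[of j l "i + n"]
    by metis
  then have "k = i \<or> k = j \<or> Suc k = j \<or> Suc k = i + n"
    using e(2) k by (fastforce simp: Ed_def)
  then have "k = i \<or> k = j \<or> k = j - 1 \<or> k = i + n - 1" by linarith
  then show ?thesis using k(2) by (auto simp: ends_def)
qed

lemma endsD:
  assumes ch: "chord i j" and e: "e \<in> ends i j"
  shows "e \<in> W" "f i \<in> e" "e \<subseteq> insert (f i) (side i j)" "card (e \<inter> side i j) = 1"
proof -
  obtain y where y: "e = {f i, y}" "y \<in> side i j"
  proof (cases "e = Ed i")
    case True
    then show ?thesis using that[of "f (Suc i)"] chord_length[OF ch] by (auto simp: Ed_def side_def)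
  next
    case False
    then have "e = Ed (j - 1)" using e by (simp add: ends_def)
    then show ?thesis using that[of "f (j - 1)"] chord_length[OF ch] ch
      by (auto simp: Ed_def side_def chord_def)
  qed
  have "e \<inter> side i j = {y}" using y apex_notin_side[OF ch] by auto
  then show "card (e \<inter> side i j) = 1" by simp
  show "e \<in> W" "f i \<in> e" "e \<subseteq> insert (f i) (side i j)" using e y by (auto simp: ends_def)
qed

lemma ends_disjoint: assumes "chord i j" shows "ends i j \<inter> ends j (i + n) = {}"
proof -
  have "e \<notin> ends j (i + n)" if e: "e \<in> ends i j" for e
  proof
    assume e': "e \<in> ends j (i + n)"
    have "e \<inter> side i j \<noteq> {}" using endsD(4)[OF assms e] by auto
    moreover have "e \<subseteq> insert (f i) (side j (i + n))"
      using endsD(3)[OF chord_shift[OF assms] e'] assms by (simp add: chord_def)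
    ultimately show False using sides_disjoint[OF assms] apex_notin_side[OF assms] by auto
  qed
  then show ?thesis by blast
qed

section \<open>Subgraphs without cut vertex and the sides of a chord\<close>

lemma chord_separates:
  assumes ch: "chord i j" and "(x, y) \<in> (adj_rel F)\<^sup>*" and F: "F \<subseteq> W" "\<forall>e\<in>F. f i \<notin> e"
    and x: "x \<in> side i j"
  shows "y \<in> side i j"
  using assms(2) x
proof (induction rule: rtrancl_induct)
  case (step y z)
  then have "{y, z} \<in> W" "f i \<notin> {y, z}" using F by (auto simp: adj_rel_def)
  then show ?case using edge_in_side[OF ch, of "{y, z}"] sides_disjoint[OF ch] step by blast
qed

text \<open>Deleting the base vertex leaves the subgraph connected, and no path avoiding that vertex
  changes sides.\<close>

lemma no_cut_vertex_in_side:
  assumes ch: "chord i j" and D: "subgraph VD ED (range f) W" "no_cut_vertex VD ED" and v: "f i \<in> VD"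
  shows "VD - {f i} \<subseteq> side i j \<or> VD - {f i} \<subseteq> side j (i + n)"
proof (rule ccontr)
  assume "\<not> ?thesis"
  then obtain x y where xy: "x \<in> VD - {f i}" "x \<notin> side j (i + n)" "y \<in> VD - {f i}" "y \<notin> side i j"
    by blast
  then have "x \<in> side i j" using D range_sides[OF ch] by (auto simp: subgraph_def)
  moreover have "(x, y) \<in> (adj_rel {e\<in>ED. f i \<notin> e})\<^sup>*"
    using D v xy by (auto simp: no_cut_vertex_def connected_graph_def)
  moreover have "{e\<in>ED. f i \<notin> e} \<subseteq> W" using D by (auto simp: subgraph_def)
  ultimately have "y \<in> side i j" using chord_separates[OF ch, of x y "{e\<in>ED. f i \<notin> e}"] by blast
  then show False using xy by blast
qed

lemma no_cut_vertex_ends: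
  assumes ch: "chord i j" and D: "subgraph VD ED (range f) W" "no_cut_vertex VD ED"
    and side: "VD - {f i} \<subseteq> side i j"
  shows "{e\<in>ED. f i \<in> e} \<subseteq> ends i j"
proof
  fix e assume "e \<in> {e\<in>ED. f i \<in> e}"
  then have e: "e \<in> W" "f i \<in> e" "e \<subseteq> VD" using D by (auto simp: subgraph_def)
  have "e \<notin> ends j (i + n)"
  proof
    assume "e \<in> ends j (i + n)"
    then have "e \<inter> side j (i + n) \<noteq> {}" using endsD(4)[OF chord_shift[OF ch]] by force
    then show False using e(3) side sides_disjoint[OF ch] apex_notin_side'[OF ch] by blast
  qed
  then show "e \<in> ends i j" using edge_at_apex[OF ch e(1,2)] by blast
qed

text \<open>The step into \<open>f m\<close> is read at \<open>m + n - 1\<close>, one period later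
  than \<open>m - 1\<close>, because subtraction would be truncated at \<open>m = 0\<close>.\<close>

lemma single_edges:
  assumes "\<And>j. m < j \<Longrightarrow> j < m + n \<Longrightarrow> f j \<noteq> f m"
  shows "{e\<in>W. f m \<in> e} = {Ed m, Ed (m + n - 1)}" and "even (m + n - 1) \<noteq> even m"
proof -
  show "even (m + n - 1) \<noteq> even m" using npos neven by (cases n) auto
  have "e \<in> {Ed m, Ed (m + n - 1)}" if e: "e \<in> W" "f m \<in> e" for e
  proof -
    obtain k where k: "k \<in> {m..<m+n}" "e = Ed k" using W_window e by blast
    then have "k = m \<or> Suc k = m + n" using e(2) assms[of k] assms[of "Suc k"]
      by (fastforce simp: Ed_def)
    then have "k = m \<or> k = m + n - 1" by linarith
    then show ?thesis using k(2) by blast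
  qed
  moreover have "f m \<in> Ed (m + n - 1)" using npos per[of m] by (auto simp: Ed_def)
  moreover have "f m \<in> Ed m" by (simp add: Ed_def)
  ultimately show "{e\<in>W. f m \<in> e} = {Ed m, Ed (m + n - 1)}" using Ed_in_W by blast
qed

lemma vertex_cases:
  assumes "x \<in> range f"
  obtains (single) m where "x = f m" "{e\<in>W. x \<in> e} = {Ed m, Ed (m + n - 1)}" "even (m + n - 1) \<noteq> even m"
  | (double) i j where "x = f i" "chord i j"
proof -
  obtain m where m: "x = f m" using assms by blast
  show ?thesis
  proof (cases "\<exists>j. m < j \<and> j < m + n \<and> f j = f m")
    case True
    then show ?thesis using m double unfolding chord_def by metis
  next
    case False
    then show ?thesis using m single single_edges[of m] by blast
  qed
qed

text \<open>Every degree is at most two: a vertex visited once has only two edges in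
  \<open>W\<close>, and at a vertex visited twice the subgraph stays on one side, which offers only
  the two \<open>ends\<close>. At least two edges come from
  \<open>no_cut_vertex_degree\<close>.\<close>

lemma no_cut_vertex_is_cycle:
  assumes D: "subgraph VD ED (range f) W" "no_cut_vertex VD ED" and card: "card VD \<ge> 3"
  shows "is_cycle VD ED"
proof -
  have fin: "finite VD" using D finite_range by (auto simp: subgraph_def intro: finite_subset)
  have edges: "\<forall>e\<in>ED. e \<subseteq> VD \<and> card e = 2" using D card_W by (auto simp: subgraph_def)
  have "card {e\<in>ED. x \<in> e} = 2" if x: "x \<in> VD" for x
  proof -
    obtain e e' where e: "e \<in> ED" "e' \<in> ED" "e \<noteq> e'" "x \<in> e" "x \<in> e'"
      using no_cut_vertex_degree[OF D(2) fin card x edges] by blast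
    obtain d d' where d: "{e\<in>ED. x \<in> e} \<subseteq> {d, d'}"
    proof -
      have "x \<in> range f" using x D by (auto simp: subgraph_def)
      then show ?thesis
      proof (cases rule: vertex_cases)
        case (single m)
        have "{e\<in>ED. x \<in> e} \<subseteq> {e\<in>W. x \<in> e}" using D(1) by (auto simp: subgraph_def)
        then have "{e\<in>ED. x \<in> e} \<subseteq> {Ed m, Ed (m + n - 1)}" using single(2) by (rule subset_trans[OF _ equalityD1])
        then show ?thesis by (rule that)
      next
        case (double i j)
        have "{e\<in>ED. x \<in> e} \<subseteq> ends i j \<or> {e\<in>ED. x \<in> e} \<subseteq> ends j (i + n)"
          using no_cut_vertex_in_side[OF double(2) D] no_cut_vertex_ends[OF double(2) D]
            no_cut_vertex_ends[OF chord_shift[OF double(2)] D] x double by (auto simp: chord_def)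
        then show ?thesis using that unfolding ends_def by metis
      qed
    qed
    have "{e\<in>ED. x \<in> e} = {e, e'}" using d e by blast
    then show ?thesis using e by simp
  qed
  then show ?thesis using D fin card by (auto simp: is_cycle_def no_cut_vertex_def)
qed

section \<open>Cyclic blocks of the walk graph\<close>

lemma arc_connected:
  assumes "k \<le> l" "\<And>m. k \<le> m \<Longrightarrow> m \<le> l \<Longrightarrow> f m \<noteq> v"
  shows "(f k, f l) \<in> (adj_rel {e\<in>W. v \<notin> e})\<^sup>*"
  using assms
proof (induction l rule: dec_induct)
  case (step l)
  have "v \<notin> Ed l" using step.prems[of l] step.prems[of "Suc l"] step.hyps by (auto simp: Ed_def)
  then have "(f l, f (Suc l)) \<in> adj_rel {e\<in>W. v \<notin> e}"
    using Ed_in_W[of l] by (simp add: adj_rel_def Ed_def)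
  moreover have "(f k, f l) \<in> (adj_rel {e\<in>W. v \<notin> e})\<^sup>*" using step by auto
  ultimately show ?case by (rule rtrancl_into_rtrancl[rotated])
qed simp

lemma path_vertices: "y \<in> set ps \<Longrightarrow> y = hd ps \<or> (\<exists>e\<in>path_edges ps. y \<in> e)"
  by (induction ps rule: path_edges.induct) auto

text \<open>The stretch between the two visits joins the two distinct neighbours by a path that
  avoids the base vertex. Closing it up gives a subgraph without cut vertex on at least three
  vertices; the block around it is a cycle.\<close>

lemma ends_in_cyclic_block:
  assumes ch: "chord i j" and neq: "Ed i \<noteq> Ed (j - 1)"
  obtains VC EC where "cyclic_block (range f) W VC EC" "Ed i \<in> EC" "Ed (j - 1) \<in> EC"
proof -
  let ?v = "f i"
  have len: "Suc i \<le> j - 1" "Suc (j - 1) = j" using chord_length[OF ch] by auto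
  have fj: "f j = ?v" using ch by (simp add: chord_def)
  have avoid: "f m \<noteq> ?v" if "Suc i \<le> m" "m \<le> j - 1" for m
    using apex_notin_side[OF ch] that len sideI[of i m j] by (metis Suc_le_eq le_imp_less_Suc)
  obtain ps where ps: "ps \<noteq> []" "hd ps = f (Suc i)" "last ps = f (j - 1)" "distinct ps"
      "path_edges ps \<subseteq> {e\<in>W. ?v \<notin> e}"
    using distinct_path_exists[OF arc_connected[OF len(1) avoid]] by blast
  let ?ps = "ps @ [?v]"
  \<comment> \<open>The cycle is built as the single edge \<open>Ed i\<close> with one ear, running
    from its far end back to the base vertex.\<close>
  let ?VD = "{?v, f (Suc i)} \<union> set ?ps" and ?ED = "{Ed i} \<union> path_edges ?ps"
  have vps: "?v \<notin> set ps" using ps path_vertices[of ?v ps] avoid[of "Suc i"] len by auto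
  have pe: "path_edges ?ps = insert (Ed (j - 1)) (path_edges ps)"
    using path_edges_snoc[OF ps(1)] ps(3) len fj by (simp add: Ed_def)
  have ncv: "no_cut_vertex ?VD ?ED"
    using no_cut_vertex_edge[of ?v "f (Suc i)"] ps vps
    by (intro no_cut_vertex_ear) (auto simp: Ed_def)
  have "y \<in> range f" if "y \<in> set ps" for y
    using path_vertices[OF that] ps(2,5) W_range by blast
  moreover have "?ED \<subseteq> W" using pe ps(5) by auto
  moreover have "e \<subseteq> ?VD" if "e \<in> ?ED" for e
    using that path_edges_subset[of e ?ps] by (auto simp: Ed_def)
  ultimately have sub: "subgraph ?VD ?ED (range f) W" by (auto simp: subgraph_def)
  obtain VB EB where B: "is_block (range f) W VB EB" "?VD \<subseteq> VB" "?ED \<subseteq> EB"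
    using block_extends[OF finite_range finite_W sub ncv] by auto
  have B': "subgraph VB EB (range f) W" "no_cut_vertex VB EB" using B by (auto simp: is_block_def)
  have "f (Suc i) \<noteq> f (j - 1)" using neq len fj by (auto simp: Ed_def insert_commute)
  then have "card {?v, f (Suc i), f (j - 1)} = 3" using avoid[of "Suc i"] avoid[of "j - 1"] len by auto
  moreover have "{?v, f (Suc i), f (j - 1)} \<subseteq> VB" using B(2) ps(3) last_in_set[OF ps(1)] by auto
  moreover have "finite VB" using B' finite_range by (auto simp: subgraph_def intro: finite_subset)
  ultimately have "card VB \<ge> 3" using card_mono by metis
  then have "is_cycle VB EB" using no_cut_vertex_is_cycle[OF B'] by blast
  then show ?thesis using that[of VB EB] B pe by (auto simp: cyclic_block_def)
qed

lemma cyclic_blockD: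
  assumes "cyclic_block (range f) W VC EC"
  shows "subgraph VC EC (range f) W" "no_cut_vertex VC EC" "is_cycle VC EC" "finite VC" "finite EC"
    "e \<in> EC \<Longrightarrow> e \<in> W" "e \<in> EC \<Longrightarrow> e \<subseteq> VC" "x \<in> VC \<Longrightarrow> card {e\<in>EC. x \<in> e} = 2"
  using assms finite_W by (auto simp: cyclic_block_def is_block_def subgraph_def is_cycle_def
      intro: finite_subset[of EC W])

lemma cyclic_block_at_apex:
  assumes C: "cyclic_block (range f) W VC EC" and ch: "chord i j"
    and side: "VC - {f i} \<subseteq> side i j" and v: "f i \<in> VC"
  shows "{e\<in>EC. f i \<in> e} = ends i j" "Ed i \<noteq> Ed (j - 1)"
proof -
  note C = cyclic_blockD[OF C]
  have sub: "{e\<in>EC. f i \<in> e} \<subseteq> ends i j" using no_cut_vertex_ends[OF ch C(1,2) side] .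
  have "card (ends i j) \<le> 2" by (simp add: ends_def card_insert_if)
  then show eq: "{e\<in>EC. f i \<in> e} = ends i j" using C(8)[OF v] sub
    by (intro card_seteq) (auto simp: ends_def)
  then have "card (ends i j) = 2" using C(8)[OF v] by argo
  then show "Ed i \<noteq> Ed (j - 1)" by (auto simp: ends_def)
qed

lemma cyclic_block_at_chord:
  assumes C: "cyclic_block (range f) W VC EC" and ch: "chord i j" and v: "f i \<in> VC"
  shows "VC - {f i} \<subseteq> side i j \<and> {e\<in>EC. f i \<in> e} = ends i j \<and> Ed i \<noteq> Ed (j - 1) \<or>
    VC - {f i} \<subseteq> side j (i + n) \<and> {e\<in>EC. f i \<in> e} = ends j (i + n) \<and> Ed j \<noteq> Ed (i + n - 1)"
proof -
  have fj: "f j = f i" using ch by (simp add: chord_def)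
  show ?thesis
    using no_cut_vertex_in_side[OF ch cyclic_blockD(1,2)[OF C] v]
      cyclic_block_at_apex[OF C ch _ v] cyclic_block_at_apex[OF C chord_shift[OF ch]] v
    unfolding fj by blast
qed

text \<open>If the cycle lies on the complementary side of the chord, replacing the chord by its
  shift puts it on \<open>side i j\<close>, so one case is enough.\<close>

lemma cyclic_block_vertex_cases:
  assumes C: "cyclic_block (range f) W VC EC" and x: "x \<in> VC"
  obtains (single) m where "x = f m" "{e\<in>W. x \<in> e} = {Ed m, Ed (m + n - 1)}"
      "{e\<in>EC. x \<in> e} = {Ed m, Ed (m + n - 1)}" "even (m + n - 1) \<noteq> even m"
  | (double) i j where "x = f i" "chord i j" "VC - {x} \<subseteq> side i j" "{e\<in>EC. x \<in> e} = ends i j"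
      "Ed i \<noteq> Ed (j - 1)"
proof -
  note CD = cyclic_blockD[OF C]
  have "x \<in> range f" using x CD(1) by (auto simp: subgraph_def)
  then show ?thesis
  proof (cases rule: vertex_cases)
    case (single m)
    have "{e\<in>EC. x \<in> e} \<subseteq> {Ed m, Ed (m + n - 1)}" using single CD(6) by blast
    moreover have "card {Ed m, Ed (m + n - 1)} \<le> 2" by (simp add: card_insert_if)
    ultimately have "{e\<in>EC. x \<in> e} = {Ed m, Ed (m + n - 1)}" using CD(8)[OF x]
      by (intro card_seteq) auto
    then show ?thesis using that(1) single by blast
  next
    case (double i j)
    then show ?thesis using cyclic_block_at_chord[OF C double(2)] x that(2)[of i j]
       that(2)[of j "i + n"] chord_shift[OF double(2)] by (auto simp: chord_def)
  qed
qed

text \<open>An edge of a cyclic block is traversed only once per period. A second traversal has the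
  same parity, hence runs in the opposite direction, and yields a chord whose two
  \<open>ends\<close> coincide; a cycle through its base vertex cannot contain that edge on either
  side.\<close>

lemma cyclic_block_coeff:
  assumes C: "cyclic_block (range f) W VC EC" and k: "Ed k \<in> EC"
  shows "b (Ed k) = (-1) ^ k"
proof -
  have "l = k" if l: "l \<in> {k..<k+n}" "Ed l = Ed k" for l
  proof (rule ccontr)
    assume "l \<noteq> k"
    then have kl: "k < l" "l < k + n" using l by auto
    have par: "even l = even k" using l(2) sgn[of l k] by simp
    then have "f k \<noteq> f l" using odd_chord[OF kl] by auto
    then have eq: "f k = f (Suc l)" "f (Suc k) = f l" using l(2) by (auto simp: Ed_def doubleton_eq_iff)
    have "Suc l \<noteq> k + n" using par neven by presburger
    then have ch: "chord k (Suc l)" using kl eq by (auto simp: chord_def)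
    have v: "f k \<in> VC" using cyclic_blockD(7)[OF C k] by (auto simp: Ed_def)
    have "Ed k \<in> ends k (Suc l)" by (simp add: ends_def)
    moreover have "Ed k \<in> {e\<in>EC. f k \<in> e}" using k by (simp add: Ed_def)
    ultimately show False
      using cyclic_block_at_chord[OF C ch v] ends_disjoint[OF ch] l(2) by auto
  qed
  then have "{l\<in>{k..<k+n}. Ed l = Ed k} = {k}" using npos by auto
  then show ?thesis using vec_sign[of "{k..<k+n}" k] vec_window[of k] by simp
qed

lemma sum_bal:
  assumes "finite X" shows "(\<Sum>x\<in>X. bal h x) = (\<Sum>e\<in>W. h e * int (card (e \<inter> X)))"
proof -
  have "(\<Sum>x\<in>X. bal h x) = (\<Sum>e\<in>W. \<Sum>x\<in>{x\<in>X. x \<in> e}. h e)"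
    using assms sum.swap_restrict[of X W "\<lambda>x e. h e" "\<lambda>x e. x \<in> e"] by (simp add: bal_def)
  also have "\<dots> = (\<Sum>e\<in>W. h e * int (card (e \<inter> X)))"
    by (intro sum.cong) (auto simp: Int_def conj_commute)
  finally show ?thesis .
qed

text \<open>For a vertex visited twice, sum the balance equations over the side \<open>?X\<close>
  away from the cycle. Edges inside \<open>?X\<close> count twice and the edges joining it to the
  base vertex once, so the latter have even sum; balance at the base vertex transfers this to the
  cycle edges.\<close>

lemma cyclic_block_parity:
  assumes C: "cyclic_block (range f) W VC EC" and h: "\<And>x. bal h x = 0" and x: "x \<in> VC"
  shows "even (\<Sum>e | e \<in> EC \<and> x \<in> e. h e)"
  using C x
proof (cases rule: cyclic_block_vertex_cases)
  case (single m)
  then have "(\<Sum>e | e \<in> EC \<and> x \<in> e. h e) = bal h x" by (simp add: bal_def)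
  then show ?thesis using h by simp
next
  case (double i j)
  let ?X = "side j (i + n)"
  have ch: "chord i j" "chord j (i + n)" and fj: "f j = f i"
    using double chord_shift by (auto simp: chord_def)
  have at: "{e\<in>W. f i \<in> e} = ends i j \<union> ends j (i + n)"
  proof
    show "{e\<in>W. f i \<in> e} \<subseteq> ends i j \<union> ends j (i + n)" using edge_at_apex[OF ch(1)] by blast
    show "ends i j \<union> ends j (i + n) \<subseteq> {e\<in>W. f i \<in> e}"
      using endsD(1,2)[OF ch(1)] endsD(1,2)[OF ch(2)] unfolding fj by blast
  qed
  have fin: "finite (ends i j)" "finite (ends j (i + n))" by (auto simp: ends_def)
  have bal0: "(\<Sum>e\<in>ends i j. h e) + (\<Sum>e\<in>ends j (i + n). h e) = 0"
    using h[of "f i"] sum.union_disjoint[OF fin ends_disjoint[OF ch(1)], of h] at by (simp add: bal_def)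
  have "even (h e * int (card (e \<inter> ?X)) - (if e \<in> ends j (i + n) then h e else 0))" if e: "e \<in> W" for e
  proof (cases "f i \<in> e")
    case False
    then have "e \<inter> ?X = e \<or> e \<inter> ?X = {}"
      using edge_in_side[OF ch(1) e] sides_disjoint[OF ch(1)] by blast
    moreover have "e \<notin> ends j (i + n)" using False endsD(2)[OF ch(2)] fj by auto
    ultimately show ?thesis using card_W[OF e] by auto
  next
    case True
    then consider "e \<in> ends i j" | "e \<in> ends j (i + n)" using edge_at_apex[OF ch(1) e] by blast
    then show ?thesis
    proof cases
      case 1
      then have "e \<inter> ?X = {}" using endsD(3)[OF ch(1)] sides_disjoint[OF ch(1)] apex_notin_side'[OF ch(1)] by blast
      then show ?thesis using 1 ends_disjoint[OF ch(1)] by auto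
    next
      case 2
      then show ?thesis using endsD(4)[OF ch(2)] by simp
    qed
  qed
  then have "even (\<Sum>e\<in>W. h e * int (card (e \<inter> ?X)) - (if e \<in> ends j (i + n) then h e else 0))"
    by (intro dvd_sum) auto
  moreover have "(\<Sum>e\<in>W. h e * int (card (e \<inter> ?X))) = 0"
    using sum_bal[of ?X h] h by (simp add: side_def)
  moreover have "(\<Sum>e\<in>W. if e \<in> ends j (i + n) then h e else 0) = (\<Sum>e\<in>ends j (i + n). h e)"
  proof -
    have "ends j (i + n) \<subseteq> W" by (auto simp: ends_def)
    then have "W \<inter> {e. e \<in> ends j (i + n)} = ends j (i + n)" by auto
    then show ?thesis by (simp add: sum.If_cases)
  qed
  ultimately have "even (\<Sum>e\<in>ends j (i + n). h e)" by (simp add: sum_subtractf)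
  then have "even (\<Sum>e\<in>ends i j. h e)" using bal0 by presburger
  then show ?thesis using double by simp
qed

section \<open>Pure and mixed cyclic blocks\<close>

text \<open>A quantity that agrees on cycle edges sharing a vertex spreads along paths in the
  connected cycle. It is applied to signs and to parities.\<close>

lemma cyclic_block_constant:
  assumes C: "cyclic_block (range f) W VC EC"
    and P: "\<And>x e e'. x \<in> VC \<Longrightarrow> e \<in> EC \<Longrightarrow> e' \<in> EC \<Longrightarrow> x \<in> e \<Longrightarrow> x \<in> e' \<Longrightarrow> P e = P e'"
    and e: "e \<in> EC" "e' \<in> EC"
  shows "P e = P e'"
proof -
  note CD = cyclic_blockD[OF C]
  have "e \<noteq> {}" "e' \<noteq> {}" using card_W[OF CD(6)[OF e(1)]] card_W[OF CD(6)[OF e(2)]] by auto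
  then obtain x x' where x: "x \<in> e" "x' \<in> e'" by blast
  then have xV: "x \<in> VC" "x' \<in> VC" using CD(7) e by auto
  have "(x, x') \<in> (adj_rel EC)\<^sup>*" using CD(3) xV by (auto simp: is_cycle_def connected_graph_def)
  then have "\<forall>e'\<in>EC. x' \<in> e' \<longrightarrow> P e = P e'"
  proof (induction rule: rtrancl_induct)
    case base
    then show ?case using P[OF xV(1) e(1)] x(1) by blast
  next
    case (step y z)
    then have yz: "{y, z} \<in> EC" by (simp add: adj_rel_def)
    then have "z \<in> VC" using CD(7) by auto
    then have "P {y, z} = P e'" if "e' \<in> EC" "z \<in> e'" for e' using P[of z "{y, z}" e'] yz that by simp
    moreover have "P e = P {y, z}" using step yz by simp
    ultimately show ?case by simp
  qed
  then show ?thesis using e x by blast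
qed

text \<open>\<open>X\<close> collects the vertices that \<open>x\<close> separates from the cycle.\<close>

definition hangs_at :: "'v set \<Rightarrow> 'v set set \<Rightarrow> 'v \<Rightarrow> 'v set \<Rightarrow> bool" where
  "hangs_at VC EC x X \<longleftrightarrow> X \<inter> VC = {} \<and> (\<forall>e\<in>W. e \<inter> X \<noteq> {} \<longrightarrow> e \<subseteq> insert x X) \<and>
    {e\<in>W. x \<in> e} = {e\<in>EC. x \<in> e} \<union> {e\<in>W. x \<in> e \<and> e \<inter> X \<noteq> {}} \<and>
    (\<forall>y\<in>X. (y, x) \<in> (adj_rel {e\<in>W. e \<subseteq> insert x X})\<^sup>*)"

text \<open>At a vertex visited once the two cycle edges have opposite signs, which purity excludes.
  So every cycle vertex is visited twice, and the side away from the cycle serves as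
  \<open>X\<close>.\<close>

lemma hanging_part:
  assumes C: "cyclic_block (range f) W VC EC" and pure: "\<And>e. e \<in> EC \<Longrightarrow> b e = \<sigma>" and x: "x \<in> VC"
  shows "\<exists>X. hangs_at VC EC x X"
  using C x
proof (cases rule: cyclic_block_vertex_cases)
  case (single m)
  then have "Ed m \<in> EC" "Ed (m + n - 1) \<in> EC" by blast+
  then have "b (Ed m) = b (Ed (m + n - 1))" using pure by simp
  then show ?thesis using single(4) b_pos_iff[of m] b_pos_iff[of "m + n - 1"] by simp
next
  case (double i j)
  let ?X = "side j (i + n)"
  have ch: "chord i j" "chord j (i + n)" and fj: "f j = f i"
    using double chord_shift by (auto simp: chord_def)
  have X1: "?X \<inter> VC = {}"
    using double sides_disjoint[OF ch(1)] apex_notin_side'[OF ch(1)] by blast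
  have X2: "e \<subseteq> insert x ?X" if e: "e \<in> W" "e \<inter> ?X \<noteq> {}" for e
  proof (cases "f i \<in> e")
    case True
    then show ?thesis using edge_at_apex[OF ch(1) e(1)] endsD(3)[OF ch(1)] endsD(3)[OF ch(2)] fj double(1) e(2)
      sides_disjoint[OF ch(1)] apex_notin_side'[OF ch(1)] by blast
  next
    case False
    then show ?thesis using edge_in_side[OF ch(1) e(1)] sides_disjoint[OF ch(1)] e by blast
  qed
  have X3: "{e\<in>W. x \<in> e} = {e\<in>EC. x \<in> e} \<union> {e\<in>W. x \<in> e \<and> e \<inter> ?X \<noteq> {}}"
  proof -
    have "e \<inter> ?X \<noteq> {}" if "e \<in> ends j (i + n)" for e using endsD(4)[OF ch(2) that] by auto
    then show ?thesis using edge_at_apex[OF ch(1)] double cyclic_blockD(6)[OF C] by blast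
  qed
  let ?F = "{e\<in>W. e \<subseteq> insert x ?X}"
  have X4: "(y, x) \<in> (adj_rel ?F)\<^sup>*" if "y \<in> ?X" for y
  proof -
    obtain k where k: "j < k" "k < i + n" "y = f k" using \<open>y \<in> ?X\<close> by (auto simp: side_def)
    have "(f k, f l) \<in> (adj_rel ?F)\<^sup>*" if "k \<le> l" "l \<le> i + n" for l
      using that
    proof (induction l rule: dec_induct)
      case (step l)
      have "f l \<in> ?X" using step k by (intro sideI) auto
      moreover have "f (Suc l) \<in> insert x ?X"
        using step k per[of i] double(1) sideI[of j "Suc l" "i + n"] by (cases "Suc l = i + n") auto
      ultimately have "Ed l \<in> ?F" using Ed_in_W[of l] by (auto simp: Ed_def)
      then have "(f l, f (Suc l)) \<in> adj_rel ?F" by (simp add: adj_rel_def Ed_def)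
      then show ?case using step by (meson Suc_leD rtrancl_into_rtrancl)
    qed simp
    from this[of "i + n"] show ?thesis using k per[of i] double(1) by simp
  qed
  have "hangs_at VC EC x ?X" unfolding hangs_at_def by (intro conjI ballI impI X1 X2 X3 X4)
  then show ?thesis by blast
qed

text \<open>Supplies the binomials for \<open>no_divisor_family\<close>. The sign
  \<open>\<tau>\<close> selects the term to be excluded as a leading term: \<open>1\<close> stands
  for \<open>E^+\<close> and \<open>-1\<close> for \<open>E^-\<close>.\<close>

lemma pure_family:
  assumes C: "cyclic_block (range f) W VC EC" and pure: "\<And>e. e \<in> EC \<Longrightarrow> b e = \<sigma>"
    and \<sigma>: "\<sigma> = 1 \<or> \<sigma> = -1" and \<tau>: "\<tau> = 1 \<or> \<tau> = -1"
  shows "\<exists>H N. EC \<noteq> {} \<and> finite EC \<and> N > 0 \<and> (\<forall>e\<in>W. (\<Sum>t\<in>EC. H t e) = int N * (\<tau> * b e)) \<and>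
    (\<forall>t\<in>EC. (\<forall>x. bal (H t) x = 0) \<and> (\<forall>e\<in>W. H t e \<le> max 0 (\<tau> * b e)) \<and>
       (\<exists>e\<in>W. 0 < \<tau> * b e \<and> H t e \<le> 0))"
proof -
  note CD = cyclic_blockD[OF C]
  have \<sigma>2: "\<sigma> * \<sigma> = 1" using \<sigma> by auto
  have EC2: "\<forall>e\<in>EC. e \<subseteq> VC \<and> card e = 2" using CD(6,7) card_W by blast
  have cardEC: "card EC = card VC" using cycle_card_edges(2)[OF CD(3) EC2] .
  have cardVC: "card VC \<ge> 3" using CD(3) by (simp add: is_cycle_def)
  have ECne: "EC \<noteq> {}" using cardEC cardVC by auto
  obtain X where "\<And>x. x \<in> VC \<Longrightarrow> hangs_at VC EC x (X x)"
    using hanging_part[OF C pure] by metis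
  then have X:
    "\<And>x. x \<in> VC \<Longrightarrow> X x \<inter> VC = {}"
    "\<And>x e. x \<in> VC \<Longrightarrow> e \<in> W \<Longrightarrow> e \<inter> X x \<noteq> {} \<Longrightarrow> e \<subseteq> insert x (X x)"
    "\<And>x. x \<in> VC \<Longrightarrow> {e\<in>W. x \<in> e} = {e\<in>EC. x \<in> e} \<union> {e\<in>W. x \<in> e \<and> e \<inter> X x \<noteq> {}}"
    "\<And>x y. x \<in> VC \<Longrightarrow> y \<in> X x \<Longrightarrow> (y, x) \<in> (adj_rel {e\<in>W. e \<subseteq> insert x (X x)})\<^sup>*"
    unfolding hangs_at_def by simp_all
  \<comment> \<open>From a common vertex there is a path to \<open>y\<close> inside
    \<open>insert y (X y)\<close>. It could leave \<open>X x\<close> only through \<open>x\<close>,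
    which lies on the cycle and so is not in that set; hence \<open>y\<close> would belong to
    \<open>X x\<close>, against disjointness from the cycle.\<close>
  have Xdisj: "X x \<inter> X y = {}" if xy: "x \<in> VC" "y \<in> VC" "x \<noteq> y" for x y
  proof (rule ccontr)
    assume "X x \<inter> X y \<noteq> {}"
    then obtain z where z: "z \<in> X x" "z \<in> X y" by blast
    have "u \<in> X x" if "(z, u) \<in> (adj_rel {e\<in>W. e \<subseteq> insert y (X y)})\<^sup>*" for u
      using that
    proof (induction rule: rtrancl_induct)
      case (step u v)
      then have uv: "{u, v} \<in> W" "{u, v} \<subseteq> insert y (X y)" by (auto simp: adj_rel_def)
      have "v \<in> insert x (X x)" using X(2)[OF xy(1) uv(1)] step(3) by blast
      moreover have "v \<noteq> x" using uv(2) X(1)[OF xy(2)] xy by auto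
      ultimately show ?case by simp
    qed (rule z)
    then have "y \<in> X x" using X(4)[OF xy(2) z(2)] by blast
    then show False using X(1)[OF xy(1)] xy by blast
  qed
  define d where "d x e = (if e \<inter> X x \<noteq> {} then b e else 0)" for x e
  have d_unique: "x = y" if "x \<in> VC" "y \<in> VC" "e \<in> W" "e \<inter> X x \<noteq> {}" "e \<inter> X y \<noteq> {}" for x y e
    using Xdisj[of x y] X(1)[OF \<open>y \<in> VC\<close>] X(2)[of x e] that by blast
  have EC_X: "e \<inter> X x = {}" if "e \<in> EC" "x \<in> VC" for e x using X(1) CD(7) that by blast
  have d_sum: "(\<Sum>x\<in>A. d x e) = 0 \<or> (\<Sum>x\<in>A. d x e) = b e" if e: "e \<in> W" and A: "A \<subseteq> VC" for A e
  proof (cases "\<exists>x\<in>A. e \<inter> X x \<noteq> {}")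
    case True
    then obtain x where x: "x \<in> A" "e \<inter> X x \<noteq> {}" by blast
    have "(\<Sum>y\<in>A. d y e) = (\<Sum>y\<in>{x}. d y e)"
    proof (rule sum.mono_neutral_right)
      show "finite A" using A CD(4) finite_subset by blast
      show "\<forall>y\<in>A - {x}. d y e = 0" using d_unique[of _ x e] x e A by (auto simp: d_def)
    qed (use x in auto)
    then show ?thesis using x by (simp add: d_def)
  next
    case False
    then show ?thesis by (simp add: d_def)
  qed
  have d_EC: "(\<Sum>x\<in>A. d x e) = 0" if "e \<in> EC" "A \<subseteq> VC" for A e
    using that EC_X by (intro sum.neutral) (auto simp: d_def)
  have hang_sum: "(\<Sum>e | e \<in> W \<and> x \<in> e \<and> e \<inter> X x \<noteq> {}. b e) = - 2 * \<sigma>" if x: "x \<in> VC" for x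
  proof -
    have "(\<Sum>e | e \<in> W \<and> x \<in> e. b e) =
        (\<Sum>e | e \<in> EC \<and> x \<in> e. b e) + (\<Sum>e | e \<in> W \<and> x \<in> e \<and> e \<inter> X x \<noteq> {}. b e)"
      unfolding X(3)[OF x] using CD(5) EC_X[OF _ x] by (intro sum.union_disjoint) auto
    moreover have "(\<Sum>e | e \<in> EC \<and> x \<in> e. b e) = (\<Sum>e | e \<in> EC \<and> x \<in> e. \<sigma>)"
      using pure by (intro sum.cong) auto
    ultimately show ?thesis using bal_b[of x] CD(8)[OF x] by (simp add: bal_def)
  qed
  \<comment> \<open>The edges meeting \<open>X x\<close> carry all of \<open>b\<close> at vertices
    of \<open>X x\<close>, so balance fails only at \<open>x\<close>, where the cycle edges account
    for the missing \<open>2 * \<sigma>\<close>.\<close>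
  have bal_d: "bal (d x) y = (if y = x then - 2 * \<sigma> else 0)" if x: "x \<in> VC" for x y
  proof -
    have eq: "bal (d x) y = (\<Sum>e | e \<in> W \<and> y \<in> e \<and> e \<inter> X x \<noteq> {}. b e)"
      unfolding bal_def d_def by (intro sum.mono_neutral_cong_right) auto
    consider "y = x" | "y \<in> X x" "y \<noteq> x" | "y \<notin> insert x (X x)" by blast
    then show ?thesis
    proof cases
      case 1
      then show ?thesis using eq hang_sum[OF x] by simp
    next
      case 2
      then have "{e. e \<in> W \<and> y \<in> e \<and> e \<inter> X x \<noteq> {}} = {e. e \<in> W \<and> y \<in> e}" by auto
      then show ?thesis using eq 2 bal_b[of y] by (simp add: bal_def)
    next
      case 3
      then have none: "{e. e \<in> W \<and> y \<in> e \<and> e \<inter> X x \<noteq> {}} = {}" using X(2)[OF x] by blast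
      have "bal (d x) y = 0" unfolding eq none by simp
      moreover have "y \<noteq> x" using 3 by blast
      ultimately show ?thesis by simp
    qed
  qed
  have bal_sum_d: "(\<Sum>x\<in>A. bal (d x) y) = (if y \<in> A then - 2 * \<sigma> else 0)" if A: "A \<subseteq> VC" for A y
  proof -
    have "(\<Sum>x\<in>A. bal (d x) y) = (\<Sum>x\<in>A. if y = x then - 2 * \<sigma> else 0)"
      using A by (intro sum.cong) (auto simp: bal_d)
    then show ?thesis using finite_subset[OF A CD(4)] by (simp add: sum.delta)
  qed
  have bal_d_sum: "bal (\<lambda>e. \<Sum>x\<in>A. d x e) y = (\<Sum>x\<in>A. bal (d x) y)" for A y
    unfolding bal_def by (rule sum.swap)
  \<comment> \<open>The decomposition of \<open>b\<close> into the cycle and the hanging parts. It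
    is balanced, takes only the values \<open>0\<close> and \<open>b e\<close>, and is nonzero on
    the cycle, so primitivity makes it equal to \<open>b\<close> on \<open>W\<close>.\<close>
  define h where "h e = \<sigma> * of_bool (e \<in> EC) + (\<Sum>x\<in>VC. d x e)" for e
  have hb: "h e = b e" if "e \<in> W" for e
  proof -
    have "(\<forall>e\<in>W. h e = 0) \<or> (\<forall>e\<in>W. h e = b e)"
    proof (rule prim)
      fix y
      have "bal h y = \<sigma> * (\<Sum>e | e \<in> W \<and> y \<in> e. of_bool (e \<in> EC)) + bal (\<lambda>e. \<Sum>x\<in>VC. d x e) y"
        unfolding bal_def h_def by (simp add: sum.distrib sum_distrib_left)
      also have "(\<Sum>e | e \<in> W \<and> y \<in> e. of_bool (e \<in> EC)) = int (card {e\<in>EC. y \<in> e})"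
      proof -
        have "(\<Sum>e | e \<in> W \<and> y \<in> e. of_bool (e \<in> EC)) = (\<Sum>e\<in>{e\<in>EC. y \<in> e}. 1::int)"
          using CD(6) by (intro sum.mono_neutral_cong_right) auto
        then show ?thesis by simp
      qed
      finally have *: "bal h y = \<sigma> * int (card {e\<in>EC. y \<in> e}) + (if y \<in> VC then - 2 * \<sigma> else 0)"
        using bal_d_sum bal_sum_d[of VC] by simp
      have "card {e\<in>EC. y \<in> e} = 0" if "y \<notin> VC"
      proof -
        have none: "{e\<in>EC. y \<in> e} = {}" using CD(7) that by blast
        show ?thesis unfolding none by simp
      qed
      then show "bal h y = 0" using * CD(8)[of y] by (cases "y \<in> VC") auto
    next
      fix e assume e: "e \<in> W"
      have "h e = 0 \<or> h e = b e"
        using d_sum[OF e, of VC] d_EC[of e VC] pure[of e] by (auto simp: h_def)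
      then show "0 \<le> h e \<and> h e \<le> b e \<or> b e \<le> h e \<and> h e \<le> 0" by auto
    qed
    moreover obtain e0 where "e0 \<in> EC" using ECne by blast
    then have "e0 \<in> W" "h e0 \<noteq> 0" using d_EC[of e0 VC] \<sigma> CD(6) by (auto simp: h_def)
    ultimately show ?thesis using that by blast
  qed
  \<comment> \<open>\<open>H\<close> is \<open>\<sigma> (b - g t)\<close> if \<open>\<tau> = \<sigma>\<close> and \<open>- \<sigma> g t\<close> otherwise.\<close>
  define g where "g t e = 2 * \<sigma> * of_bool (e = t) + (\<Sum>x\<in>t. d x e)" for t e
  have tV: "t \<subseteq> VC" "t \<in> W" if "t \<in> EC" for t using CD(6,7) that by auto
  have bal_g: "bal (g t) y = 0" if t: "t \<in> EC" for t y
  proof -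
    have "bal (g t) y = 2 * \<sigma> * (\<Sum>e | e \<in> W \<and> y \<in> e. of_bool (e = t)) + bal (\<lambda>e. \<Sum>x\<in>t. d x e) y"
      unfolding bal_def g_def by (simp add: sum.distrib sum_distrib_left)
    also have "(\<Sum>e | e \<in> W \<and> y \<in> e. of_bool (e = t)) = (of_bool (y \<in> t) :: int)"
      using tV[OF t] by (simp add: of_bool_def sum.delta)
    finally show ?thesis using bal_d_sum bal_sum_d[OF tV(1)[OF t]] by simp
  qed
  have g_other: "g t e = 0 \<or> g t e = b e" if "t \<in> EC" "e \<in> W" "e \<noteq> t" for t e
    using d_sum[OF that(2) tV(1)[OF that(1)]] that(3) by (simp add: g_def)
  have g_self: "g t t = 2 * \<sigma>" if "t \<in> EC" for t
    using d_EC[OF that tV(1)[OF that]] by (simp add: g_def)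
  \<comment> \<open>Each cycle vertex lies on two cycle edges, so every \<open>d x\<close> is
    counted twice, matching the coefficient \<open>2 * \<sigma>\<close> of each cycle edge.\<close>
  have sum_g: "(\<Sum>t\<in>EC. g t e) = 2 * b e" if "e \<in> W" for e
  proof -
    have "(\<Sum>t\<in>EC. \<Sum>x\<in>t. d x e) = (\<Sum>t\<in>EC. \<Sum>x\<in>{x\<in>VC. x \<in> t}. d x e)"
      using CD(7) by (intro sum.cong refl) auto
    also have "\<dots> = (\<Sum>x\<in>VC. \<Sum>t\<in>{t\<in>EC. x \<in> t}. d x e)"
      by (rule sum.swap_restrict[OF CD(5,4)])
    also have "\<dots> = (\<Sum>x\<in>VC. 2 * d x e)" using CD(8) by (intro sum.cong) auto
    finally have "(\<Sum>t\<in>EC. g t e) = 2 * \<sigma> * of_bool (e \<in> EC) + 2 * (\<Sum>x\<in>VC. d x e)"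
      using CD(5) by (simp add: g_def sum.distrib flip: sum_distrib_left)
    then show ?thesis using hb[OF that] by (simp add: h_def)
  qed
  show ?thesis
  proof (cases "\<tau> = \<sigma>")
    case True
    define H where "H t e = \<sigma> * (b e - g t e)" for t e
    \<comment> \<open>The cycle has at least three edges, so the natural subtraction is exact and
      the factor is positive.\<close>
    have "(\<Sum>t\<in>EC. H t e) = int (card EC - 2) * (\<tau> * b e)" if "e \<in> W" for e
      using sum_g[OF that] cardEC cardVC True
      by (simp add: H_def sum_subtractf algebra_simps flip: sum_distrib_left)
    moreover have "bal (H t) x = 0" if "t \<in> EC" for t x
      using bal_g[OF that, of x] bal_b[of x]
      by (simp add: bal_def H_def sum_subtractf flip: sum_distrib_left)
    moreover have "H t e \<le> max 0 (\<tau> * b e)" if "t \<in> EC" "e \<in> W" for t e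
      using g_other[OF that] g_self[OF that(1)] pure[OF that(1)] True \<sigma>
      by (cases "e = t") (auto simp: H_def)
    \<comment> \<open>The witness is \<open>t\<close> itself, where
      \<open>b t - g t t = - \<sigma>\<close> and hence \<open>H t t = -1\<close>.\<close>
    moreover have "\<exists>e\<in>W. 0 < \<tau> * b e \<and> H t e \<le> 0" if "t \<in> EC" for t
      using g_self[OF that] pure[OF that] True \<sigma> tV(2)[OF that] by (intro bexI[of _ t]) (auto simp: H_def)
    ultimately show ?thesis using ECne CD(5) cardEC cardVC
      by (intro exI[of _ H] exI[of _ "card EC - 2"]) auto
  next
    case False
    then have ts: "\<tau> = - \<sigma>" using \<sigma> \<tau> by auto
    define H where "H t e = - \<sigma> * g t e" for t e
    have "(\<Sum>t\<in>EC. H t e) = int 2 * (\<tau> * b e)" if "e \<in> W" for e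
      using sum_g[OF that] ts by (simp add: H_def sum_negf flip: sum_distrib_left)
    moreover have "bal (H t) x = 0" if "t \<in> EC" for t x
      using bal_g[OF that, of x] by (simp add: bal_def H_def sum_negf flip: sum_distrib_left)
    moreover have "H t e \<le> max 0 (\<tau> * b e)" if "t \<in> EC" "e \<in> W" for t e
      using g_other[OF that] g_self[OF that(1)] ts \<sigma> by (cases "e = t") (auto simp: H_def)
    \<comment> \<open>A cycle vertex \<open>z\<close> off \<open>t\<close> exists. Its hanging edges
      at \<open>z\<close> sum to \<open>-2 * \<sigma>\<close>, so one of them has sign opposite to
      \<open>\<sigma>\<close>, and \<open>g t\<close> vanishes there.\<close>
    moreover have "\<exists>e\<in>W. 0 < \<tau> * b e \<and> H t e \<le> 0" if t: "t \<in> EC" for t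
    proof -
      have "card t = 2" "finite t" using EC2 t finite_subset[OF tV(1)[OF t] CD(4)] by auto
      then have "\<not> VC \<subseteq> t" using cardVC card_mono[of t VC] by auto
      then obtain z where z: "z \<in> VC" "z \<notin> t" by blast
      have "\<exists>e. e \<in> W \<and> z \<in> e \<and> e \<inter> X z \<noteq> {} \<and> \<sigma> * b e < 0"
      proof (rule ccontr)
        assume "\<not> ?thesis"
        then have "0 \<le> (\<Sum>e | e \<in> W \<and> z \<in> e \<and> e \<inter> X z \<noteq> {}. \<sigma> * b e)"
          by (intro sum_nonneg) (auto simp: not_less)
        then show False using hang_sum[OF z(1)] \<sigma>2 by (simp flip: sum_distrib_left)
      qed
      then obtain e where e: "e \<in> W" "e \<inter> X z \<noteq> {}" "\<sigma> * b e < 0" by blast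
      have "d x e = 0" if "x \<in> t" for x
        using d_unique[of x z e] e z that tV(1)[OF t] by (auto simp: d_def)
      moreover have "e \<noteq> t" using EC_X[OF t z(1)] e(2) by blast
      ultimately have "H t e = 0" by (simp add: H_def g_def)
      then show ?thesis using e ts by (intro bexI[of _ e]) auto
    qed
    ultimately show ?thesis using ECne CD(5) by (intro exI[of _ H] exI[of _ "2::nat"]) auto
  qed
qed


section \<open>Mixed blocks and the supporting functional\<close>

lemma cyclic_block_single_vertex:
  assumes C: "cyclic_block (range f) W VC EC"
    and mixed: "e \<in> EC" "e' \<in> EC" "b e > 0" "b e' < 0"
  obtains x m where "{d\<in>W. x \<in> d} = {Ed m, Ed (m + n - 1)}" "Ed m \<in> EC" "Ed (m + n - 1) \<in> EC"
    "even (m + n - 1) \<noteq> even m"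
proof -
  have "\<exists>x m. {d\<in>W. x \<in> d} = {Ed m, Ed (m + n - 1)} \<and> Ed m \<in> EC \<and> Ed (m + n - 1) \<in> EC \<and>
    even (m + n - 1) \<noteq> even m"
  proof (rule ccontr)
    assume none: "\<not> ?thesis"
    have "(b d > 0) = (b d' > 0)" if x: "x \<in> VC" and d: "d \<in> EC" "d' \<in> EC" "x \<in> d" "x \<in> d'" for x d d'
      using C x
    proof (cases rule: cyclic_block_vertex_cases)
      case (single m)
      then have "Ed m \<in> EC" "Ed (m + n - 1) \<in> EC" by blast+
      then show ?thesis using none single by blast
    next
      case (double i j)
      \<comment> \<open>A chord has odd length, so its first and last step have the same sign. If
        every cycle vertex were visited twice, the sign would be constant on the cycle.\<close>
      have "even (j - 1) = even i" using odd_chord[of i j] double(2) by (auto simp: chord_def)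
      moreover have "d \<in> {Ed i, Ed (j - 1)}" "d' \<in> {Ed i, Ed (j - 1)}"
        using double(4) d unfolding ends_def by blast+
      ultimately show ?thesis using b_pos_iff[of i] b_pos_iff[of "j - 1"] by auto
    qed
    then have "(b e > 0) = (b e' > 0)" by (rule cyclic_block_constant[OF C _ mixed(1,2)])
    then show False using mixed by simp
  qed
  then show ?thesis using that by blast
qed

text \<open>Since \<open>min 0 (b e)\<close> is minus the exponent of \<open>e\<close> in
  \<open>E^-\<close>, these are on \<open>W\<close> the differences between a member of the fiber of
  \<open>E^-\<close> and \<open>E^-\<close> itself.\<close>

definition admissible :: "('v set \<Rightarrow> int) \<Rightarrow> bool" where
  "admissible h \<longleftrightarrow> (\<forall>x. bal h x = 0) \<and> (\<forall>e\<in>W. min 0 (b e) \<le> h e)"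

text \<open>At a vertex with only two edges in \<open>W\<close> the balance equation reads
  \<open>h (Ed k) + h (Ed l) = 0\<close>, and the lower bounds leave \<open>h (Ed k)\<close> only
  the values \<open>0\<close> and \<open>1\<close>. All values of \<open>h\<close> on the cycle have
  this same parity, which improves each lower bound \<open>min 0 (b d)\<close> to
  \<open>b d * h p\<close>.\<close>

lemma cyclic_block_dominates:
  assumes C: "cyclic_block (range f) W VC EC"
    and mixed: "e \<in> EC" "e' \<in> EC" "b e > 0" "b e' < 0"
  obtains p where "p \<in> EC" "b p = 1" "\<And>h d. admissible h \<Longrightarrow> d \<in> EC \<Longrightarrow> b d * h p \<le> h d"
proof -
  note CD = cyclic_blockD[OF C]
  obtain x m where m: "{d\<in>W. x \<in> d} = {Ed m, Ed (m + n - 1)}" "Ed m \<in> EC" "Ed (m + n - 1) \<in> EC"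
    "even (m + n - 1) \<noteq> even m" using cyclic_block_single_vertex[OF C mixed] by blast
  obtain k l where kl: "even k" "odd l" "{d\<in>W. x \<in> d} = {Ed k, Ed l}" "Ed k \<in> EC" "Ed l \<in> EC"
  proof (cases "even m")
    case True
    show ?thesis by (rule that[of m "m + n - 1"]) (use m True in \<open>simp_all only: simp_thms\<close>)
  next
    case False
    show ?thesis by (rule that[of "m + n - 1" m])
      (use m False in \<open>simp_all only: simp_thms insert_commute\<close>)
  qed
  have bkl: "b (Ed k) = 1" "b (Ed l) = -1"
    using cyclic_block_coeff[OF C] kl by auto
  then have neq: "Ed k \<noteq> Ed l" by auto
  have "b d * h (Ed k) \<le> h d" if h: "admissible h" and d: "d \<in> EC" for h d
  proof -
    have bal: "bal h y = 0" for y using h by (simp add: admissible_def)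
    have ge: "min 0 (b e) \<le> h e" if "e \<in> W" for e using h that by (simp add: admissible_def)
    have "h (Ed k) + h (Ed l) = 0" using bal[of x] neq unfolding bal_def kl(3) by simp
    then have t: "h (Ed k) = 0 \<or> h (Ed k) = 1" using ge[OF Ed_in_W, of k] ge[OF Ed_in_W, of l] bkl by auto
    have "even (h d) = even (h (Ed k))"
    proof (rule cyclic_block_constant[OF C _ d kl(4)])
      fix y e e' assume y: "y \<in> VC" "e \<in> EC" "e' \<in> EC" "y \<in> e" "y \<in> e'"
      show "even (h e) = even (h e')"
      proof (cases "e = e'")
        case False
        then have "{e, e'} = {d\<in>EC. y \<in> d}" using y CD(5) CD(8)[OF y(1)] by (intro card_subset_eq) auto
        then have at: "{d. d \<in> EC \<and> y \<in> d} = {e, e'}" by simp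
        have "(\<Sum>d | d \<in> EC \<and> y \<in> d. h d) = h e + h e'" unfolding at using False by simp
        then show ?thesis using cyclic_block_parity[OF C bal y(1)] by simp
      qed simp
    qed
    then have par: "even (h d) \<longleftrightarrow> h (Ed k) = 0" using t by auto
    obtain i where i: "d = Ed i" using CD(6)[OF d] by (auto simp: W_def)
    then have bd: "b d = 1 \<or> b d = -1" using cyclic_block_coeff[OF C, of i] d by (cases "even i") auto
    have hd: "min 0 (b d) \<le> h d" using ge CD(6) d by blast
    show ?thesis
    proof (cases "h (Ed k) = 0")
      case True
      then have "h d \<noteq> -1" using par by auto
      then show ?thesis using True bd hd by auto
    next
      case False
      then have "h (Ed k) = 1" "h d \<noteq> 0" using par t by auto
      then show ?thesis using bd hd by auto
    qed
  qed
  then show ?thesis using that kl(4) bkl(1) by blast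
qed

text \<open>Distinct \<open>ends\<close> lie in a common cyclic block, where the ratio of
  \<open>h\<close> to \<open>b\<close> is constant by assumption. They have the same sign, so their
  \<open>b\<close>-values do not cancel; this lets a balance equation be divided by the sum.\<close>

lemma ends_ratio:
  fixes h :: "'v set \<Rightarrow> int"
  assumes ch: "chord i j"
    and blk: "\<forall>VC EC. cyclic_block (range f) W VC EC \<longrightarrow> (\<exists>t. \<forall>e\<in>EC. h e = b e * t)"
  shows "\<exists>r::real. (\<forall>e\<in>ends i j. h e = r * b e) \<and> (\<Sum>e\<in>ends i j. b e) \<noteq> 0"
proof (cases "Ed i = Ed (j - 1)")
  case True
  then have "ends i j = {Ed i}" by (simp add: ends_def)
  then show ?thesis using b_nonzero[of i] by (intro exI[of _ "h (Ed i) / b (Ed i)"]) simp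
next
  case False
  obtain VC EC where C: "cyclic_block (range f) W VC EC" "Ed i \<in> EC" "Ed (j - 1) \<in> EC"
    using ends_in_cyclic_block[OF ch False] by blast
  obtain t where t: "\<forall>e\<in>EC. h e = b e * t" using blk C(1) by blast
  have "even (j - 1) = even i" using odd_chord[of i j] ch by (auto simp: chord_def)
  then have "(\<Sum>e\<in>ends i j. b e) \<noteq> 0"
    using False cyclic_block_coeff[OF C(1,2)] cyclic_block_coeff[OF C(1,3)]
    by (cases "even i") (auto simp: ends_def)
  moreover have "h e = of_int t * real_of_int (b e)" if "e \<in> ends i j" for e
    using t C(2,3) that by (auto simp: ends_def)
  ultimately show ?thesis by blast
qed

text \<open>The ratio of \<open>h\<close> to \<open>b\<close> is the same on consecutive steps. At a
  vertex visited once this is the balance of both vectors on two edges; at a vertex visited twice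
  each pair of \<open>ends\<close> has a ratio of its own, and balance equates the two.\<close>

lemma proportional:
  fixes h :: "'v set \<Rightarrow> int"
  assumes bal: "\<And>x. bal h x = 0"
    and blk: "\<forall>VC EC. cyclic_block (range f) W VC EC \<longrightarrow> (\<exists>t. \<forall>e\<in>EC. h e = b e * t)"
  shows "\<exists>r::real. \<forall>e\<in>W. h e = r * b e"
proof -
  define r :: "nat \<Rightarrow> real" where "r k = h (Ed k) / b (Ed k)" for k
  have hr: "h (Ed k) = r k * b (Ed k)" for k using b_nonzero[of k] by (simp add: r_def)
  have "r (Suc k) = r k" for k
  proof -
    let ?m = "Suc k"
    have km: "Ed (?m + n - 1) = Ed k" by simp
    show ?thesis
    proof (cases "\<exists>j. ?m < j \<and> j < ?m + n \<and> f j = f ?m")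
      case False
      then have s: "{e\<in>W. f ?m \<in> e} = {Ed ?m, Ed k}" using single_edges(1)[of ?m] km by metis
      have neq: "Ed ?m \<noteq> Ed k" using b_pos_iff[of ?m] b_pos_iff[of k] by auto
      have "h (Ed ?m) + h (Ed k) = 0" "b (Ed ?m) + b (Ed k) = 0"
        using bal[of "f ?m"] bal_b[of "f ?m"] neq unfolding bal_def s by simp_all
      then have "h (Ed ?m) = - h (Ed k)" "b (Ed ?m) = - b (Ed k)" by simp_all
      then show ?thesis by (simp add: r_def)
    next
      case True
      then obtain j where ch: "chord ?m j" by (force simp: chord_def)
      have ch': "chord j (?m + n)" using chord_shift[OF ch] .
      have fj: "f j = f ?m" using ch by (simp add: chord_def)
      obtain r1 :: real where r1: "\<forall>e\<in>ends ?m j. h e = r1 * b e" "(\<Sum>e\<in>ends ?m j. b e) \<noteq> 0"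
        using ends_ratio[OF ch blk] by blast
      obtain r2 :: real where r2: "\<forall>e\<in>ends j (?m + n). h e = r2 * b e"
        using ends_ratio[OF ch' blk] by blast
      have at: "{e\<in>W. f ?m \<in> e} = ends ?m j \<union> ends j (?m + n)"
      proof
        show "{e\<in>W. f ?m \<in> e} \<subseteq> ends ?m j \<union> ends j (?m + n)" using edge_at_apex[OF ch] by blast
        show "ends ?m j \<union> ends j (?m + n) \<subseteq> {e\<in>W. f ?m \<in> e}"
          using endsD(1,2)[OF ch] endsD(1,2)[OF ch'] unfolding fj by blast
      qed
      have fin: "finite (ends ?m j)" "finite (ends j (?m + n))" by (auto simp: ends_def)
      have split: "bal g (f ?m) = (\<Sum>e\<in>ends ?m j. g e) + (\<Sum>e\<in>ends j (?m + n). g e)" for g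
        unfolding bal_def at by (rule sum.union_disjoint[OF fin ends_disjoint[OF ch]])
      have "real_of_int (\<Sum>e\<in>ends ?m j. h e) = r1 * real_of_int (\<Sum>e\<in>ends ?m j. b e)"
        using r1(1) by (simp add: sum_distrib_left)
      moreover have "real_of_int (\<Sum>e\<in>ends j (?m + n). h e) = r2 * real_of_int (\<Sum>e\<in>ends j (?m + n). b e)"
        using r2(1) by (simp add: sum_distrib_left)
      moreover have "(\<Sum>e\<in>ends j (?m + n). h e) = - (\<Sum>e\<in>ends ?m j. h e)"
         "(\<Sum>e\<in>ends j (?m + n). b e) = - (\<Sum>e\<in>ends ?m j. b e)"
        using split[of h] split[of b] bal[of "f ?m"] bal_b[of "f ?m"] by simp_all
      ultimately have "r1 * real_of_int (\<Sum>e\<in>ends ?m j. b e) = r2 * real_of_int (\<Sum>e\<in>ends ?m j. b e)"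
        by (simp del: of_int_sum)
      then have "r1 = r2" using r1(2) by (simp del: of_int_sum)
      moreover have "r ?m = r1" using r1(1) b_nonzero[of ?m] by (simp add: ends_def r_def)
      moreover have "r k = r2" using r2 b_nonzero[of k] km by (simp add: ends_def r_def)
      ultimately show ?thesis by simp
    qed
  qed
  then have "r k = r 0" for k by (induction k) auto
  then have "\<forall>e\<in>W. h e = r 0 * b e" using hr by (auto simp: W_def)
  then show ?thesis by blast
qed

lemma mixed_weight:
  assumes mixed: "\<forall>VC EC. cyclic_block (range f) W VC EC \<longrightarrow> (\<exists>e\<in>EC. \<exists>e'\<in>EC. b e > 0 \<and> b e' < 0)"
  obtains \<omega> :: "'v set \<Rightarrow> int" where "(\<Sum>e\<in>W. \<omega> e * b e) = 0"
    "\<And>h. admissible h \<Longrightarrow> (\<Sum>e\<in>W. \<omega> e * h e) \<le> 0 \<Longrightarrow> (\<forall>e\<in>W. h e = 0) \<or> (\<forall>e\<in>W. h e = b e)"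
proof -
  define CB where "CB = {EC. \<exists>VC. cyclic_block (range f) W VC EC}"
  have CBW: "EC \<subseteq> W" if "EC \<in> CB" for EC using that cyclic_blockD(6) by (fastforce simp: CB_def)
  then have finCB: "finite CB" by (intro finite_subset[of CB "Pow W"]) auto
  have finEC: "finite EC" if "EC \<in> CB" for EC using finite_subset[OF CBW[OF that] finite_W] .
  have "\<exists>p. p \<in> EC \<and> b p = 1 \<and> (\<forall>h d. admissible h \<longrightarrow> d \<in> EC \<longrightarrow> b d * h p \<le> h d)" if "EC \<in> CB" for EC
  proof -
    obtain VC where C: "cyclic_block (range f) W VC EC" using \<open>EC \<in> CB\<close> unfolding CB_def by blast
    obtain e e' where "e \<in> EC" "e' \<in> EC" "b e > 0" "b e' < 0" using mixed C by blast
    then show ?thesis using cyclic_block_dominates[OF C] by metis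
  qed
  then obtain p where p: "\<And>EC. EC \<in> CB \<Longrightarrow> p EC \<in> EC" "\<And>EC. EC \<in> CB \<Longrightarrow> b (p EC) = 1"
    "\<And>EC h d. EC \<in> CB \<Longrightarrow> admissible h \<Longrightarrow> d \<in> EC \<Longrightarrow> b d * h (p EC) \<le> h d"
    by metis
  \<comment> \<open>Coefficients chosen so that the functional at \<open>h\<close> is the sum of all
    the nonnegative differences \<open>h d - b d * h (p EC)\<close>; at \<open>b\<close> they vanish
    because \<open>b (p EC) = 1\<close>.\<close>
  define \<omega> where "\<omega> e = (\<Sum>EC\<in>CB. \<Sum>d\<in>EC. of_bool (e = d) - b d * of_bool (e = p EC))" for e
  have eval: "(\<Sum>e\<in>W. \<omega> e * h e) = (\<Sum>EC\<in>CB. \<Sum>d\<in>EC. h d - b d * h (p EC))" for h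
  proof -
    have "(\<Sum>e\<in>W. \<omega> e * h e) =
        (\<Sum>EC\<in>CB. \<Sum>d\<in>EC. \<Sum>e\<in>W. (of_bool (e = d) - b d * of_bool (e = p EC)) * h e)"
      unfolding \<omega>_def sum_distrib_right
      by (subst sum.swap) (intro sum.cong refl sum.swap)
    also have "\<dots> = (\<Sum>EC\<in>CB. \<Sum>d\<in>EC. h d - b d * h (p EC))"
    proof (intro sum.cong refl)
      fix EC d assume EC: "EC \<in> CB" "d \<in> EC"
      then have dW: "d \<in> W" "p EC \<in> W" using CBW p(1) by auto
      have indicator: "(\<Sum>e\<in>W. of_bool (e = a) * h e) = h a" if "a \<in> W" for a
        using sum.remove[OF finite_W that, of "\<lambda>e. of_bool (e = a) * h e"] by simp
      have "(\<Sum>e\<in>W. (of_bool (e = d) - b d * of_bool (e = p EC)) * h e) =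
         (\<Sum>e\<in>W. of_bool (e = d) * h e) - b d * (\<Sum>e\<in>W. of_bool (e = p EC) * h e)"
        by (simp only: left_diff_distrib sum_subtractf sum_distrib_left mult.assoc)
      also have "\<dots> = h d - b d * h (p EC)" using dW by (simp add: indicator)
      finally show "(\<Sum>e\<in>W. (of_bool (e = d) - b d * of_bool (e = p EC)) * h e) = h d - b d * h (p EC)" .
    qed
    finally show ?thesis .
  qed
  have "(\<Sum>e\<in>W. \<omega> e * b e) = 0" unfolding eval using p(2) by (intro sum.neutral ballI) simp
  moreover have "(\<forall>e\<in>W. h e = 0) \<or> (\<forall>e\<in>W. h e = b e)"
    if h: "admissible h" and le: "(\<Sum>e\<in>W. \<omega> e * h e) \<le> 0" for h
  proof -
    have bal: "bal h y = 0" for y using h by (simp add: admissible_def)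
    have ge: "min 0 (b e) \<le> h e" if "e \<in> W" for e using h that by (simp add: admissible_def)
    have nonneg: "0 \<le> (\<Sum>d\<in>EC. h d - b d * h (p EC))" if "EC \<in> CB" for EC
      using p(3)[OF that h] by (intro sum_nonneg) simp
    then have "(\<Sum>EC\<in>CB. \<Sum>d\<in>EC. h d - b d * h (p EC)) = 0"
      using le sum_nonneg[of CB] unfolding eval by (metis (no_types, lifting) order_antisym)
    then have "\<forall>EC\<in>CB. (\<Sum>d\<in>EC. h d - b d * h (p EC)) = 0"
      by (subst sum_nonneg_eq_0_iff[OF finCB, symmetric]) (auto intro: nonneg)
    then have zero: "(\<Sum>d\<in>EC. h d - b d * h (p EC)) = 0" if "EC \<in> CB" for EC
      using that by blast
    have eq: "h d = b d * h (p EC)" if EC: "EC \<in> CB" "d \<in> EC" for EC d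
    proof -
      have "\<forall>d\<in>EC. h d - b d * h (p EC) = 0"
        using zero[OF EC(1)] p(3)[OF EC(1) h] by (subst sum_nonneg_eq_0_iff[OF finEC[OF EC(1)], symmetric]) auto
      then show ?thesis using EC(2) by simp
    qed
    have "\<forall>VC EC. cyclic_block (range f) W VC EC \<longrightarrow> (\<exists>t. \<forall>e\<in>EC. h e = b e * t)"
    proof (intro allI impI)
      fix VC EC assume "cyclic_block (range f) W VC EC"
      then have "EC \<in> CB" by (auto simp: CB_def)
      then show "\<exists>t. \<forall>e\<in>EC. h e = b e * t" using eq by (intro exI[of _ "h (p EC)"]) blast
    qed
    then have "\<exists>r::real. \<forall>e\<in>W. h e = r * b e" by (rule proportional[OF bal])
    then obtain r :: real where r: "\<And>e. e \<in> W \<Longrightarrow> h e = r * b e" by blast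
    \<comment> \<open>One positive and one negative edge bound the ratio by \<open>0\<close> and
      \<open>1\<close>, so \<open>h\<close> lies between \<open>0\<close> and \<open>b\<close> and
      primitivity applies.\<close>
    have "b (Ed 0) > 0" "b (Ed 1) < 0" using b_pos_iff[of 0] b_neg_iff[of 1] by simp_all
    then have "real_of_int (h (Ed 0)) \<ge> 0" "real_of_int (h (Ed 1)) \<ge> b (Ed 1)"
      using ge[OF Ed_in_W, of 0] ge[OF Ed_in_W, of 1] by simp_all
    then have "0 \<le> r * b (Ed 0)" "b (Ed 1) \<le> r * b (Ed 1)" using r[OF Ed_in_W, of 0] r[OF Ed_in_W, of 1] by simp_all
    then have r01: "0 \<le> r" "r \<le> 1" using \<open>b (Ed 0) > 0\<close> \<open>b (Ed 1) < 0\<close>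
      by (simp_all add: zero_le_mult_iff)
    show ?thesis
    proof (rule prim[OF bal])
      fix e assume e: "e \<in> W"
      show "0 \<le> h e \<and> h e \<le> b e \<or> b e \<le> h e \<and> h e \<le> 0"
      proof (cases "b e \<ge> 0")
        case True
        then have "0 \<le> r * b e" "r * b e \<le> 1 * b e" using r01 True mult_right_mono[of r 1 "real_of_int (b e)"] by simp_all
        then show ?thesis unfolding r[OF e, symmetric] by simp
      next
        case False
        then have "r * b e \<le> 0" "1 * b e \<le> r * b e"
          using r01 False mult_right_mono_neg[of r 1 "real_of_int (b e)"] by (simp_all add: mult_le_0_iff)
        then show ?thesis unfolding r[OF e, symmetric] by simp
      qed
    qed
  qed
  ultimately show ?thesis using that by blast
qed

end

section \<open>Reduced Groebner bases of toric ideals\<close>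

lemma mons_0 [simp]: "0 \<in> mons X" by (simp add: mons_def)

lemma mons_iff: "m \<in> mons X \<longleftrightarrow> (\<forall>x. x \<notin> X \<longrightarrow> Poly_Mapping.lookup m x = 0)"
  by (auto simp: mons_def in_keys_iff)

lemma mons_add [simp]: "m \<in> mons X \<Longrightarrow> n \<in> mons X \<Longrightarrow> m + n \<in> mons X"
  by (simp add: mons_iff lookup_add)

lemma mons_sum: "(\<And>t. t \<in> T \<Longrightarrow> u t \<in> mons X) \<Longrightarrow> (\<Sum>t\<in>T. u t) \<in> mons X"
  by (simp add: mons_iff lookup_sum)

lemma mdvd_refl [simp]: "mdvd m m" by (simp add: mdvd_def)

lemma mdvd_antisym: "mdvd m n \<Longrightarrow> mdvd n m \<Longrightarrow> m = n"
  by (auto simp: mdvd_def intro!: poly_mapping_eqI order_antisym)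

lemma mdvd_trans: "mdvd l m \<Longrightarrow> mdvd m n \<Longrightarrow> mdvd l n"
  unfolding mdvd_def using order_trans by blast

lemma mdvd_mons: "mdvd m n \<Longrightarrow> n \<in> mons X \<Longrightarrow> m \<in> mons X"
  unfolding mons_iff mdvd_def by (metis le_zero_eq)

lemma mdvdE:
  assumes "mdvd m n" "n \<in> mons X" obtains t where "n = m + t" "t \<in> mons X"
proof
  show "n = m + (n - m)"
    using assms by (intro poly_mapping_eqI) (simp add: lookup_add lookup_minus mdvd_def)
  show "n - m \<in> mons X" using assms by (simp add: mons_iff lookup_minus)
qed

lemma balanced_refl [simp]: "balanced E u u" by (simp add: balanced_def)
lemma balanced_sym: "balanced E u v \<Longrightarrow> balanced E v u" by (simp add: balanced_def)
lemma balanced_trans: "balanced E u v \<Longrightarrow> balanced E v w \<Longrightarrow> balanced E u w" by (simp add: balanced_def)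
lemma balanced_add_iff [simp]: "balanced E (u + t) (v + t) \<longleftrightarrow> balanced E u v"
  by (simp add: balanced_def lookup_add sum.distrib)

lemma poly_mapping_sum_single: "p = (\<Sum>t\<in>Poly_Mapping.keys p. Poly_Mapping.single t (Poly_Mapping.lookup p t))"
proof (rule poly_mapping_eqI)
  fix k
  have "(\<Sum>t\<in>Poly_Mapping.keys p. Poly_Mapping.lookup (Poly_Mapping.single t (Poly_Mapping.lookup p t)) k) = (\<Sum>t\<in>Poly_Mapping.keys p. if t = k then Poly_Mapping.lookup p t else 0)"
    by (intro sum.cong) (auto simp: lookup_single when_def)
  then show "Poly_Mapping.lookup p k = Poly_Mapping.lookup (\<Sum>t\<in>Poly_Mapping.keys p. Poly_Mapping.single t (Poly_Mapping.lookup p t)) k"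
    by (simp add: lookup_sum sum.delta in_keys_iff)
qed

text \<open>For a class \<open>S\<close> of monomials closed under \<open>balanced\<close>, this vanishes on the toric ideal. Hence
  every monomial of a polynomial of the ideal shares its fiber with another one.\<close>

definition class_sum :: "'a set \<Rightarrow> ('a \<Rightarrow>\<^sub>0 'k::comm_monoid_add) \<Rightarrow> 'k" where
  "class_sum S p = (\<Sum>m\<in>Poly_Mapping.keys p \<inter> S. Poly_Mapping.lookup p m)"

lemma class_sum_superset:
  assumes "finite A" "Poly_Mapping.keys p \<subseteq> A" shows "class_sum S p = (\<Sum>m\<in>A \<inter> S. Poly_Mapping.lookup p m)"
  unfolding class_sum_def using assms
  by (intro sum.mono_neutral_left) (auto simp: in_keys_iff)

lemma class_sum_0 [simp]: "class_sum S 0 = 0" by (simp add: class_sum_def)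

lemma class_sum_add: "class_sum S (p + q) = class_sum S p + class_sum S q"
proof -
  let ?A = "Poly_Mapping.keys p \<union> Poly_Mapping.keys q"
  have "class_sum S (p + q) = (\<Sum>m\<in>?A \<inter> S. Poly_Mapping.lookup (p + q) m)"
    using keys_add[of p q] by (intro class_sum_superset) auto
  also have "\<dots> = class_sum S p + class_sum S q"
    using class_sum_superset[of ?A p S] class_sum_superset[of ?A q S]
    by (simp add: lookup_add sum.distrib)
  finally show ?thesis .
qed

lemma class_sum_sum: "class_sum S (\<Sum>i\<in>I. g i) = (\<Sum>i\<in>I. class_sum S (g i))"
  by (induction I rule: infinite_finite_induct) (auto simp: class_sum_add)

lemma class_sum_single: "class_sum S (Poly_Mapping.single m a) = (if m \<in> S then a else 0)"
  by (auto simp: class_sum_def)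

text \<open>Each monomial of \<open>c\<close> contributes its coefficient and the negative of it, at
  two monomials that are both in \<open>S\<close> or both outside.\<close>

lemma class_sum_binom_mult:
  fixes c :: "('x \<Rightarrow>\<^sub>0 nat) \<Rightarrow>\<^sub>0 'k::comm_ring_1"
  assumes "\<And>t. t + u \<in> S \<longleftrightarrow> t + v \<in> S" shows "class_sum S (c * binom u v) = 0"
proof -
  have "c * binom u v = (\<Sum>t\<in>Poly_Mapping.keys c. Poly_Mapping.single t (Poly_Mapping.lookup c t)) * binom u v"
    using poly_mapping_sum_single[of c] by simp
  also have "\<dots> = (\<Sum>t\<in>Poly_Mapping.keys c. Poly_Mapping.single (t + u) (Poly_Mapping.lookup c t) + Poly_Mapping.single (t + v) (- Poly_Mapping.lookup c t))"
    unfolding sum_distrib_right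
    by (intro sum.cong refl) (simp add: binom_def monom_def right_diff_distrib mult_single single_uminus)
  finally show ?thesis by (auto simp: class_sum_sum class_sum_add class_sum_single assms intro: sum.neutral)
qed

lemma toric_ideal_class_sum:
  assumes "p \<in> toric_ideal E" shows "class_sum {m. balanced E m0 m} p = 0"
proof -
  obtain F c where F: "finite F" "p = (\<Sum>s\<in>F. c s * s)"
     "F \<subseteq> {binom u v | u v. u \<in> mons E \<and> v \<in> mons E \<and> balanced E u v}"
    using assms unfolding toric_ideal_def ideal_gen_def by blast
  have "class_sum {m. balanced E m0 m} (c s * s) = 0" if sF: "s \<in> F" for s
  proof -
    obtain u v where s: "s = binom u v" "balanced E u v" using F(3) sF by blast
    have "balanced E (t + u) (t + v)" for t
      using s(2) balanced_add_iff[of E u t v] by (simp add: add.commute)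
    then have "t + u \<in> {m. balanced E m0 m} \<longleftrightarrow> t + v \<in> {m. balanced E m0 m}" for t
      using balanced_trans[of E m0] balanced_sym by blast
    then show ?thesis unfolding s(1) by (rule class_sum_binom_mult)
  qed
  then show ?thesis by (simp add: F(2) class_sum_sum)
qed

lemma toric_ideal_polys:
  assumes "p \<in> toric_ideal E" shows "Poly_Mapping.keys p \<subseteq> mons E"
proof
  obtain F c where F: "finite F" "p = (\<Sum>s\<in>F. c s * s)" "\<forall>s\<in>F. c s \<in> polys E"
     "F \<subseteq> {binom u v | u v. u \<in> mons E \<and> v \<in> mons E \<and> balanced E u v}"
    using assms unfolding toric_ideal_def ideal_gen_def by blast
  fix m assume "m \<in> Poly_Mapping.keys p"
  then obtain s where s: "s \<in> F" "m \<in> Poly_Mapping.keys (c s * s)"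
    unfolding F(2) by (auto simp: in_keys_iff lookup_sum dest: sum.not_neutral_contains_not_neutral)
  obtain u v where uv: "s = binom u v" "u \<in> mons E" "v \<in> mons E" using s(1) F(4) by blast
  have "Poly_Mapping.keys s \<subseteq> {u, v}" unfolding uv(1) binom_def monom_def
    by (auto simp: in_keys_iff lookup_minus lookup_single when_def split: if_splits)
  then show "m \<in> mons E" using s keys_mult[of "c s" s] uv F(3) by (fastforce simp: polys_def)
qed

lemma binom_in_toric_ideal:
  fixes u v :: "'v set \<Rightarrow>\<^sub>0 nat"
  assumes "u \<in> mons E" "v \<in> mons E" "balanced E u v"
  shows "(binom u v :: ('v set \<Rightarrow>\<^sub>0 nat) \<Rightarrow>\<^sub>0 'k::comm_ring_1) \<in> toric_ideal E"
  unfolding toric_ideal_def ideal_gen_def using assms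
  by (intro CollectI exI[of _ "{binom u v}"] exI[of _ "\<lambda>_. 1"]) (auto simp: polys_def)

lemma keys_binom:
  "u \<noteq> v \<Longrightarrow> Poly_Mapping.keys (binom u v :: ('x \<Rightarrow>\<^sub>0 nat) \<Rightarrow>\<^sub>0 'k::comm_ring_1) = {u, v}"
  by (auto simp: in_keys_iff binom_def monom_def lookup_minus lookup_single when_def split: if_splits)

lemma uminus_binom: "- binom u v = binom v u" by (simp add: binom_def)

section \<open>Term orders and leading monomials\<close>

locale term_ordered =
  fixes X :: "'x set" and ord :: "('x \<Rightarrow>\<^sub>0 nat) \<Rightarrow> ('x \<Rightarrow>\<^sub>0 nat) \<Rightarrow> bool"
  assumes term_order: "term_order X ord"
begin

lemma ord_refl: "m \<in> mons X \<Longrightarrow> ord m m"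
  and ord_antisym: "m \<in> mons X \<Longrightarrow> n \<in> mons X \<Longrightarrow> ord m n \<Longrightarrow> ord n m \<Longrightarrow> m = n"
  and ord_trans: "l \<in> mons X \<Longrightarrow> m \<in> mons X \<Longrightarrow> n \<in> mons X \<Longrightarrow> ord l m \<Longrightarrow> ord m n \<Longrightarrow> ord l n"
  and ord_total: "m \<in> mons X \<Longrightarrow> n \<in> mons X \<Longrightarrow> ord m n \<or> ord n m"
  and ord_0: "m \<in> mons X \<Longrightarrow> ord 0 m"
  and ord_add: "m \<in> mons X \<Longrightarrow> n \<in> mons X \<Longrightarrow> l \<in> mons X \<Longrightarrow> ord m n \<Longrightarrow> ord (m + l) (n + l)"
  and ord_wf: "wf {(m, n). m \<in> mons X \<and> n \<in> mons X \<and> ord m n \<and> m \<noteq> n}"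
  using term_order unfolding term_order_def by blast+

lemma ord_min_exists:
  assumes "m \<in> Q" "Q \<subseteq> mons X" obtains z where "z \<in> Q" "\<And>y. y \<in> Q \<Longrightarrow> ord z y"
proof -
  obtain z where z: "z \<in> Q" "\<And>y. (y, z) \<in> {(m, n). m \<in> mons X \<and> n \<in> mons X \<and> ord m n \<and> m \<noteq> n} \<Longrightarrow> y \<notin> Q"
    using wfE_min[OF ord_wf assms(1)] by blast
  have "ord z y" if "y \<in> Q" for y
    using z(1) z(2)[of y] that assms(2) ord_total[of z y] ord_refl[of z] by (cases "y = z") auto
  then show ?thesis using that z(1) by blast
qed

lemma mdvd_ord: assumes "mdvd m n" "n \<in> mons X" shows "ord m n"
proof -
  obtain t where "n = m + t" "t \<in> mons X" using mdvdE[OF assms] .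
  then show ?thesis using ord_add[of 0 t m] ord_0 mdvd_mons[OF assms] by (simp add: add.commute)
qed

lemma finite_has_max:
  assumes "finite K" "K \<noteq> {}" "K \<subseteq> mons X" shows "\<exists>m\<in>K. \<forall>n\<in>K. ord n m"
  using assms
proof (induction K rule: finite_ne_induct)
  case (singleton x)
  then show ?case using ord_refl by auto
next
  case (insert x K)
  then obtain m where m: "m \<in> K" "\<forall>n\<in>K. ord n m" by auto
  show ?case
  proof (cases "ord x m")
    case True
    then show ?thesis using m by auto
  next
    case False
    then have "ord m x" using ord_total m insert by blast
    then have "\<forall>n\<in>K. ord n x" using m insert.prems ord_trans[of _ m x] by blast
    then show ?thesis using ord_refl insert.prems by auto
  qed
qed

lemma lm_eqI:
  assumes "m \<in> Poly_Mapping.keys p" "Poly_Mapping.keys p \<subseteq> mons X" "\<And>n. n \<in> Poly_Mapping.keys p \<Longrightarrow> ord n m" shows "lm ord p = m"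
  unfolding lm_def using assms ord_antisym by (intro the_equality) blast+

lemma lm_in_keys:
  assumes "p \<noteq> 0" "Poly_Mapping.keys p \<subseteq> mons X" shows "lm ord p \<in> Poly_Mapping.keys p" "n \<in> Poly_Mapping.keys p \<Longrightarrow> ord n (lm ord p)"
proof -
  obtain m where "m \<in> Poly_Mapping.keys p" "\<forall>n\<in>Poly_Mapping.keys p. ord n m"
    using finite_has_max[of "Poly_Mapping.keys p"] assms by auto
  then show "lm ord p \<in> Poly_Mapping.keys p" "n \<in> Poly_Mapping.keys p \<Longrightarrow> ord n (lm ord p)"
    using lm_eqI[of m p] assms(2) by auto
qed

lemma lm_binom:
  assumes "u \<in> mons X" "v \<in> mons X" "u \<noteq> v" "ord v u"
  shows "lm ord (binom u v :: ('x \<Rightarrow>\<^sub>0 nat) \<Rightarrow>\<^sub>0 'k::comm_ring_1) = u"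
  using assms keys_binom[OF assms(3), where ?'k = 'k] ord_refl by (intro lm_eqI) auto

end

text \<open>Dickson's lemma. From an infinite antichain take an injective sequence and pass to
  subsequences, one variable at a time, until all exponents are nondecreasing; then one member
  divides another.\<close>

lemma dickson:
  fixes S :: "('x \<Rightarrow>\<^sub>0 nat) set"
  assumes fin: "finite X" and S: "S \<subseteq> mons X" "\<And>m n. m \<in> S \<Longrightarrow> n \<in> S \<Longrightarrow> mdvd m n \<Longrightarrow> m = n"
  shows "finite S"
proof (rule ccontr)
  assume "infinite S"
  then obtain s :: "nat \<Rightarrow> _" where s: "inj s" "range s \<subseteq> S"
    using infinite_countable_subset by blast
  \<comment> \<open>A nonincreasing sequence of naturals is constant from the point where it attains
    its minimum, so its tail is also nondecreasing.\<close>
  have nat_mono: "\<exists>r::nat \<Rightarrow> nat. strict_mono r \<and> mono (\<lambda>i. a (r i))" for a :: "nat \<Rightarrow> nat"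
  proof -
    obtain r :: "nat \<Rightarrow> nat" where r: "strict_mono r" "monoseq (\<lambda>i. a (r i))" using seq_monosub by blast
    show ?thesis
    proof (cases "\<forall>i j. i \<le> j \<longrightarrow> a (r i) \<le> a (r j)")
      case True
      then have "mono (\<lambda>i. a (r i))" by (auto intro: monoI)
      with r(1) show ?thesis by (intro exI[of _ r] conjI)
    next
      case False
      then have dec: "a (r j) \<le> a (r i)" if "i \<le> j" for i j using r(2) that unfolding monoseq_def by blast
      obtain N where N: "\<And>j. a (r N) \<le> a (r j)"
        using ex_has_least_nat[of "\<lambda>_. True" 0 "\<lambda>j. a (r j)"] by blast
      then have "a (r (i + N)) = a (r N)" for i using dec[of N "i + N"] by (simp add: order_antisym)
      moreover have "strict_mono (\<lambda>i. r (i + N))" using r(1) by (simp add: strict_mono_def)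
      ultimately show ?thesis by (intro exI[of _ "\<lambda>i. r (i + N)"]) (simp add: mono_def)
    qed
  qed
  have "\<exists>r::nat \<Rightarrow> nat. strict_mono r \<and> (\<forall>x\<in>X. mono (\<lambda>i. Poly_Mapping.lookup (s (r i)) x))"
    using fin
  proof (induction X)
    case empty
    show ?case using strict_mono_id by auto
  next
    case (insert x X)
    then obtain r :: "nat \<Rightarrow> nat" where r: "strict_mono r" "\<forall>x\<in>X. mono (\<lambda>i. Poly_Mapping.lookup (s (r i)) x)" by blast
    obtain r' :: "nat \<Rightarrow> nat" where r': "strict_mono r'" "mono (\<lambda>i. Poly_Mapping.lookup (s (r (r' i))) x)"
      using nat_mono[of "\<lambda>i. Poly_Mapping.lookup (s (r i)) x"] by blast
    have "strict_mono (\<lambda>i. r (r' i))" using r(1) r'(1) by (simp add: strict_mono_def)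
    moreover have "mono (\<lambda>i. Poly_Mapping.lookup (s (r (r' i))) y)" if "y \<in> X" for y
      using r(2) that strict_mono_mono[OF r'(1)] by (simp add: mono_def)
    ultimately show ?case using r'(2) by (intro exI[of _ "\<lambda>i. r (r' i)"]) auto
  qed
  then obtain r :: "nat \<Rightarrow> nat" where r: "strict_mono r" "\<forall>x\<in>X. mono (\<lambda>i. Poly_Mapping.lookup (s (r i)) x)" by blast
  have in_S: "s k \<in> S" "s k \<in> mons X" for k using s S by auto
  have "mdvd (s (r 0)) (s (r 1))"
    unfolding mdvd_def
  proof
    fix x show "Poly_Mapping.lookup (s (r 0)) x \<le> Poly_Mapping.lookup (s (r 1)) x"
      using r(2) in_S(2) by (cases "x \<in> X") (auto simp: mono_def mons_iff)
  qed
  then have "r 0 = r 1" using S(2) in_S s(1) by (meson injD)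
  then show False using r(1) by (metis strict_mono_eq zero_neq_one)
qed

section \<open>Standard monomials and the reduced Groebner basis\<close>

locale toric_order = term_ordered E ord for E :: "'v set set" and ord +
  assumes finite_E: "finite E"
begin

text \<open>The standard monomials, those outside the initial ideal, are described directly as the
  least members of their fibers. The minimal nonstandard ones then generate the initial
  ideal.\<close>

definition standard :: "('v set \<Rightarrow>\<^sub>0 nat) \<Rightarrow> bool" where
  "standard m \<longleftrightarrow> m \<in> mons E \<and> (\<forall>n\<in>mons E. balanced E m n \<longrightarrow> ord m n)"

definition min_nonstandard :: "('v set \<Rightarrow>\<^sub>0 nat) \<Rightarrow> bool" where
  "min_nonstandard m \<longleftrightarrow> m \<in> mons E \<and> \<not> standard m \<and> (\<forall>n. mdvd n m \<and> n \<noteq> m \<longrightarrow> standard n)"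

lemma standard_exists: assumes "m \<in> mons E" shows "\<exists>n. standard n \<and> balanced E m n"
proof -
  obtain z where z: "z \<in> {n\<in>mons E. balanced E m n}" "\<And>y. y \<in> {n\<in>mons E. balanced E m n} \<Longrightarrow> ord z y"
    using ord_min_exists[of m "{n\<in>mons E. balanced E m n}"] assms by auto
  have "standard z" unfolding standard_def using z balanced_trans by blast
  then show ?thesis using z by blast
qed

definition nf :: "('v set \<Rightarrow>\<^sub>0 nat) \<Rightarrow> ('v set \<Rightarrow>\<^sub>0 nat)" where
  "nf m = (SOME n. standard n \<and> balanced E m n)"

lemma nf: "m \<in> mons E \<Longrightarrow> standard (nf m)" "m \<in> mons E \<Longrightarrow> balanced E m (nf m)"
  unfolding nf_def using someI_ex[OF standard_exists] by blast+

lemma standard_mons: "standard m \<Longrightarrow> m \<in> mons E" by (simp add: standard_def)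

lemma standard_unique: "standard m \<Longrightarrow> standard n \<Longrightarrow> balanced E m n \<Longrightarrow> m = n"
  using ord_antisym balanced_sym unfolding standard_def by blast

text \<open>A smaller member of the fiber of \<open>m\<close>, multiplied by the cofactor of
  \<open>m\<close> in \<open>n\<close>, would be a smaller member of the fiber of
  \<open>n\<close>.\<close>

lemma standard_mdvd: assumes "standard n" "mdvd m n" shows "standard m"
proof -
  have n: "n \<in> mons E" using assms standard_mons by blast
  obtain t where t: "n = m + t" "t \<in> mons E" using mdvdE[OF assms(2) n] .
  have m: "m \<in> mons E" using mdvd_mons assms n by blast
  have "ord m l" if l: "l \<in> mons E" "balanced E m l" for l
  proof (rule ccontr)
    assume "\<not> ord m l"
    then have "ord l m" using ord_total l m by blast
    then have 1: "ord (l + t) n" using ord_add l m t by simp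
    have "ord n (l + t)" using assms(1) l t unfolding standard_def by simp
    moreover have "l + t \<in> mons E" using l t(2) by simp
    ultimately have "l + t = n" using 1 ord_antisym n by blast
    then show False using \<open>\<not> ord m l\<close> t ord_refl m by simp
  qed
  then show ?thesis using m by (simp add: standard_def)
qed

text \<open>Divisors are smaller in a term order, so the least nonstandard divisor of
  \<open>m\<close> has only standard proper divisors.\<close>

lemma min_nonstandard_below:
  assumes "m \<in> mons E" "\<not> standard m" shows "\<exists>n. min_nonstandard n \<and> mdvd n m"
proof -
  let ?Q = "{n\<in>mons E. mdvd n m \<and> \<not> standard n}"
  obtain z where z: "z \<in> ?Q" "\<And>y. y \<in> ?Q \<Longrightarrow> ord z y"
    using ord_min_exists[of m ?Q] assms by auto
  have "standard n" if n: "mdvd n z" "n \<noteq> z" for n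
  proof (rule ccontr)
    assume "\<not> standard n"
    moreover have "n \<in> mons E" using n z mdvd_mons by blast
    ultimately have "ord z n" using z n mdvd_trans by blast
    then show False using mdvd_ord[of n z] ord_antisym[of n z] n z \<open>n \<in> mons E\<close> by blast
  qed
  then show ?thesis using z by (auto simp: min_nonstandard_def)
qed

lemma nf_neq: "m \<in> mons E \<Longrightarrow> \<not> standard m \<Longrightarrow> m \<noteq> nf m" using nf by metis

lemma ord_nf: "m \<in> mons E \<Longrightarrow> ord (nf m) m"
  using nf[of m] balanced_sym unfolding standard_def by blast

text \<open>Leading monomials of the ideal are nonstandard, hence divisible by a minimal nonstandard
  one. The basis is reduced because normal forms and proper divisors of minimal nonstandard
  monomials have only standard divisors.\<close>

lemma reduced_groebner_basis:
  "is_reduced_groebner_basis ord (toric_ideal E)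
     ((\<lambda>m. binom m (nf m) :: ('v set \<Rightarrow>\<^sub>0 nat) \<Rightarrow>\<^sub>0 'k::field) ` {m. min_nonstandard m})"
proof -
  let ?M = "{m. min_nonstandard m}" and ?g = "\<lambda>m. binom m (nf m) :: ('v set \<Rightarrow>\<^sub>0 nat) \<Rightarrow>\<^sub>0 'k"
  have M: "m \<in> mons E" "\<not> standard m" if "m \<in> ?M" for m using that by (auto simp: min_nonstandard_def)
  have keys: "Poly_Mapping.keys (?g m) = {m, nf m}" if "m \<in> ?M" for m
    using keys_binom[OF nf_neq[OF M[OF that]]] .
  have lmg: "lm ord (?g m) = m" if "m \<in> ?M" for m
    using M[OF that] nf[of m] standard_mons nf_neq ord_nf by (intro lm_binom) auto
  have "finite ?M"
    using finite_E by (rule dickson) (auto simp: min_nonstandard_def)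
  moreover have "?g ` ?M \<subseteq> toric_ideal E"
    using M nf standard_mons by (auto intro!: binom_in_toric_ideal)
  moreover have "0 \<notin> ?g ` ?M" using keys by (force dest: arg_cong[of _ _ Poly_Mapping.keys])
  moreover have "\<exists>g\<in>?g ` ?M. mdvd (lm ord g) (lm ord p)" if p: "p \<in> toric_ideal E" "p \<noteq> 0" for p :: "('v set \<Rightarrow>\<^sub>0 nat) \<Rightarrow>\<^sub>0 'k"
  proof -
    let ?m = "lm ord p" and ?S = "{n. balanced E (lm ord p) n}"
    have kp: "Poly_Mapping.keys p \<subseteq> mons E" using toric_ideal_polys p by blast
    note lmp = lm_in_keys[OF p(2) kp]
    \<comment> \<open>If the leading monomial were alone in its fiber, the class sum would be its
      nonzero coefficient.\<close>
    have "\<exists>n\<in>Poly_Mapping.keys p \<inter> ?S. n \<noteq> ?m"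
    proof (rule ccontr)
      assume "\<not> ?thesis"
      then have "Poly_Mapping.keys p \<inter> ?S = {?m}" using lmp(1) by auto
      then have "class_sum ?S p = Poly_Mapping.lookup p ?m" by (simp add: class_sum_def)
      then show False using toric_ideal_class_sum[OF p(1), of ?m] lmp(1) by (simp add: in_keys_iff)
    qed
    then obtain n where n: "n \<in> Poly_Mapping.keys p" "balanced E ?m n" "n \<noteq> ?m" by blast
    have "\<not> standard ?m"
      using n lmp kp ord_antisym[of n ?m] unfolding standard_def by blast
    then obtain m where "min_nonstandard m" "mdvd m ?m" using min_nonstandard_below lmp(1) kp by blast
    then show ?thesis using lmg by (intro bexI[of _ "?g m"]) auto
  qed
  ultimately have "is_groebner_basis ord (toric_ideal E) (?g ` ?M)"
    unfolding is_groebner_basis_def by blast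
  moreover have "lc ord (?g m) = 1" if "m \<in> ?M" for m
    using lmg[OF that] nf_neq[OF M[OF that]]
    by (simp add: lc_def binom_def monom_def lookup_minus lookup_single when_def)
  moreover have "\<not> mdvd (lm ord (?g m)) k" if "m \<in> ?M" "m' \<in> ?M" "?g m \<noteq> ?g m'" "k \<in> Poly_Mapping.keys (?g m')" for m m' k
  proof
    assume *: "mdvd (lm ord (?g m)) k"
    have "m \<noteq> m'" using that by auto
    have "standard m"
    proof (cases "k = m'")
      case True
      then show ?thesis using * that \<open>m \<noteq> m'\<close> lmg by (auto simp: min_nonstandard_def)
    next
      case False
      then have "k = nf m'" using keys that by auto
      then show ?thesis using * lmg[OF that(1)] nf(1)[OF M(1)[OF that(2)]] standard_mdvd by simp
    qed
    then show False using M that by blast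
  qed
  ultimately show ?thesis unfolding is_reduced_groebner_basis_def by blast
qed

text \<open>If \<open>u\<close> were the leading monomial of \<open>binom u v\<close>, some basis
  element would have a leading monomial dividing \<open>u\<close> and hence \<open>m\<close>.
  Reducedness makes this element \<open>g\<close>, so that \<open>m\<close> divides its proper
  divisor \<open>u\<close>.\<close>

lemma reduced_basis_lm:
  fixes u v :: "'v set \<Rightarrow>\<^sub>0 nat" and G :: "(('v set \<Rightarrow>\<^sub>0 nat) \<Rightarrow>\<^sub>0 'k::field) set"
  assumes G: "is_reduced_groebner_basis ord (toric_ideal E) G"
    and g: "g \<in> G" "m \<in> Poly_Mapping.keys g" 
    and uv: "u \<in> mons E" "v \<in> mons E" "balanced E u v" "mdvd u m" "m = lm ord g" "u \<noteq> m"
  shows "ord u v"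
proof (cases "u = v")
  case True
  then show ?thesis using ord_refl uv by simp
next
  case False
  let ?p = "binom u v :: ('v set \<Rightarrow>\<^sub>0 nat) \<Rightarrow>\<^sub>0 'k"
  have keys: "Poly_Mapping.keys ?p = {u, v}" using keys_binom[OF False] .
  then have p: "?p \<noteq> 0" "Poly_Mapping.keys ?p \<subseteq> mons E" using uv by auto
  have "lm ord ?p \<noteq> u"
  proof
    assume lmp: "lm ord ?p = u"
    obtain g' where g': "g' \<in> G" "mdvd (lm ord g') u"
      using G binom_in_toric_ideal[OF uv(1-3)] p(1) lmp
      unfolding is_reduced_groebner_basis_def is_groebner_basis_def by metis
    then have "mdvd (lm ord g') m" using uv mdvd_trans by blast
    then have "g' = g" using G g g' unfolding is_reduced_groebner_basis_def by blast
    then show False using g' uv mdvd_antisym by blast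
  qed
  then have "lm ord ?p = v" using lm_in_keys(1)[OF p] keys by auto
  then show ?thesis using lm_in_keys(2)[OF p, of u] keys by simp
qed

end

section \<open>Weight orders with lexicographic tie-breaking\<close>

fun lexle :: "'x list \<Rightarrow> ('x \<Rightarrow>\<^sub>0 nat) \<Rightarrow> ('x \<Rightarrow>\<^sub>0 nat) \<Rightarrow> bool" where
  "lexle [] m n = True"
| "lexle (x # xs) m n = (Poly_Mapping.lookup m x < Poly_Mapping.lookup n x \<or> Poly_Mapping.lookup m x = Poly_Mapping.lookup n x \<and> lexle xs m n)"

lemma lexle_refl: "lexle xs m m" by (induction xs) auto
lemma lexle_total: "lexle xs m n \<or> lexle xs n m" by (induction xs) auto
lemma lexle_trans: "lexle xs l m \<Longrightarrow> lexle xs m n \<Longrightarrow> lexle xs l n" by (induction xs) auto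
lemma lexle_add: "lexle xs m n \<Longrightarrow> lexle xs (m + l) (n + l)" by (induction xs) (auto simp: lookup_add)
lemma lexle_0: "lexle xs 0 m" by (induction xs) auto
lemma lexle_antisym: "lexle xs m n \<Longrightarrow> lexle xs n m \<Longrightarrow> x \<in> set xs \<Longrightarrow> Poly_Mapping.lookup m x = Poly_Mapping.lookup n x"
  by (induction xs) auto

definition weight :: "'x set \<Rightarrow> ('x \<Rightarrow> nat) \<Rightarrow> ('x \<Rightarrow>\<^sub>0 nat) \<Rightarrow> nat" where
  "weight X wt m = (\<Sum>x\<in>X. wt x * Poly_Mapping.lookup m x)"

lemma weight_0 [simp]: "weight X wt 0 = 0" by (simp add: weight_def)

lemma weight_add: "weight X wt (m + n) = weight X wt m + weight X wt n"
  by (simp add: weight_def lookup_add sum.distrib algebra_simps)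

lemma finite_weight_le:
  assumes "finite X" "\<And>x. x \<in> X \<Longrightarrow> wt x > 0" shows "finite {m\<in>mons X. weight X wt m \<le> k}"
proof -
  let ?F = "{f. \<forall>x. (x \<in> X \<longrightarrow> f x \<in> {..k}) \<and> (x \<notin> X \<longrightarrow> f x = 0)}"
  have "Poly_Mapping.lookup m x \<le> weight X wt m" if "x \<in> X" for m x
  proof -
    have "Poly_Mapping.lookup m x \<le> wt x * Poly_Mapping.lookup m x" using assms(2)[OF that] by simp
    also have "\<dots> \<le> weight X wt m" unfolding weight_def using that assms(1) by (intro member_le_sum) auto
    finally show ?thesis .
  qed
  then have bounded: "Poly_Mapping.lookup m \<in> ?F" if "m \<in> mons X" "weight X wt m \<le> k" for m
    using that order_trans[OF \<open>\<And>x m. x \<in> X \<Longrightarrow> Poly_Mapping.lookup m x \<le> weight X wt m\<close>]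
    by (auto simp: mons_iff)
  have "Poly_Mapping.lookup ` {m\<in>mons X. weight X wt m \<le> k} \<subseteq> ?F"
    by (rule image_subsetI, elim CollectE conjE, rule bounded)
  moreover have "finite ?F" using assms(1) by (intro finite_set_of_finite_funs) auto
  ultimately have "finite (Poly_Mapping.lookup ` {m\<in>mons X. weight X wt m \<le> k})" by (rule finite_subset)
  then show ?thesis by (rule finite_imageD) (rule inj_onI, simp only: poly_mapping_eq_iff)
qed

definition weight_lex :: "'x set \<Rightarrow> ('x \<Rightarrow> nat) \<Rightarrow> 'x list \<Rightarrow> ('x \<Rightarrow>\<^sub>0 nat) \<Rightarrow> ('x \<Rightarrow>\<^sub>0 nat) \<Rightarrow> bool" where
  "weight_lex X wt xs m n \<longleftrightarrow> weight X wt m < weight X wt n \<or> weight X wt m = weight X wt n \<and> lexle xs m n"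

lemma term_order_weight_lex:
  assumes fin: "finite X" and pos: "\<And>x. x \<in> X \<Longrightarrow> wt x > 0" and xs: "set xs = X"
  shows "term_order X (weight_lex X wt xs)"
proof -
  let ?le = "weight_lex X wt xs"
  have antisym: "m = n" if "m \<in> mons X" "n \<in> mons X" "?le m n" "?le n m" for m n
  proof (rule poly_mapping_eqI)
    fix x show "Poly_Mapping.lookup m x = Poly_Mapping.lookup n x"
      using that lexle_antisym[of xs m n x] xs by (cases "x \<in> X") (auto simp: weight_lex_def mons_iff)
  qed
  have trans: "?le l n" if "?le l m" "?le m n" for l m n
    using that lexle_trans[of xs l m n] by (auto simp: weight_lex_def)
  let ?R = "{(m, n). m \<in> mons X \<and> n \<in> mons X \<and> ?le m n \<and> m \<noteq> n}"
  let ?below = "\<lambda>n. {m\<in>mons X. ?le m n \<and> m \<noteq> n}"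
  have fin_below: "finite (?below n)" for n
    by (rule finite_subset[OF _ finite_weight_le[OF fin pos, where k = "weight X wt n"]])
      (auto simp: weight_lex_def)
  \<comment> \<open>Positive weights leave only finitely many monomials below a given one, so their
    number is a rank for well-foundedness.\<close>
  have "?R \<subseteq> measure (\<lambda>n. card (?below n))"
  proof clarify
    fix m n assume mn: "m \<in> mons X" "n \<in> mons X" "?le m n" "m \<noteq> n"
    have "l \<noteq> n" if "l \<in> mons X" "?le l m" "l \<noteq> m" for l using antisym[of m l] that mn by blast
    then have "?below m \<subseteq> ?below n" using trans mn by blast
    moreover have "m \<in> ?below n" "m \<notin> ?below m" using mn by auto
    ultimately have "?below m \<subset> ?below n" by blast
    then show "(m, n) \<in> measure (\<lambda>n. card (?below n))" using psubset_card_mono[OF fin_below] unfolding in_measure by blast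
  qed
  then have "wf ?R" using wf_measure wf_subset by blast
  moreover have "?le m m" "?le m n \<or> ?le n m" "?le 0 m" "?le m n \<Longrightarrow> ?le (m + l) (n + l)" for l m n
    using lexle_refl lexle_total[of xs m n] lexle_0 lexle_add by (auto simp: weight_lex_def weight_add)
  ultimately show ?thesis unfolding term_order_def using antisym trans by blast
qed

text \<open>Here \<open>q\<close> is the normal form of \<open>p\<close>, and \<open>p\<close> turns
  out to be minimal nonstandard, so the binomial occurs in the explicit reduced basis.\<close>

lemma (in toric_order) binom_in_universal:
  assumes pq: "p \<in> mons E" "q \<in> mons E" "balanced E p q" "p \<noteq> q" "ord q p"
    and disj: "\<And>e. Poly_Mapping.lookup p e = 0 \<or> Poly_Mapping.lookup q e = 0"
    and least: "\<And>m. m \<in> mons E \<Longrightarrow> balanced E p m \<Longrightarrow> ord m p \<Longrightarrow> m = p \<or> m = q"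
  shows "(binom p q :: ('v set \<Rightarrow>\<^sub>0 nat) \<Rightarrow>\<^sub>0 'k::field) \<in> universal_groebner_basis E (toric_ideal E)"
proof -
  have "ord q m" if m: "m \<in> mons E" "balanced E q m" for m
  proof (cases "ord m p")
    case True
    then show ?thesis using least[OF m(1)] balanced_trans[OF pq(3) m(2)] ord_refl pq by blast
  next
    case False
    then show ?thesis using ord_total[of m p] ord_trans[of q p m] m pq by blast
  qed
  then have std: "standard q" using pq by (simp add: standard_def)
  have nstd: "\<not> standard p" using standard_unique[OF _ std pq(3)] pq(4) by blast
  have "nf p = q" using standard_unique[OF nf(1)[OF pq(1)] std] nf(2)[OF pq(1)] pq(3) balanced_sym balanced_trans by blast
  have "standard n" if n: "mdvd n p" "n \<noteq> p" for n
  proof (rule ccontr)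
    assume ns: "\<not> standard n"
    obtain t where t: "p = n + t" "t \<in> mons E" using mdvdE[OF n(1) pq(1)] .
    have nm: "n \<in> mons E" using mdvd_mons n pq by blast
    let ?m = "nf n"
    have m: "?m \<in> mons E" "balanced E n ?m" "ord ?m n" "?m \<noteq> n"
      using nf[OF nm] standard_mons ord_nf[OF nm] nf_neq[OF nm ns] by auto
    have "ord (?m + t) p" using ord_add[OF m(1) nm t(2) m(3)] t by simp
    then have "?m + t = p \<or> ?m + t = q" using least[of "?m + t"] m t by simp
    \<comment> \<open>The cofactor \<open>t\<close> now divides both \<open>p\<close> and
      \<open>q\<close>, which have no common variable, so \<open>t = 0\<close>.\<close>
    then have q: "?m + t = q" using m(4) t by auto
    have "Poly_Mapping.lookup t e = 0" for e using disj[of e] arg_cong[OF q, of "\<lambda>m. Poly_Mapping.lookup m e"] t by (auto simp: lookup_add)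
    then have "t = 0" by (intro poly_mapping_eqI) simp
    then show False using t n by simp
  qed
  then have "min_nonstandard p" using nstd pq by (simp add: min_nonstandard_def)
  then have "binom p q \<in> ((\<lambda>m. binom m (nf m) :: ('v set \<Rightarrow>\<^sub>0 nat) \<Rightarrow>\<^sub>0 'k) ` {m. min_nonstandard m})"
    using \<open>nf p = q\<close> by (intro image_eqI[of _ _ p]) auto
  then show ?thesis unfolding universal_groebner_basis_def
    using reduced_groebner_basis term_order by blast
qed

text \<open>The weight is minimal on the fiber exactly at \<open>p\<close> and \<open>q\<close>. The
  lexicographic tie-break decides which of them leads, and this determines the sign.\<close>

lemma edge_in_universal:
  fixes p q :: "'v set \<Rightarrow>\<^sub>0 nat"
  assumes fin: "finite E" and pos: "\<And>e. e \<in> E \<Longrightarrow> wt e > 0"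
    and pq: "p \<in> mons E" "q \<in> mons E" "balanced E p q" "p \<noteq> q" "weight E wt p = weight E wt q"
    and disj: "\<And>e. Poly_Mapping.lookup p e = 0 \<or> Poly_Mapping.lookup q e = 0"
    and least: "\<And>m. m \<in> mons E \<Longrightarrow> balanced E p m \<Longrightarrow> weight E wt m \<le> weight E wt p \<Longrightarrow> m = p \<or> m = q"
  shows "(binom p q :: ('v set \<Rightarrow>\<^sub>0 nat) \<Rightarrow>\<^sub>0 'k::field) \<in> universal_groebner_basis E (toric_ideal E) \<or>
    - (binom p q :: ('v set \<Rightarrow>\<^sub>0 nat) \<Rightarrow>\<^sub>0 'k::field) \<in> universal_groebner_basis E (toric_ideal E)"
proof -
  obtain xs where xs: "set xs = E" using finite_list[OF fin] by blast
  let ?le = "weight_lex E wt xs"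
  interpret toric_order E ?le
    using term_order_weight_lex[OF fin pos xs] fin by unfold_locales
  have le: "weight E wt m \<le> weight E wt n" if "?le m n" for m n using that by (auto simp: weight_lex_def)
  show ?thesis
  proof (cases "?le q p")
    case True
    then show ?thesis using binom_in_universal[OF pq(1-4) True disj] least le by blast
  next
    case False
    then have le': "?le p q" using ord_total pq by blast
    have "binom q p \<in> (universal_groebner_basis E (toric_ideal E) :: (('v set \<Rightarrow>\<^sub>0 nat) \<Rightarrow>\<^sub>0 'k) set)"
    proof (rule binom_in_universal[OF pq(2,1) balanced_sym[OF pq(3)] pq(4)[symmetric] le'])
      show "Poly_Mapping.lookup q e = 0 \<or> Poly_Mapping.lookup p e = 0" for e using disj[of e] by argo
      show "m = q \<or> m = p" if "m \<in> mons E" "balanced E q m" "?le m q" for m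
        using least[OF that(1) balanced_trans[OF pq(3) that(2)]] le[OF that(3)] pq(5) by auto
    qed
    then show ?thesis by (simp add: uminus_binom)
  qed
qed

section \<open>Excluding a monomial as leading term\<close>

lemma (in term_ordered) ord_sum:
  assumes "\<And>t. t \<in> T \<Longrightarrow> u t \<in> mons X" "\<And>t. t \<in> T \<Longrightarrow> v t \<in> mons X" "\<And>t. t \<in> T \<Longrightarrow> ord (u t) (v t)"
  shows "ord (\<Sum>t\<in>T. u t) (\<Sum>t\<in>T. v t)"
  using assms
proof (induction T rule: infinite_finite_induct)
  case (insert x T)
  have mem: "sum u T \<in> mons X" "sum v T \<in> mons X" "u x \<in> mons X" "v x \<in> mons X"
    using insert.prems by (auto intro: mons_sum)
  have "ord (u x + sum u T) (v x + sum u T)" using ord_add mem insert by auto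
  moreover have "ord (v x + sum u T) (v x + sum v T)"
    using ord_add[OF mem(1,2,4)] insert by (simp add: add.commute)
  ultimately show ?case using insert ord_trans[of "u x + sum u T" "v x + sum u T" "v x + sum v T"] mem by auto
qed (auto intro: ord_refl)

text \<open>All binomials \<open>u t - v t\<close> have leading monomial \<open>v t\<close>, which contradicts \<open>Q\<close> being smaller
  than \<open>P\<close> after multiplying everything up.\<close>

lemma no_divisor_family:
  fixes P Q :: "'v set \<Rightarrow>\<^sub>0 nat" and g :: "('v set \<Rightarrow>\<^sub>0 nat) \<Rightarrow>\<^sub>0 'k::field"
    and N :: nat
  assumes fin: "finite E" and ord: "term_order E ord"
    and G: "is_reduced_groebner_basis ord (toric_ideal E) G" "g \<in> G"
    and PQ: "P \<in> mons E" "Q \<in> mons E" "P \<noteq> Q" "Poly_Mapping.keys g = {P, Q}" "lm ord g = P"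
    and uv: "\<And>t. t \<in> T \<Longrightarrow> u t \<in> mons E \<and> v t \<in> mons E \<and> balanced E (u t) (v t) \<and> mdvd (u t) P \<and> u t \<noteq> P"
    and N: "N > 0" and eq: "(\<Sum>t\<in>T. u t) + (\<Sum>i<N. Q) = (\<Sum>t\<in>T. v t) + (\<Sum>i<N. P)"
  shows False
proof -
  interpret toric_order E ord using ord fin by unfold_locales
  have "ord (u t) (v t)" if "t \<in> T" for t
    by (rule reduced_basis_lm[OF G, of P]) (use uv[OF that] PQ(4,5) in simp_all)
  moreover have memT: "u t \<in> mons E" "v t \<in> mons E" if "t \<in> T" for t using uv[OF that] by auto
  ultimately have 1: "ord (\<Sum>t\<in>T. u t) (\<Sum>t\<in>T. v t)" by (intro ord_sum)
  have "ord Q P"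
  proof -
    have "g \<noteq> 0" "Poly_Mapping.keys g \<subseteq> mons E" using PQ by auto
    then show ?thesis using lm_in_keys(2)[of g Q] PQ by auto
  qed
  then have 2: "ord (\<Sum>i<N. Q) (\<Sum>i<N. P)" using PQ by (intro ord_sum) auto
  define a b c d where "a = (\<Sum>t\<in>T. u t)" "b = (\<Sum>t\<in>T. v t)" "c = (\<Sum>i<N. Q)" "d = (\<Sum>i<N. P)"
  have mem: "a \<in> mons E" "b \<in> mons E" "c \<in> mons E" "d \<in> mons E"
    unfolding a_b_c_d_def using memT PQ by (auto intro!: mons_sum)
  \<comment> \<open>The chain from \<open>a + c\<close> over \<open>b + c\<close> to
    \<open>b + d\<close> returns to \<open>a + c\<close>, so equality holds throughout and
    \<open>c = d\<close>; as \<open>N\<close> is positive this contradicts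
    \<open>P \<noteq> Q\<close>.\<close>
  have "ord (a + c) (b + c)" using ord_add[OF mem(1,2,3)] 1 by (simp add: a_b_c_d_def)
  moreover have "ord (c + b) (d + b)" using ord_add[OF mem(3,4,2)] 2 by (simp add: a_b_c_d_def)
  moreover have "a + c = b + d" using eq by (simp add: a_b_c_d_def)
  ultimately have "b + c = b + d" using mem ord_antisym[of "b + c" "b + d"] by (simp add: add.commute)
  then have "c = d" by simp
  obtain e where "Poly_Mapping.lookup P e \<noteq> Poly_Mapping.lookup Q e" using PQ(3) poly_mapping_eqI by metis
  moreover have "Poly_Mapping.lookup c e = N * Poly_Mapping.lookup Q e" "Poly_Mapping.lookup d e = N * Poly_Mapping.lookup P e"
    by (simp_all add: a_b_c_d_def lookup_sum)
  ultimately show False using \<open>c = d\<close> N by simp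
qed

section \<open>The binomial of a primitive walk\<close>

locale graph_walk =
  fixes V :: "'v set" and E :: "'v set set" and ws :: "'v list"
  assumes graph: "simple_graph V E" and walk: "even_closed_walk E ws"
begin

abbreviation "n \<equiv> walk_len ws"
abbreviation "p \<equiv> Eplus ws"
abbreviation "q \<equiv> Eminus ws"
text \<open>The last entry of \<open>ws\<close> repeats the first, so reading the indices modulo
  \<open>n\<close> extends the walk periodically.\<close>

definition f :: "nat \<Rightarrow> 'v" where "f k = ws ! (k mod n)"

lemma n_pos: "n > 0" and n_even: "even n" and length_ws: "length ws = Suc n"
  using walk by (auto simp: even_closed_walk_def walk_len_def)

lemma edge_f: "{f k, f (Suc k)} = walk_edge ws (k mod n)"
proof -
  have "ws ! n = ws ! 0"
    using walk length_ws by (auto simp: even_closed_walk_def last_conv_nth hd_conv_nth simp flip: length_0_conv)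
  then show ?thesis using n_pos by (auto simp: f_def walk_edge_def mod_Suc)
qed

lemma walk_edge_in_E: "j < n \<Longrightarrow> walk_edge ws j \<in> E"
  using walk by (simp add: even_closed_walk_def)

lemma finite_E: "finite E"
  using graph by (auto simp: simple_graph_def intro: finite_subset[of E "Pow V"])

lemma card_E: "e \<in> E \<Longrightarrow> card e = 2"
  using graph by (simp add: simple_graph_def)

sublocale closed_walk f n
proof
  show "n > 0" "even n" by (fact n_pos n_even)+
  show "f (k + n) = f k" for k by (simp add: f_def)
  have "card {f k, f (Suc k)} = 2" for k
    unfolding edge_f using card_E[OF walk_edge_in_E] n_pos by simp
  then show "f k \<noteq> f (Suc k)" for k by (metis card_2_iff' insertI1 insert_absorb2 singletonD)
qed

lemma Ed_eq: "Ed k = walk_edge ws (k mod n)" using edge_f by (simp add: Ed_def)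

lemma W_eq: "W = walk_edges ws" by (auto simp: W_def walk_edges_def Ed_eq)

lemma W_subset_E: "W \<subseteq> E" using walk_edge_in_E by (auto simp: W_def Ed_eq)

lemma range_eq: "range f = walk_vertices ws"
proof
  show "range f \<subseteq> walk_vertices ws" using n_pos length_ws by (auto simp: f_def walk_vertices_def intro!: nth_mem less_SucI)
  have "ws ! i \<in> range f" if "i < Suc n" for i
  proof (cases "i = n")
    case True
    have "ws \<noteq> []" using length_ws by auto
    then have "ws ! n = ws ! 0"
      using walk length_ws by (simp add: even_closed_walk_def last_conv_nth hd_conv_nth)
    then have "ws ! i = f 0" using True by (simp add: f_def)
    then show ?thesis by simp
  next
    case False
    then have "ws ! i = f i" using that by (simp add: f_def)
    then show ?thesis by simp
  qed
  then show "walk_vertices ws \<subseteq> range f" using length_ws by (auto simp: walk_vertices_def in_set_conv_nth)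
qed

lemma lookup_p: "Poly_Mapping.lookup p e = (\<Sum>j | j < n \<and> even j. if Ed j = e then 1 else 0)"
  unfolding Eplus_def lookup_sum by (intro sum.cong) (auto simp: lookup_single when_def Ed_eq)

lemma lookup_q: "Poly_Mapping.lookup q e = (\<Sum>j | j < n \<and> odd j. if Ed j = e then 1 else 0)"
  unfolding Eminus_def lookup_sum by (intro sum.cong) (auto simp: lookup_single when_def Ed_eq)

lemma b_eq: "b e = int (Poly_Mapping.lookup p e) - int (Poly_Mapping.lookup q e)"
proof -
  have split: "{..<n} = {j. j < n \<and> even j} \<union> {j. j < n \<and> odd j}" by auto
  have "b e = (\<Sum>j | j < n \<and> even j. if Ed j = e then (-1) ^ j else 0) +
      (\<Sum>j | j < n \<and> odd j. if Ed j = e then (-1) ^ j else 0)"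
    unfolding b_def vec_def split by (rule sum.union_disjoint) auto
  also have "(\<Sum>j | j < n \<and> even j. if Ed j = e then (-1::int) ^ j else 0) = int (Poly_Mapping.lookup p e)"
    unfolding lookup_p of_nat_sum by (intro sum.cong) auto
  also have "(\<Sum>j | j < n \<and> odd j. if Ed j = e then (-1::int) ^ j else 0) = - int (Poly_Mapping.lookup q e)"
    unfolding lookup_q of_nat_sum sum_negf[symmetric] by (intro sum.cong) auto
  finally show ?thesis by simp
qed

lemma lookup_outside_W: "e \<notin> W \<Longrightarrow> Poly_Mapping.lookup p e = 0" "e \<notin> W \<Longrightarrow> Poly_Mapping.lookup q e = 0"
  using Ed_in_W unfolding lookup_p lookup_q by (auto intro!: sum.neutral)

lemma pq_mons: "p \<in> mons E" "q \<in> mons E"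
  using lookup_outside_W W_subset_E by (auto simp: mons_iff)

text \<open>Edges outside the walk cancel in the difference, so the sum over \<open>E\<close>
  reduces to the sum over \<open>W\<close> in \<open>bal\<close>.\<close>

lemma balanced_iff_bal:
  assumes "\<And>e. e \<notin> W \<Longrightarrow> Poly_Mapping.lookup u e = Poly_Mapping.lookup v e"
  shows "balanced E u v \<longleftrightarrow> (\<forall>x. bal (\<lambda>e. int (Poly_Mapping.lookup u e) - int (Poly_Mapping.lookup v e)) x = 0)"
proof -
  have "bal (\<lambda>e. int (Poly_Mapping.lookup u e) - int (Poly_Mapping.lookup v e)) x =
      int (\<Sum>e | e \<in> E \<and> x \<in> e. Poly_Mapping.lookup u e) - int (\<Sum>e | e \<in> E \<and> x \<in> e. Poly_Mapping.lookup v e)" for x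
  proof -
    have "bal (\<lambda>e. int (Poly_Mapping.lookup u e) - int (Poly_Mapping.lookup v e)) x =
       (\<Sum>e | e \<in> E \<and> x \<in> e. int (Poly_Mapping.lookup u e) - int (Poly_Mapping.lookup v e))"
      unfolding bal_def using W_subset_E finite_E assms by (intro sum.mono_neutral_left) auto
    then show ?thesis by (simp add: sum_subtractf)
  qed
  then show ?thesis by (simp add: balanced_def flip: of_nat_sum)
qed

lemma balanced_pq: "balanced E p q"
  using bal_b lookup_outside_W by (subst balanced_iff_bal) (auto simp flip: b_eq)

text \<open>The positive part of \<open>h\<close>, since \<open>nat\<close> sends negative values to
  \<open>0\<close>. Thus \<open>mon h\<close> and the \<open>mon\<close> of the negated vector are
  the two coprime terms of the binomial with exponent vector \<open>h\<close> on
  \<open>W\<close>.\<close>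

definition mon :: "('v set \<Rightarrow> int) \<Rightarrow> 'v set \<Rightarrow>\<^sub>0 nat" where
  "mon h = (\<Sum>e\<in>W. Poly_Mapping.single e (nat (h e)))"

lemma lookup_mon: "Poly_Mapping.lookup (mon h) e = (if e \<in> W then nat (h e) else 0)"
proof -
  have "Poly_Mapping.lookup (mon h) e = (\<Sum>d\<in>W. if d = e then nat (h d) else 0)"
    unfolding mon_def lookup_sum by (intro sum.cong) (auto simp: lookup_single when_def)
  then show ?thesis by (simp add: sum.delta)
qed

lemma mon_mons: "mon h \<in> mons E" using W_subset_E by (auto simp: mons_iff lookup_mon)

lemma balanced_mon:
  assumes "\<And>x. bal h x = 0" shows "balanced E (mon h) (mon (\<lambda>e. - h e))"
proof -
  have "bal (\<lambda>e. int (Poly_Mapping.lookup (mon h) e) - int (Poly_Mapping.lookup (mon (\<lambda>e. - h e)) e)) x = bal h x" for x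
    unfolding bal_def by (intro sum.cong) (auto simp: lookup_mon)
  then show ?thesis using assms by (subst balanced_iff_bal) (auto simp: lookup_mon)
qed

text \<open>Summing the vertex conditions counts every edge twice, so the toric ideal is
  homogeneous.\<close>

lemma degree_balanced:
  assumes "balanced E u v" shows "(\<Sum>e\<in>E. Poly_Mapping.lookup u e) = (\<Sum>e\<in>E. Poly_Mapping.lookup v e)"
proof -
  have fV: "finite V" using graph by (simp add: simple_graph_def)
  have "(\<Sum>x\<in>V. \<Sum>e\<in>{e\<in>E. x \<in> e}. Poly_Mapping.lookup u e) = 2 * (\<Sum>e\<in>E. Poly_Mapping.lookup u e)" for u :: "'v set \<Rightarrow>\<^sub>0 nat"
  proof -
    have "(\<Sum>x\<in>V. \<Sum>e\<in>{e\<in>E. x \<in> e}. Poly_Mapping.lookup u e) = (\<Sum>e\<in>E. \<Sum>x\<in>{x\<in>V. x \<in> e}. Poly_Mapping.lookup u e)"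
      by (rule sum.swap_restrict[OF fV finite_E])
    also have "\<dots> = (\<Sum>e\<in>E. 2 * Poly_Mapping.lookup u e)"
    proof (rule sum.cong)
      fix e assume "e \<in> E"
      then have "{x\<in>V. x \<in> e} = e" "card e = 2" using graph by (auto simp: simple_graph_def)
      then show "(\<Sum>x\<in>{x\<in>V. x \<in> e}. Poly_Mapping.lookup u e) = 2 * Poly_Mapping.lookup u e" by simp
    qed simp
    finally show ?thesis by (simp add: sum_distrib_left)
  qed
  from this[of u] this[of v] show ?thesis using assms by (simp add: balanced_def)
qed

end

section \<open>Primitivity of the walk and membership of its binomial\<close>

locale primitive_graph_walk = graph_walk V E ws for V :: "'v set" and E ws +
  assumes primitive: "primitive_walk E ws"
begin

lemma primitiveD:
  assumes "u \<in> mons E" "v \<in> mons E" "balanced E u v" "u \<noteq> v" "mdvd u p" "mdvd v q"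
  shows "u = p" "v = q"
  using primitive assms unfolding primitive_walk_def by blast+

lemma p_neq_q: "p \<noteq> q" using primitive by (simp add: primitive_walk_def)

text \<open>Cancelling a common edge from both terms would leave a smaller binomial of the ideal,
  against primitivity.\<close>

lemma pq_disjoint: "Poly_Mapping.lookup p e = 0 \<or> Poly_Mapping.lookup q e = 0"
proof (rule ccontr)
  assume *: "\<not> ?thesis"
  let ?s = "Poly_Mapping.single e (1::nat)"
  have "mdvd ?s p" "mdvd ?s q" using * by (auto simp: mdvd_def lookup_single when_def)
  then obtain u v where u: "p = ?s + u" "u \<in> mons E" and v: "q = ?s + v" "v \<in> mons E"
    using pq_mons by (metis mdvdE)
  have "balanced E (u + ?s) (v + ?s)" using balanced_pq unfolding u(1) v(1) by (simp only: add.commute)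
  then have "balanced E u v" by simp
  moreover have "u \<noteq> v" using p_neq_q u v by auto
  moreover have "mdvd u p" "mdvd v q" unfolding u v by (auto simp: mdvd_def lookup_add)
  ultimately have "u = p" using primitiveD u v by blast
  then have "Poly_Mapping.lookup p e = Poly_Mapping.lookup (?s + p) e" using u by simp
  then show False by (simp add: lookup_add)
qed

lemma lookup_p_pos: "int (Poly_Mapping.lookup p e) = max 0 (b e)" and lookup_q_pos: "int (Poly_Mapping.lookup q e) = max 0 (- b e)"
  using pq_disjoint[of e] b_eq[of e] by auto

lemma mdvd_mon_p: "(\<And>e. e \<in> W \<Longrightarrow> h e \<le> max 0 (b e)) \<Longrightarrow> mdvd (mon h) p"
  and mdvd_mon_q: "(\<And>e. e \<in> W \<Longrightarrow> h e \<le> max 0 (- b e)) \<Longrightarrow> mdvd (mon h) q"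
  unfolding mdvd_def lookup_mon by (auto simp: nat_le_iff simp flip: lookup_p_pos lookup_q_pos)

text \<open>Primitivity passes from monomials to vectors: the positive and negative parts of
  \<open>h\<close> divide \<open>E^+\<close> and \<open>E^-\<close>, so they either agree, which
  gives \<open>h = 0\<close> on \<open>W\<close>, or are these two monomials.\<close>

sublocale prim_walk f n
proof
  fix k l assume eq: "Ed k = Ed l"
  have p_pos: "Poly_Mapping.lookup p (Ed i) > 0" if "even i" for i
  proof -
    have "even (i mod n)" "i mod n < n" "Ed (i mod n) = Ed i"
      using that n_even n_pos by (auto simp: Ed_eq dvd_mod)
    then show ?thesis unfolding lookup_p by (intro sum_pos2[of _ "i mod n"]) auto
  qed
  have q_pos: "Poly_Mapping.lookup q (Ed i) > 0" if "odd i" for i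
  proof -
    have "odd (i mod n)" "i mod n < n" "Ed (i mod n) = Ed i"
      using that n_even n_pos by (auto simp: Ed_eq dvd_mod_iff)
    then show ?thesis unfolding lookup_q by (intro sum_pos2[of _ "i mod n"]) auto
  qed
  show "even k = even l" using p_pos[of k] p_pos[of l] q_pos[of k] q_pos[of l] eq pq_disjoint[of "Ed k"]
    by (cases "even k"; cases "even l") auto
next
  fix h :: "'v set \<Rightarrow> int"
  assume h: "\<And>x. bal h x = 0" "\<And>e. e \<in> W \<Longrightarrow> 0 \<le> h e \<and> h e \<le> b e \<or> b e \<le> h e \<and> h e \<le> 0"
  let ?u = "mon h" and ?v = "mon (\<lambda>e. - h e)"
  show "(\<forall>e\<in>W. h e = 0) \<or> (\<forall>e\<in>W. h e = b e)"
  proof (cases "?u = ?v")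
    case True
    have "h e = 0" if "e \<in> W" for e
      using arg_cong[OF True, of "\<lambda>m. Poly_Mapping.lookup m e"] that by (auto simp: lookup_mon)
    then show ?thesis by blast
  next
    case False
    have "mdvd ?u p" "mdvd ?v q" using h(2) by (force intro: mdvd_mon_p mdvd_mon_q)+
    then have eq: "?u = p" "?v = q"
      using primitiveD[OF mon_mons mon_mons balanced_mon[OF h(1)] False] by blast+
    have "h e = b e" if "e \<in> W" for e
      using arg_cong[OF eq(1), of "\<lambda>m. Poly_Mapping.lookup m e"] arg_cong[OF eq(2), of "\<lambda>m. Poly_Mapping.lookup m e"] that
      by (auto simp: lookup_mon b_eq)
    then show ?thesis by blast
  qed
qed

lemma plus_edge_iff: "e \<in> W \<Longrightarrow> e \<in> walk_plus_edges ws \<longleftrightarrow> b e > 0"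
  and minus_edge_iff: "e \<in> W \<Longrightarrow> e \<in> walk_minus_edges ws \<longleftrightarrow> b e < 0"
proof -
  have walk_Ed: "walk_edge ws j = Ed j" if "j < n" for j using that by (simp add: Ed_eq)
  assume "e \<in> W"
  then obtain k where k: "k < n" "e = Ed k" by (auto simp: W_def)
  have "e \<in> walk_plus_edges ws \<longleftrightarrow> even k"
  proof
    assume "e \<in> walk_plus_edges ws"
    then obtain j where "j < n" "even j" "e = walk_edge ws j" by (auto simp: walk_plus_edges_def)
    then show "even k" using k sgn[of j k] walk_Ed[of j] by simp
  next
    assume "even k"
    then show "e \<in> walk_plus_edges ws" using k walk_Ed[of k] by (auto simp: walk_plus_edges_def)
  qed
  then show "e \<in> walk_plus_edges ws \<longleftrightarrow> b e > 0" using k b_pos_iff by simp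
  have "e \<in> walk_minus_edges ws \<longleftrightarrow> odd k"
  proof
    assume "e \<in> walk_minus_edges ws"
    then obtain j where "j < n" "odd j" "e = walk_edge ws j" by (auto simp: walk_minus_edges_def)
    then show "odd k" using k sgn[of j k] walk_Ed[of j] by simp
  next
    assume "odd k"
    then show "e \<in> walk_minus_edges ws" using k walk_Ed[of k] by (auto simp: walk_minus_edges_def)
  qed
  then show "e \<in> walk_minus_edges ws \<longleftrightarrow> b e < 0" using k b_neg_iff by simp
qed

text \<open>The supporting functional of \<open>mixed_weight\<close> is turned into positive integer
  weights on all of \<open>E\<close>, to which \<open>edge_in_universal\<close> applies.\<close>

lemma mixed_in_universal:
  assumes mixed: "mixed_walk ws"
  shows "(binom p q :: ('v set \<Rightarrow>\<^sub>0 nat) \<Rightarrow>\<^sub>0 'k::field) \<in> universal_groebner_basis E (toric_ideal E) \<or>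
    - (binom p q :: ('v set \<Rightarrow>\<^sub>0 nat) \<Rightarrow>\<^sub>0 'k::field) \<in> universal_groebner_basis E (toric_ideal E)"
proof -
  have blocks: "\<forall>VC EC. cyclic_block (range f) W VC EC \<longrightarrow> (\<exists>e\<in>EC. \<exists>e'\<in>EC. b e > 0 \<and> b e' < 0)"
  proof (intro allI impI)
    fix VC EC assume C: "cyclic_block (range f) W VC EC"
    have "\<not> pure_block ws EC" using mixed C by (auto simp: mixed_walk_def range_eq W_eq)
    then obtain e e' where e: "e \<in> EC" "e \<notin> walk_minus_edges ws" "e' \<in> EC" "e' \<notin> walk_plus_edges ws"
      unfolding pure_block_def by blast
    then have "e \<in> W" "e' \<in> W" using cyclic_blockD(6)[OF C] by auto
    moreover have "b d \<noteq> 0" if "d \<in> W" for d using that b_nonzero by (auto simp: W_def)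
    ultimately have "b e \<noteq> 0" "b e' \<noteq> 0" "\<not> b e < 0" "\<not> b e' > 0"
      using e plus_edge_iff[of e'] minus_edge_iff[of e] by blast+
    then have "b e > 0" "b e' < 0" by linarith+
    then show "\<exists>e\<in>EC. \<exists>e'\<in>EC. b e > 0 \<and> b e' < 0" using e by blast
  qed
  obtain \<omega> where \<omega>: "(\<Sum>e\<in>W. \<omega> e * b e) = 0"
    "\<And>h. admissible h \<Longrightarrow> (\<Sum>e\<in>W. \<omega> e * h e) \<le> 0 \<Longrightarrow> (\<forall>e\<in>W. h e = 0) \<or> (\<forall>e\<in>W. h e = b e)"
    by (rule mixed_weight[OF blocks], rule that)
  \<comment> \<open>All members of a fiber have the same degree, so adding the constant \<open>K\<close> makes the weights
    positive without changing comparisons; \<open>M\<close> excludes the edges outside the walk.\<close>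
  define K where "K = 1 + (\<Sum>e\<in>W. \<bar>\<omega> e\<bar>)"
  have K: "K + \<omega> e > 0" if "e \<in> W" for e
    using member_le_sum[of e W "\<lambda>e. \<bar>\<omega> e\<bar>"] that by (simp add: K_def)
  define M where "M = 1 + (\<Sum>e\<in>W. nat (K + \<omega> e) * Poly_Mapping.lookup p e)"
  define wt where "wt e = (if e \<in> W then nat (K + \<omega> e) else M)" for e
  have pos: "wt e > 0" for e using K by (auto simp: wt_def M_def)
  have wt_inside: "int (weight E wt m) = K * int (\<Sum>e\<in>E. Poly_Mapping.lookup m e) + (\<Sum>e\<in>W. \<omega> e * int (Poly_Mapping.lookup m e))"
    if "\<And>e. e \<notin> W \<Longrightarrow> Poly_Mapping.lookup m e = 0" for m
  proof -
    have "int (weight E wt m) = (\<Sum>e\<in>W. int (wt e * Poly_Mapping.lookup m e))"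
      unfolding weight_def of_nat_sum using W_subset_E finite_E that
      by (intro sum.mono_neutral_right) auto
    also have "\<dots> = (\<Sum>e\<in>W. K * int (Poly_Mapping.lookup m e) + \<omega> e * int (Poly_Mapping.lookup m e))"
      using K by (intro sum.cong) (auto simp: wt_def algebra_simps less_imp_le)
    also have "\<dots> = K * (\<Sum>e\<in>W. int (Poly_Mapping.lookup m e)) + (\<Sum>e\<in>W. \<omega> e * int (Poly_Mapping.lookup m e))"
      by (simp add: sum.distrib sum_distrib_left)
    also have "(\<Sum>e\<in>W. int (Poly_Mapping.lookup m e)) = int (\<Sum>e\<in>E. Poly_Mapping.lookup m e)"
      unfolding of_nat_sum using W_subset_E finite_E that by (intro sum.mono_neutral_left) auto
    finally show ?thesis .
  qed
  have wp: "weight E wt p < M"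
  proof -
    have "weight E wt p = (\<Sum>e\<in>W. wt e * Poly_Mapping.lookup p e)"
      unfolding weight_def using W_subset_E finite_E lookup_outside_W
      by (intro sum.mono_neutral_right) auto
    also have "\<dots> = (\<Sum>e\<in>W. nat (K + \<omega> e) * Poly_Mapping.lookup p e)" by (intro sum.cong) (auto simp: wt_def)
    finally show ?thesis by (simp add: M_def)
  qed
  show ?thesis
  proof (rule edge_in_universal[OF finite_E pos pq_mons balanced_pq p_neq_q _ pq_disjoint])
    have "(\<Sum>e\<in>W. \<omega> e * int (Poly_Mapping.lookup p e)) - (\<Sum>e\<in>W. \<omega> e * int (Poly_Mapping.lookup q e)) = 0"
      using \<omega>(1) by (simp add: b_eq algebra_simps sum_subtractf)
    then have "int (weight E wt p) = int (weight E wt q)"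
      using wt_inside[OF lookup_outside_W(1)] wt_inside[OF lookup_outside_W(2)] degree_balanced[OF balanced_pq] by simp
    then show wpq: "weight E wt p = weight E wt q" by simp
    fix m assume m: "m \<in> mons E" "balanced E p m" "weight E wt m \<le> weight E wt p"
    \<comment> \<open>A single variable outside the walk already has weight \<open>M\<close>, more
      than the whole of \<open>p\<close>.\<close>
    have outside: "Poly_Mapping.lookup m e = 0" if "e \<notin> W" for e
    proof (rule ccontr)
      assume ne: "Poly_Mapping.lookup m e \<noteq> 0"
      then have "e \<in> E" using m(1) by (auto simp: mons_iff)
      then have "wt e * Poly_Mapping.lookup m e \<le> weight E wt m"
        unfolding weight_def using finite_E by (intro member_le_sum) auto
      moreover have "M \<le> wt e * Poly_Mapping.lookup m e" using that ne by (simp add: wt_def)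
      ultimately show False using wp m(3) by simp
    qed
    let ?h = "\<lambda>e. int (Poly_Mapping.lookup m e) - int (Poly_Mapping.lookup q e)"
    have mq: "balanced E m q" using m(2) balanced_pq balanced_sym balanced_trans by blast
    have "\<forall>x. bal ?h x = 0"
      using balanced_iff_bal[of m q] mq outside lookup_outside_W(2) by simp
    moreover have "min 0 (b e) \<le> ?h e" for e using lookup_q_pos[of e] by auto
    ultimately have adm: "admissible ?h" by (simp add: admissible_def)
    have "int (weight E wt m) \<le> int (weight E wt q)" using m(3) wpq by simp
    then have "(\<Sum>e\<in>W. \<omega> e * ?h e) \<le> 0"
      using wt_inside[OF outside] wt_inside[OF lookup_outside_W(2)] degree_balanced[OF mq]
      by (simp add: algebra_simps sum_subtractf)
    then have "(\<forall>e\<in>W. ?h e = 0) \<or> (\<forall>e\<in>W. ?h e = b e)" by (rule \<omega>(2)[OF adm])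
    then show "m = p \<or> m = q"
    proof
      assume *: "\<forall>e\<in>W. ?h e = 0"
      have "m = q"
      proof (rule poly_mapping_eqI)
        fix e show "Poly_Mapping.lookup m e = Poly_Mapping.lookup q e"
          using * outside lookup_outside_W(2) by (cases "e \<in> W") auto
      qed
      then show ?thesis ..
    next
      assume *: "\<forall>e\<in>W. ?h e = b e"
      have "m = p"
      proof (rule poly_mapping_eqI)
        fix e show "Poly_Mapping.lookup m e = Poly_Mapping.lookup p e"
          using * outside lookup_outside_W(1) b_eq[of e] by (cases "e \<in> W") auto
      qed
      then show ?thesis ..
    qed
  qed
qed

text \<open>The positive and negative parts of the vectors \<open>H t\<close> are the monomials
  required by \<open>no_divisor_family\<close>. Stating it for \<open>P\<close>, \<open>Q\<close>
  and \<open>\<tau>\<close> treats both choices of the leading term at once.\<close>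

lemma pure_not_leading:
  fixes g :: "('v set \<Rightarrow>\<^sub>0 nat) \<Rightarrow>\<^sub>0 'k::field"
  assumes C: "cyclic_block (range f) W VC EC" and pure: "\<And>e. e \<in> EC \<Longrightarrow> b e = \<sigma>"
    and \<sigma>: "\<sigma> = 1 \<or> \<sigma> = -1" and \<tau>: "\<tau> = 1 \<or> \<tau> = -1"
    and ord: "term_order E ord" and G: "is_reduced_groebner_basis ord (toric_ideal E) G" "g \<in> G"
    and PQ: "P \<in> mons E" "Q \<in> mons E" "P \<noteq> Q" "Poly_Mapping.keys g = {P, Q}" "lm ord g = P"
    and P: "\<And>e. int (Poly_Mapping.lookup P e) = max 0 (\<tau> * b e)" and Q: "\<And>e. int (Poly_Mapping.lookup Q e) = max 0 (- (\<tau> * b e))"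
    and outside: "\<And>e. e \<notin> W \<Longrightarrow> Poly_Mapping.lookup P e = 0" "\<And>e. e \<notin> W \<Longrightarrow> Poly_Mapping.lookup Q e = 0"
  shows False
proof -
  obtain H and N :: nat where N: "N > 0" and sumH: "\<forall>e\<in>W. (\<Sum>t\<in>EC. H t e) = int N * (\<tau> * b e)" and
    H: "\<forall>t\<in>EC. (\<forall>x. bal (H t) x = 0) \<and> (\<forall>e\<in>W. H t e \<le> max 0 (\<tau> * b e)) \<and>
       (\<exists>e\<in>W. 0 < \<tau> * b e \<and> H t e \<le> 0)"
    using pure_family[OF C pure \<sigma> \<tau>] by blast
  let ?u = "\<lambda>t. mon (H t)" and ?v = "\<lambda>t. mon (\<lambda>e. - H t e)"
  show False
  proof (rule no_divisor_family[OF finite_E ord G PQ _ N])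
    fix t assume t: "t \<in> EC"
    have "mdvd (?u t) P"
      unfolding mdvd_def lookup_mon using H t by (auto simp flip: P simp: nat_le_iff)
    moreover obtain e where e: "e \<in> W" "0 < \<tau> * b e" "H t e \<le> 0" using H t by blast
    have "Poly_Mapping.lookup (?u t) e \<noteq> Poly_Mapping.lookup P e" using e P[of e] by (auto simp: lookup_mon)
    then have "?u t \<noteq> P" by auto
    moreover have "balanced E (?u t) (?v t)" using H t by (intro balanced_mon) blast
    ultimately show "?u t \<in> mons E \<and> ?v t \<in> mons E \<and> balanced E (?u t) (?v t) \<and> mdvd (?u t) P \<and> ?u t \<noteq> P"
      using mon_mons by blast
  next
    show "(\<Sum>t\<in>EC. ?u t) + (\<Sum>i<N. Q) = (\<Sum>t\<in>EC. ?v t) + (\<Sum>i<N. P)"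
    proof (rule poly_mapping_eqI)
      fix e
      have "int (Poly_Mapping.lookup ((\<Sum>t\<in>EC. ?u t) + (\<Sum>i<N. Q)) e) = int (Poly_Mapping.lookup ((\<Sum>t\<in>EC. ?v t) + (\<Sum>i<N. P)) e)"
      proof (cases "e \<in> W")
        case True
        \<comment> \<open>Splitting every \<open>H t\<close> into positive and negative part turns
          the vector identity for the sum into an identity of monomials.\<close>
        have "(\<Sum>t\<in>EC. int (nat (H t e))) - (\<Sum>t\<in>EC. int (nat (- H t e))) = (\<Sum>t\<in>EC. H t e)"
          unfolding sum_subtractf[symmetric] by (intro sum.cong) auto
        then have "(\<Sum>t\<in>EC. int (nat (H t e))) - (\<Sum>t\<in>EC. int (nat (- H t e))) = int N * (\<tau> * b e)"
          using sumH True by simp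
        moreover have "\<tau> * b e = int (Poly_Mapping.lookup P e) - int (Poly_Mapping.lookup Q e)" using P[of e] Q[of e] by auto
        ultimately show ?thesis using True
          by (simp add: lookup_add lookup_sum lookup_mon algebra_simps)
      next
        case False
        then show ?thesis using outside by (simp add: lookup_add lookup_sum lookup_mon)
      qed
      then show "Poly_Mapping.lookup ((\<Sum>t\<in>EC. ?u t) + (\<Sum>i<N. Q)) e = Poly_Mapping.lookup ((\<Sum>t\<in>EC. ?v t) + (\<Sum>i<N. P)) e"
        by (simp only: of_nat_eq_iff)
    qed
  qed
qed

text \<open>Only the monomials of \<open>g\<close> are prescribed, which covers the binomial and its
  negative together; each of the two possible leading terms is excluded.\<close>

lemma pure_not_in_universal:
  fixes g :: "('v set \<Rightarrow>\<^sub>0 nat) \<Rightarrow>\<^sub>0 'k::field"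
  assumes nm: "\<not> mixed_walk ws" and g: "Poly_Mapping.keys g = {p, q}"
  shows "g \<notin> universal_groebner_basis E (toric_ideal E)"
proof
  assume "g \<in> universal_groebner_basis E (toric_ideal E)"
  then obtain ord G where ord: "term_order E ord" and
    G: "is_reduced_groebner_basis ord (toric_ideal E) G" "g \<in> G"
    unfolding universal_groebner_basis_def by blast
  obtain VC EC where C: "cyclic_block (range f) W VC EC" and pure: "pure_block ws EC"
    using nm by (auto simp: mixed_walk_def range_eq W_eq)
  note CD = cyclic_blockD[OF C]
  have coeff: "b e = 1 \<or> b e = -1" if e: "e \<in> EC" for e
  proof -
    obtain k where "e = Ed k" using CD(6)[OF e] by (auto simp: W_def)
    then show ?thesis using cyclic_block_coeff[OF C] e by (cases "even k") auto
  qed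
  obtain \<sigma> where \<sigma>: "\<sigma> = 1 \<or> \<sigma> = -1" "\<And>e. e \<in> EC \<Longrightarrow> b e = \<sigma>"
  proof (cases "EC \<subseteq> walk_plus_edges ws")
    case True
    then have "b e = 1" if "e \<in> EC" for e using coeff[OF that] plus_edge_iff CD(6) that by force
    then show ?thesis using that[of 1] by simp
  next
    case False
    then have "EC \<subseteq> walk_minus_edges ws" using pure by (simp add: pure_block_def)
    then have "b e = -1" if "e \<in> EC" for e using coeff[OF that] minus_edge_iff CD(6) that by force
    then show ?thesis using that[of "-1"] by simp
  qed
  interpret toric_order E ord using ord finite_E by unfold_locales
  have "g \<noteq> 0" "Poly_Mapping.keys g \<subseteq> mons E" using g pq_mons by auto
  then have "lm ord g = p \<or> lm ord g = q" using lm_in_keys(1) g by blast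
  then show False
  proof
    assume "lm ord g = p"
    then show False
      using pure_not_leading[OF C \<sigma>(2,1) _ ord G pq_mons p_neq_q g, of 1]
        lookup_p_pos lookup_q_pos lookup_outside_W by simp
  next
    assume "lm ord g = q"
    then show False
      using pure_not_leading[OF C \<sigma>(2,1) _ ord G pq_mons(2,1) p_neq_q[symmetric], of "-1"] g
        lookup_p_pos lookup_q_pos lookup_outside_W by (simp add: insert_commute)
  qed
qed

end

text \<open>Elements of a reduced basis are monic, so the term order determines which of
  \<open>B_w\<close> and \<open>- B_w\<close> can occur; membership is therefore meant up to
  sign.\<close>

theorem theorem3p4:
  fixes V :: "'v set" and E :: "'v set set" and ws :: "'v list"
  assumes "simple_graph V E"
    and "connected_graph V E"
    and "even_closed_walk E ws"
    and "primitive_walk E ws"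
  shows "((binom (Eplus ws) (Eminus ws) :: ('v set \<Rightarrow>\<^sub>0 nat) \<Rightarrow>\<^sub>0 'k::field)
             \<in> universal_groebner_basis E (toric_ideal E)
          \<or> - (binom (Eplus ws) (Eminus ws) :: ('v set \<Rightarrow>\<^sub>0 nat) \<Rightarrow>\<^sub>0 'k)
             \<in> universal_groebner_basis E (toric_ideal E))
         \<longleftrightarrow> mixed_walk ws"
proof -
  interpret primitive_graph_walk V E ws using assms by unfold_locales
  have "Poly_Mapping.keys (binom p q :: ('v set \<Rightarrow>\<^sub>0 nat) \<Rightarrow>\<^sub>0 'k) = {p, q}"
    using keys_binom[OF p_neq_q] .
  moreover have "Poly_Mapping.keys (- binom p q :: ('v set \<Rightarrow>\<^sub>0 nat) \<Rightarrow>\<^sub>0 'k) = {p, q}"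
    unfolding uminus_binom using keys_binom[OF p_neq_q[symmetric]] by (simp add: insert_commute)
  ultimately show ?thesis using mixed_in_universal pure_not_in_universal by blast
qed

end
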